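(* Let $k$ be a perfect field with $\operatorname{char}k\ne2$ and let $A$ be a split finite-dimensional local commutative $k$-algebra with Jacobson radical $J$ and $\dim_k(J/J^2)=n$. Suppose $A\cong k[X_1,\dots,X_n]/I$ with $I=\langle X_1,\dots,X_n\rangle^l+\langle q\rangle$, where $l>2$ is the Loewy length of $A$ and $(J/J^2,q)$ is an anisotropic quadratic space over $k$. Then $G_A$ is not a $k$-split group.
   Context: $A$ is split local if $A/J\cong k$. A split local commutative algebra has a presentation $A\cong k[X_1,\dots,X_n]/I$ (quiver and relations) with $\langle X_1,\dots,X_n\rangle^l\subseteq I\subseteq\langle X_1,\dots,X_n\rangle^2$ for some $l\ge2$; the minimal such $l$ is the Loewy length of $A$. Here $q$ is a quadratic form in $X_1,\dots,X_n$, viewed as a quadratic form on the $n$-dimensional space $J/J^2$ via the basis of classes of the $X_i$. $\mathrm{Aut}_k(A)$ is regarded as the affine algebraic $k$-group $B\mapsto\mathrm{Aut}_B(A\otimes_kB)$, and $G_A$ is its identity component. $G_A$ is $k$-split if it contains a maximal torus that is split over $k$. *)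

theory Defs
  imports "HOL-Analysis.Analysis" "HOL-Library.Poly_Mapping"
    "HOL-Algebra.Algebraic_Closure_Type"
begin

no_notation fps_nth (infixl \<open>$\<close> 75)

section \<open>Ideals of commutative rings and fields\<close>

lemma module_times: "Modules.module ((*) :: 'r::comm_ring_1 \<Rightarrow> 'r \<Rightarrow> 'r)"
  by unfold_locales (simp_all add: algebra_simps)

abbreviation ring_ideal :: "'r::comm_ring_1 set \<Rightarrow> bool"
  where "ring_ideal \<equiv> Modules.module.subspace (*)"

abbreviation ideal_gen :: "'r::comm_ring_1 set \<Rightarrow> 'r set"
  where "ideal_gen \<equiv> Modules.module.span (*)"

definition ideal_prod :: "'r::comm_ring_1 set \<Rightarrow> 'r set \<Rightarrow> 'r set"
  where "ideal_prod I J = ideal_gen {x * y | x y. x \<in> I \<and> y \<in> J}"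

primrec ideal_pow :: "'r::comm_ring_1 set \<Rightarrow> nat \<Rightarrow> 'r set"
  where
    "ideal_pow I 0 = UNIV"
  | "ideal_pow I (Suc n) = ideal_prod I (ideal_pow I n)"

definition prime_ideal :: "'r::comm_ring_1 set \<Rightarrow> bool"
  where "prime_ideal P \<longleftrightarrow>
    ring_ideal P \<and> P \<noteq> UNIV \<and> (\<forall>x y. x * y \<in> P \<longrightarrow> x \<in> P \<or> y \<in> P)"

definition maximal_ideal :: "'r::comm_ring_1 set \<Rightarrow> bool"
  where "maximal_ideal M \<longleftrightarrow>
    ring_ideal M \<and> M \<noteq> UNIV \<and> (\<forall>I. ring_ideal I \<and> M \<subseteq> I \<longrightarrow> I = M \<or> I = UNIV)"

definition jacobson_radical :: "'r::comm_ring_1 set"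
  where "jacobson_radical = \<Inter>{M. maximal_ideal M}"

definition local_ring :: "'r::comm_ring_1 itself \<Rightarrow> bool"
  where "local_ring _ \<longleftrightarrow> (\<exists>!M :: 'r set. maximal_ideal M)"

text \<open>Every irreducible polynomial is separable.\<close>

definition perfect_field :: "'k::field itself \<Rightarrow> bool"
  where "perfect_field _ \<longleftrightarrow>
    (\<forall>p :: 'k poly. Factorial_Ring.irreducible p \<longrightarrow> rsquarefree (map_poly to_ac p))"


section \<open>Commutative algebras over a field\<close>

locale comm_algebra = vector_space smul
  for smul :: "'k::field \<Rightarrow> 'a::comm_ring_1 \<Rightarrow> 'a" +
  assumes smul_mult: "smul c (x * y) = smul c x * y"

definition algebra_hom ::
    "('k::field \<Rightarrow> 'a::comm_ring_1 \<Rightarrow> 'a) \<Rightarrow> ('k \<Rightarrow> 'b::comm_ring_1 \<Rightarrow> 'b) \<Rightarrow> ('a \<Rightarrow> 'b) \<Rightarrow> bool"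
  where "algebra_hom s1 s2 f \<longleftrightarrow>
    Vector_Spaces.linear s1 s2 f \<and> f 1 = 1 \<and> (\<forall>x y. f (x * y) = f x * f y)"

text \<open>The algebra isomorphism $A/J \cong k$ is given as a surjection $A \to k$ with kernel $J$.\<close>

definition split_local :: "('k::field \<Rightarrow> 'a::comm_ring_1 \<Rightarrow> 'a) \<Rightarrow> bool"
  where "split_local smul \<longleftrightarrow> local_ring TYPE('a) \<and>
    (\<exists>f. algebra_hom smul (*) f \<and> surj f \<and> {x. f x = 0} = jacobson_radical)"

text \<open>The quotient $U/W$ of a subspace $U$ by a subspace $W \subseteq U$ has a basis consisting
  of the classes of $b_0, \dots, b_{n-1}$.\<close>

definition quotient_dim ::
    "('k::field \<Rightarrow> 'a::comm_ring_1 \<Rightarrow> 'a) \<Rightarrow> 'a set \<Rightarrow> 'a set \<Rightarrow> nat \<Rightarrow> bool"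
  where "quotient_dim smul U W n \<longleftrightarrow>
    (\<exists>b :: nat \<Rightarrow> 'a. b ` {..<n} \<subseteq> U \<and>
      (\<forall>u\<in>U. \<exists>!c. c \<in> extensional {..<n} \<and> u - (\<Sum>i<n. smul (c i) (b i)) \<in> W))"


section \<open>Multivariate polynomials\<close>

text \<open>Polynomials over \<open>'k\<close> with variables indexed by \<open>'x\<close>: finitely supported coefficient
  functions on monomials, which are finitely supported exponent functions.\<close>

type_synonym ('x, 'k) mpoly = "('x \<Rightarrow>\<^sub>0 nat) \<Rightarrow>\<^sub>0 'k"

definition mp_const :: "'k::comm_ring_1 \<Rightarrow> ('x, 'k) mpoly"
  where "mp_const c = Poly_Mapping.single 0 c"

definition mp_var :: "'x \<Rightarrow> ('x, 'k::comm_ring_1) mpoly"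
  where "mp_var i = Poly_Mapping.single (Poly_Mapping.single i 1) 1"

definition mp_scale :: "'k::comm_ring_1 \<Rightarrow> ('x, 'k) mpoly \<Rightarrow> ('x, 'k) mpoly"
  where "mp_scale c f = mp_const c * f"

text \<open>Evaluation at \<open>x\<close>, where the coefficients are mapped to the target ring along \<open>h\<close>.\<close>

definition mp_eval :: "('k::comm_ring_1 \<Rightarrow> 'b::comm_ring_1) \<Rightarrow> ('x \<Rightarrow> 'b) \<Rightarrow> ('x, 'k) mpoly \<Rightarrow> 'b"
  where "mp_eval h x f = (\<Sum>m\<in>Poly_Mapping.keys f.
    h (Poly_Mapping.lookup f m) * (\<Prod>i\<in>Poly_Mapping.keys m. x i ^ Poly_Mapping.lookup m i))"

lemma mp_eval_superset:
  assumes "h 0 = 0" "finite S" "Poly_Mapping.keys f \<subseteq> S"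
  shows "mp_eval h x f = (\<Sum>m\<in>S. h (Poly_Mapping.lookup f m) *
    (\<Prod>i\<in>Poly_Mapping.keys m. x i ^ Poly_Mapping.lookup m i))"
  unfolding mp_eval_def
  by (rule sum.mono_neutral_left) (use assms in \<open>auto simp: in_keys_iff\<close>)

context
  fixes h :: "'k::comm_ring_1 \<Rightarrow> 'b::comm_ring_1" and x :: "'x \<Rightarrow> 'b"
  assumes h_add: "\<And>a b. h (a + b) = h a + h b"
    and h_mult: "\<And>a b. h (a * b) = h a * h b"
    and h_1: "h 1 = 1"
begin

private lemma h_0: "h 0 = 0"
  using h_add[of 0 0] by simp

private lemma monomial_add:
  "(\<Prod>i\<in>Poly_Mapping.keys (m + n). x i ^ Poly_Mapping.lookup (m + n) i) =
   (\<Prod>i\<in>Poly_Mapping.keys m. x i ^ Poly_Mapping.lookup m i) *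
   (\<Prod>i\<in>Poly_Mapping.keys n. x i ^ Poly_Mapping.lookup n i)"
proof -
  let ?S = "Poly_Mapping.keys m \<union> Poly_Mapping.keys n"
  have *: "(\<Prod>i\<in>Poly_Mapping.keys k. x i ^ Poly_Mapping.lookup k i) =
      (\<Prod>i\<in>?S. x i ^ Poly_Mapping.lookup k i)" if "Poly_Mapping.keys k \<subseteq> ?S" for k
    by (rule prod.mono_neutral_left) (use that in \<open>auto simp: in_keys_iff\<close>)
  show ?thesis
    by (subst (1 2 3) *) (auto simp: lookup_add power_add prod.distrib dest: subsetD[OF Poly_Mapping.keys_add])
qed

lemma mp_eval_add: "mp_eval h x (f + g) = mp_eval h x f + mp_eval h x g"
proof -
  let ?S = "Poly_Mapping.keys f \<union> Poly_Mapping.keys g"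
  show ?thesis
    by (subst (1 2 3) mp_eval_superset[of h ?S])
      (auto simp: h_0 lookup_add h_add sum.distrib distrib_right dest: subsetD[OF Poly_Mapping.keys_add])
qed

lemma mp_eval_sum: "mp_eval h x (sum F S) = (\<Sum>s\<in>S. mp_eval h x (F s))"
  by (induction S rule: infinite_finite_induct) (auto simp: mp_eval_add, simp_all add: mp_eval_def)

lemma mp_eval_single: "mp_eval h x (Poly_Mapping.single m c) =
    h c * (\<Prod>i\<in>Poly_Mapping.keys m. x i ^ Poly_Mapping.lookup m i)"
  by (simp add: mp_eval_def h_0)

lemma mp_eval_mult: "mp_eval h x (f * g) = mp_eval h x f * mp_eval h x g"
proof -
  have single: "f = (\<Sum>m\<in>Poly_Mapping.keys f. Poly_Mapping.single m (Poly_Mapping.lookup f m))"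
    for f :: "('x, 'k) mpoly"
    by (rule poly_mapping_eqI)
      (auto simp: lookup_sum lookup_single when_def in_keys_iff sum.delta)
  have "mp_eval h x (f * g) = mp_eval h x
      ((\<Sum>m\<in>Poly_Mapping.keys f. Poly_Mapping.single m (Poly_Mapping.lookup f m)) *
       (\<Sum>m\<in>Poly_Mapping.keys g. Poly_Mapping.single m (Poly_Mapping.lookup g m)))"
    by (simp flip: single)
  also have "\<dots> = mp_eval h x f * mp_eval h x g"
    unfolding sum_product
    by (simp add: mp_eval_sum mult_single mp_eval_single monomial_add h_mult)
      (simp add: mp_eval_def sum_product ac_simps)
  finally show ?thesis .
qed

lemma mp_eval_const [simp]: "mp_eval h x (mp_const c) = h c"
  by (simp add: mp_const_def mp_eval_single)

lemma mp_eval_var [simp]: "mp_eval h x (mp_var i) = x i"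
  by (simp add: mp_var_def mp_eval_single h_1)

lemma mp_eval_1 [simp]: "mp_eval h x 1 = 1"
  using mp_eval_const[of 1] by (simp add: mp_const_def h_1)

lemma mp_eval_0 [simp]: "mp_eval h x 0 = 0"
  by (simp add: mp_eval_def)

lemma mp_eval_diff: "mp_eval h x (f - g) = mp_eval h x f - mp_eval h x g"
  by (metis mp_eval_add add_diff_cancel_right' diff_add_cancel)

lemma mp_eval_prod: "mp_eval h x (prod F S) = (\<Prod>s\<in>S. mp_eval h x (F s))"
  by (induction S rule: infinite_finite_induct) (auto simp: mp_eval_mult)

lemma mp_eval_of_int: "mp_eval h x (of_int z) = of_int z"
proof -
  have nat: "mp_eval h x (of_nat k) = of_nat k" for k
    by (induction k) (simp_all add: mp_eval_add)
  show ?thesis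
    by (cases z rule: int_diff_cases) (simp add: mp_eval_diff nat)
qed

lemma mp_eval_det: "mp_eval h x (det N) = det (\<chi> i j. mp_eval h x (N $ i $ j))"
  by (simp add: det_def mp_eval_sum mp_eval_mult mp_eval_of_int mp_eval_prod)

lemma mp_eval_vanish_ideal_gen:
  "(\<forall>f\<in>ideal_gen S. mp_eval h x f = 0) \<longleftrightarrow> (\<forall>f\<in>S. mp_eval h x f = 0)"
proof safe
  fix f assume S: "\<forall>f\<in>S. mp_eval h x f = 0" and "f \<in> ideal_gen S"
  from this(2) show "mp_eval h x f = 0"
    by (rule Modules.module.span_induct[OF module_times])
      (use S in \<open>auto simp: Modules.module.subspace_def[OF module_times] mp_eval_add mp_eval_mult\<close>)
qed (simp add: Modules.module.span_base[OF module_times])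

end

definition quadratic_form :: "('x, 'k::comm_ring_1) mpoly \<Rightarrow> bool"
  where "quadratic_form q \<longleftrightarrow>
    (\<forall>m\<in>Poly_Mapping.keys q. (\<Sum>i\<in>Poly_Mapping.keys m. Poly_Mapping.lookup m i) = 2)"

definition var_ideal :: "('x, 'k::comm_ring_1) mpoly set"
  where "var_ideal = ideal_gen (range mp_var)"

text \<open>For an ideal \<open>I\<close> presenting a split local algebra, \<open>l\<close> is its Loewy length.\<close>

definition loewy_length :: "('x, 'k::field) mpoly set \<Rightarrow> nat \<Rightarrow> bool"
  where "loewy_length I l \<longleftrightarrow>
    is_arg_min id (\<lambda>j. 2 \<le> j \<and> ideal_pow var_ideal j \<subseteq> I \<and> I \<subseteq> ideal_pow var_ideal 2) l"

text \<open>The form that \<open>q\<close> induces on $J/J^2$, expressed in the basis of the classes of the elements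
  \<open>x i\<close> of $J$, is anisotropic: if it takes the value 0 at a class, then this class is 0.\<close>

definition anisotropic_on_cotangent ::
    "('k::field \<Rightarrow> 'a::comm_ring_1 \<Rightarrow> 'a) \<Rightarrow> ('n::finite \<Rightarrow> 'a) \<Rightarrow> ('n, 'k) mpoly \<Rightarrow> bool"
  where "anisotropic_on_cotangent smul x q \<longleftrightarrow>
    (\<forall>c :: 'n \<Rightarrow> 'k. mp_eval id c q = 0 \<longrightarrow>
      (\<Sum>i\<in>UNIV. smul (c i) (x i)) \<in> ideal_pow jacobson_radical 2)"


section \<open>Closed subgroup schemes of the general linear group\<close>

text \<open>The coordinate ring of $GL_m$ over \<open>'k\<close> is the polynomial ring in the matrix entries and one
  further variable, modulo the relation that this variable times the determinant is 1. A closed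
  subscheme of $GL_m$ is represented by its ideal in the polynomial ring, which has to contain this
  relation; inclusion of subschemes is reverse inclusion of ideals.\<close>

datatype 'm gl_var = Entry 'm 'm | Inv_Det

type_synonym ('m, 'k) gl_poly = "('m gl_var, 'k) mpoly"

definition gl_point :: "'b^'m^'m \<Rightarrow> 'b \<Rightarrow> 'm gl_var \<Rightarrow> 'b"
  where "gl_point M d v = (case v of Entry i j \<Rightarrow> M $ i $ j | Inv_Det \<Rightarrow> d)"

definition var_matrix :: "('m gl_var \<Rightarrow> 'x) \<Rightarrow> ('x, 'k::comm_ring_1) mpoly^'m^'m"
  where "var_matrix g = (\<chi> i j. mp_var (g (Entry i j)))"

definition gl_relation :: "('m::finite, 'k::comm_ring_1) gl_poly"
  where "gl_relation = mp_var Inv_Det * det (var_matrix (\<lambda>v. v)) - 1"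

definition gl_counit :: "('m::finite, 'k::comm_ring_1) gl_poly \<Rightarrow> 'k"
  where "gl_counit = mp_eval id (gl_point (mat 1) 1)"

definition gl_comult ::
    "('m::finite, 'k::comm_ring_1) gl_poly \<Rightarrow> ('m gl_var + 'm gl_var, 'k) mpoly"
  where "gl_comult = mp_eval mp_const
    (gl_point (var_matrix Inl ** var_matrix Inr) (mp_var (Inl Inv_Det) * mp_var (Inr Inv_Det)))"

text \<open>The entry $(i,j)$ of the inverse of $X$ is, by Cramer's rule, the inverse determinant times
  the determinant of $X$ with its $i$-th column replaced by the $j$-th unit vector.\<close>

definition gl_antipode :: "('m::finite, 'k::comm_ring_1) gl_poly \<Rightarrow> ('m, 'k) gl_poly"
  where "gl_antipode = mp_eval mp_const
    (gl_point
      (\<chi> i j. mp_var Inv_Det *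
        det (\<chi> a b. if b = i then (if a = j then 1 else 0) else mp_var (Entry a b)))
      (det (var_matrix (\<lambda>v. v))))"

definition closed_subgroup :: "('m::finite, 'k::field) gl_poly set \<Rightarrow> bool"
  where "closed_subgroup I \<longleftrightarrow>
    ring_ideal I \<and> gl_relation \<in> I \<and>
    (\<forall>f\<in>I. gl_counit f = 0) \<and>
    (\<forall>f\<in>I. gl_antipode f \<in> I) \<and>
    (\<forall>f\<in>I. gl_comult f \<in>
      ideal_gen (mp_eval mp_const (\<lambda>v. mp_var (Inl v)) ` I \<union>
                 mp_eval mp_const (\<lambda>v. mp_var (Inr v)) ` I))"

definition base_change :: "('x, 'k::field) mpoly set \<Rightarrow> ('x, 'k alg_closure) mpoly set"
  where "base_change I = ideal_gen (Poly_Mapping.map to_ac ` I)"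

text \<open>The spectrum of the quotient by \<open>I\<close>, with its Zariski topology.\<close>

definition spectrum :: "'r::comm_ring_1 set \<Rightarrow> 'r set topology"
  where "spectrum I = topology_generated_by
    (range (\<lambda>f. {P. prime_ideal P \<and> I \<subseteq> P \<and> f \<notin> P}))"

text \<open>The connected component $C$ of the identity point is open and closed in the spectrum, so
  the ideal of the open subscheme $C$ consists of the \<open>f\<close> whose germ at every point of $C$ is 0.\<close>

definition identity_component :: "('m::finite, 'k::field) gl_poly set \<Rightarrow> ('m, 'k) gl_poly set"
  where "identity_component I =
    {f. \<forall>P \<in> connected_component_of_set (spectrum I) {g. gl_counit g = 0}.
       \<exists>s. s \<notin> P \<and> s * f \<in> I}"


section \<open>Tori\<close>

text \<open>The coordinate ring of $\mathbb{G}_m^r$ is the ring of Laurent polynomials in the first \<open>r\<close>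
  variables, i.e. the group algebra of $\mathbb{Z}^r$.\<close>

type_synonym 'k laurent = "(nat \<Rightarrow>\<^sub>0 int) \<Rightarrow>\<^sub>0 'k"

definition laurent_ring :: "nat \<Rightarrow> 'k::field laurent set"
  where "laurent_ring r = {p. \<forall>m\<in>Poly_Mapping.keys p. Poly_Mapping.keys m \<subseteq> {..<r}}"

definition push_forward :: "('x \<Rightarrow> 'y) \<Rightarrow> ('x \<Rightarrow>\<^sub>0 'k::comm_ring_1) \<Rightarrow> ('y \<Rightarrow>\<^sub>0 'k)"
  where "push_forward g p =
    (\<Sum>m\<in>Poly_Mapping.keys p. Poly_Mapping.single (g m) (Poly_Mapping.lookup p m))"

text \<open>The matrix \<open>M\<close> of Laurent polynomials (with inverse determinant \<open>d\<close>) is a morphism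
  $\mathbb{G}_m^r \to GL_m$. It is an isomorphism onto the closed subscheme of \<open>I\<close>, as the comorphism
  is surjective with kernel \<open>I\<close>; and it is a group homomorphism, $M(st) = M(s) M(t)$, where the
  coordinate ring of $\mathbb{G}_m^r \times \mathbb{G}_m^r$ is a group algebra of pairs of exponents.\<close>

definition split_torus :: "('m::finite, 'k::field) gl_poly set \<Rightarrow> bool"
  where "split_torus I \<longleftrightarrow> closed_subgroup I \<and>
    (\<exists>r (M :: 'k laurent^'m^'m) d.
      range (mp_eval (Poly_Mapping.single 0) (gl_point M d)) = laurent_ring r \<and>
      {f. mp_eval (Poly_Mapping.single 0) (gl_point M d) f = 0} = I \<and>
      (\<forall>i j. push_forward (\<lambda>m. (m, m)) (M $ i $ j) =
        (\<Sum>k\<in>UNIV. push_forward (\<lambda>m. (m, 0)) (M $ i $ k) *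
                    push_forward (\<lambda>m. (0, m)) (M $ k $ j))))"

definition torus :: "('m::finite, 'k::field) gl_poly set \<Rightarrow> bool"
  where "torus I \<longleftrightarrow> closed_subgroup I \<and> split_torus (base_change I)"

definition maximal_torus_of ::
    "('m::finite, 'k::field) gl_poly set \<Rightarrow> ('m, 'k) gl_poly set \<Rightarrow> bool"
  where "maximal_torus_of G T \<longleftrightarrow>
    torus T \<and> G \<subseteq> T \<and> (\<forall>T'. torus T' \<and> G \<subseteq> T' \<and> T' \<subseteq> T \<longrightarrow> T' = T)"

definition k_split_group :: "('m::finite, 'k::field) gl_poly set \<Rightarrow> bool"
  where "k_split_group G \<longleftrightarrow> (\<exists>T. maximal_torus_of G T \<and> split_torus T)"


section \<open>The automorphism group scheme of an algebra\<close>

context comm_algebra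
begin

definition is_basis :: "('m \<Rightarrow> 'a) \<Rightarrow> bool"
  where "is_basis e \<longleftrightarrow> inj e \<and> independent (range e) \<and> span (range e) = UNIV"

definition coord :: "('m::finite \<Rightarrow> 'a) \<Rightarrow> 'a \<Rightarrow> 'k^'m"
  where "coord e x = (\<chi> i. representation (range e) x (e i))"

text \<open>For a commutative \<open>'k\<close>-algebra \<open>'b\<close> with structure map \<open>h\<close>, the basis \<open>e\<close> identifies
  $A \otimes_k B$ with the free module $B^m$. Its multiplication extends that of the algebra
  bilinearly.\<close>

definition tensor_mult ::
    "('m::finite \<Rightarrow> 'a) \<Rightarrow> ('k \<Rightarrow> 'b::comm_ring_1) \<Rightarrow> 'b^'m \<Rightarrow> 'b^'m \<Rightarrow> 'b^'m"
  where "tensor_mult e h u v =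
    (\<chi> k. \<Sum>i\<in>UNIV. \<Sum>j\<in>UNIV. u $ i * v $ j * h (coord e (e i * e j) $ k))"

definition tensor_one :: "('m::finite \<Rightarrow> 'a) \<Rightarrow> ('k \<Rightarrow> 'b::comm_ring_1) \<Rightarrow> 'b^'m"
  where "tensor_one e h = (\<chi> k. h (coord e 1 $ k))"

definition tensor_aut ::
    "('m::finite \<Rightarrow> 'a) \<Rightarrow> ('k \<Rightarrow> 'b::comm_ring_1) \<Rightarrow> 'b^'m^'m \<Rightarrow> bool"
  where "tensor_aut e h M \<longleftrightarrow>
    det M dvd 1 \<and> M *v tensor_one e h = tensor_one e h \<and>
    (\<forall>u v. M *v tensor_mult e h u v = tensor_mult e h (M *v u) (M *v v))"

text \<open>The ideal of $B \mapsto \mathrm{Aut}_B(A \otimes_k B)$ in $GL_m$: the conditions on the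
  generic matrix to respect the unit and the products of basis elements.\<close>

definition aut_ideal :: "('m::finite \<Rightarrow> 'a) \<Rightarrow> ('m, 'k) gl_poly set"
  where "aut_ideal e = (let N = var_matrix (\<lambda>v. v) in
    ideal_gen ({gl_relation} \<union>
      {(N *v tensor_one e mp_const - tensor_one e mp_const) $ k | k. True} \<union>
      {(N *v tensor_mult e mp_const (axis i 1) (axis j 1)
        - tensor_mult e mp_const (N *v axis i 1) (N *v axis j 1)) $ k | i j k. True}))"

text \<open>The ideal represents the functor $B \mapsto \mathrm{Aut}_B(A \otimes_k B)$.\<close>

lemma aut_ideal_points:
  fixes h :: "'k \<Rightarrow> 'b::comm_ring_1" and e :: "'m::finite \<Rightarrow> 'a"
  assumes h: "\<And>a b. h (a + b) = h a + h b" "\<And>a b. h (a * b) = h a * h b" "h 1 = 1"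
  shows "(\<forall>f\<in>aut_ideal e. mp_eval h (gl_point M d) f = 0) \<longleftrightarrow>
    d * det M = 1 \<and> tensor_aut e h M"
proof -
  let ?N = "var_matrix (\<lambda>v. v) :: ('m, 'k) gl_poly^'m^'m"
  let ?ev = "mp_eval h (gl_point M d)"
  note ev = mp_eval_add[OF h] mp_eval_mult[OF h] mp_eval_sum[OF h] mp_eval_diff[OF h]
    mp_eval_const[OF h] mp_eval_var[OF h] mp_eval_1[OF h] mp_eval_0[OF h] mp_eval_det[OF h]
  have X: "?ev (?N $ i $ j) = M $ i $ j" for i j
    by (simp add: var_matrix_def ev gl_point_def)
  have rel: "?ev gl_relation = d * det M - 1"
    by (simp add: gl_relation_def ev X gl_point_def)
  have one: "?ev ((?N *v tensor_one e mp_const - tensor_one e mp_const) $ k) =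
      (M *v tensor_one e h - tensor_one e h) $ k" for k
    by (simp add: matrix_vector_mult_def tensor_one_def ev X)
  have ax: "?ev (axis i 1 $ k) = axis i 1 $ k" for i k :: 'm
    by (simp add: axis_def ev)
  have mult: "?ev ((?N *v tensor_mult e mp_const (axis i 1) (axis j 1)
        - tensor_mult e mp_const (?N *v axis i 1) (?N *v axis j 1)) $ k) =
      (M *v tensor_mult e h (axis i 1) (axis j 1)
        - tensor_mult e h (M *v axis i 1) (M *v axis j 1)) $ k" for i j k
    by (simp add: matrix_vector_mult_def tensor_mult_def ev X ax)
  have bilinear: "(\<forall>i j. M *v tensor_mult e h (axis i 1) (axis j 1)
        = tensor_mult e h (M *v axis i 1) (M *v axis j 1)) \<longleftrightarrow>
      (\<forall>u v. M *v tensor_mult e h u v = tensor_mult e h (M *v u) (M *v v))"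
  proof safe
    fix u v :: "'b^'m"
    assume *: "\<forall>i j. M *v tensor_mult e h (axis i 1) (axis j 1)
        = tensor_mult e h (M *v axis i 1) (M *v axis j 1)"
    let ?c = "\<lambda>i j k. h (coord e (e i * e j) $ k)"
    have col: "(M *v axis i 1) $ k = M $ k $ i" for i k
      by (simp add: matrix_vector_mult_def axis_def if_distrib cong: if_cong)
    have c: "tensor_mult e h (axis i 1) (axis j 1) = (\<chi> k. ?c i j k)" for i j
    proof -
      have "(\<Sum>a\<in>UNIV. \<Sum>b\<in>UNIV. axis i 1 $ a * axis j 1 $ b * ?c a b k) =
          (\<Sum>a\<in>UNIV. if a = i then (\<Sum>b\<in>UNIV. if b = j then ?c a b k else 0) else 0)" for k
        by (rule sum.cong[OF refl]) (simp add: axis_def if_distrib[of "\<lambda>z. z * _"] cong: if_cong)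
      then show ?thesis
        by (simp add: tensor_mult_def)
    qed
    have eq: "(\<Sum>l\<in>UNIV. M $ k $ l * ?c i j l) =
        (\<Sum>a\<in>UNIV. \<Sum>b\<in>UNIV. M $ a $ i * M $ b $ j * ?c a b k)" for i j k
      using *[rule_format, of i j, THEN arg_cong, of "\<lambda>w. w $ k"]
      by (simp add: c) (simp add: matrix_vector_mult_def[of M "\<chi> k. _ k"] tensor_mult_def col)
    show "M *v tensor_mult e h u v = tensor_mult e h (M *v u) (M *v v)"
    proof (rule vec_eq_iff[THEN iffD2], rule allI)
      fix k
      have "(M *v tensor_mult e h u v) $ k =
          (\<Sum>l\<in>UNIV. \<Sum>i\<in>UNIV. \<Sum>j\<in>UNIV. u $ i * v $ j * (M $ k $ l * ?c i j l))"
        by (simp add: matrix_vector_mult_def tensor_mult_def sum_distrib_left ac_simps)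
      also have "\<dots> = (\<Sum>i\<in>UNIV. \<Sum>l\<in>UNIV. \<Sum>j\<in>UNIV. u $ i * v $ j * (M $ k $ l * ?c i j l))"
        by (rule sum.swap)
      also have "\<dots> = (\<Sum>i\<in>UNIV. \<Sum>j\<in>UNIV. \<Sum>l\<in>UNIV. u $ i * v $ j * (M $ k $ l * ?c i j l))"
        by (intro sum.cong refl sum.swap)
      also have "\<dots> = (\<Sum>i\<in>UNIV. \<Sum>j\<in>UNIV. u $ i * v $ j * (\<Sum>l\<in>UNIV. M $ k $ l * ?c i j l))"
        by (simp add: sum_distrib_left)
      also have "\<dots> = (\<Sum>i\<in>UNIV. \<Sum>j\<in>UNIV. \<Sum>a\<in>UNIV. \<Sum>b\<in>UNIV.
          (M $ a $ i * u $ i) * (M $ b $ j * v $ j) * ?c a b k)"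
        by (simp add: eq sum_distrib_left ac_simps)
      also have "\<dots> = (\<Sum>i\<in>UNIV. \<Sum>a\<in>UNIV. \<Sum>j\<in>UNIV. \<Sum>b\<in>UNIV.
          (M $ a $ i * u $ i) * (M $ b $ j * v $ j) * ?c a b k)"
        by (intro sum.cong refl sum.swap)
      also have "\<dots> = (\<Sum>a\<in>UNIV. \<Sum>i\<in>UNIV. \<Sum>j\<in>UNIV. \<Sum>b\<in>UNIV.
          (M $ a $ i * u $ i) * (M $ b $ j * v $ j) * ?c a b k)"
        by (rule sum.swap)
      also have "\<dots> = (\<Sum>a\<in>UNIV. \<Sum>i\<in>UNIV. \<Sum>b\<in>UNIV. \<Sum>j\<in>UNIV.
          (M $ a $ i * u $ i) * (M $ b $ j * v $ j) * ?c a b k)"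
        by (intro sum.cong refl sum.swap)
      also have "\<dots> = (\<Sum>a\<in>UNIV. \<Sum>b\<in>UNIV. \<Sum>i\<in>UNIV. \<Sum>j\<in>UNIV.
          (M $ a $ i * u $ i) * (M $ b $ j * v $ j) * ?c a b k)"
        by (intro sum.cong refl sum.swap)
      also have "\<dots> = tensor_mult e h (M *v u) (M *v v) $ k"
        by (simp add: tensor_mult_def matrix_vector_mult_def sum_distrib_left sum_distrib_right)
          (intro sum.cong refl sum.swap)
      finally show "(M *v tensor_mult e h u v) $ k = tensor_mult e h (M *v u) (M *v v) $ k" .
    qed
  qed blast
  have "(\<forall>f\<in>aut_ideal e. ?ev f = 0) \<longleftrightarrow>
      ?ev gl_relation = 0 \<and>
      (\<forall>k. ?ev ((?N *v tensor_one e mp_const - tensor_one e mp_const) $ k) = 0) \<and>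
      (\<forall>i j k. ?ev ((?N *v tensor_mult e mp_const (axis i 1) (axis j 1)
        - tensor_mult e mp_const (?N *v axis i 1) (?N *v axis j 1)) $ k) = 0)"
    unfolding aut_ideal_def Let_def mp_eval_vanish_ideal_gen[OF h] by blast
  also have "\<dots> \<longleftrightarrow> d * det M = 1 \<and> M *v tensor_one e h = tensor_one e h \<and>
      (\<forall>i j. M *v tensor_mult e h (axis i 1) (axis j 1)
        = tensor_mult e h (M *v axis i 1) (M *v axis j 1))"
    unfolding rel one mult by (simp add: vec_eq_iff)
  also have "\<dots> \<longleftrightarrow> d * det M = 1 \<and> tensor_aut e h M"
    unfolding bilinear tensor_aut_def by (metis dvd_triv_right)
  finally show ?thesis .
qed

end

end

theory Submission
  imports Defs
begin

text \<open>Suppose \<open>T\<close> is a maximal torus of \<open>G\<^sub>A\<close> that is split. It grades \<open>A\<close> by characters, and it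
  preserves \<open>q\<close> up to a character; since \<open>q\<close> is anisotropic, every weight vector \<open>v\<close> has
  \<open>q v \<noteq> 0\<close>, so twice its weight is that one character and all weights on \<open>J/J\<^sup>2\<close> agree. Lifting the variables
  to weight vectors gives another presentation of \<open>A\<close> with the same ideal, in which \<open>T\<close> acts through
  the scaling action. Now \<open>A\<close> has at least two variables (otherwise \<open>l = 2\<close>), so \<open>q\<close> splits off
  an anisotropic plane, on which the scaling action extends to a two-dimensional nonsplit torus in \<open>G\<^sub>A\<close>.
  It properly contains \<open>T\<close>, against maximality.

  The larger torus is the closed image of an explicit matrix of Laurent polynomials over the algebraic
  closure; it is defined over \<open>k\<close> because its entries lie in a form of the Laurent polynomial ring.\<close>

text \<open>Groups are given by ideals, so a larger group has a smaller ideal. Let K = k(s) with s^2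
  = t the nonsquare attached to the plane. The units of K act on the plane by multiplication and
  multiply q by the norm. To be a similitude of all of q, the action must scale the orthogonal
  complement by a square root of the norm, which is no character of the units. If the complement is
  nonzero, the torus is therefore a double cover, with weights \<alpha>, \<beta> on the plane and
  \<gamma> on the complement, \<gamma> + \<gamma> = \<alpha> + \<beta>. That the larger torus is
  strictly larger is witnessed by a linear equation over k that holds for scalars; on the larger
  torus it would make t a square.

  The obstacle is rationality: the image must be a subgroup over k and have the expected base
  change. Both reduce to linear disjointness from the algebraic closure.

  Passing to weight vectors as variables could spoil the relation q. If \<psi> is the common weight
  and \<psi> \<noteq> 0, the error has order at least 3, hence only weights n \<psi> with n \<ge> 3,
  whereas q has weight 2 \<psi>; if \<psi> = 0, the variables do not change at all.\<close>

abbreviation "lookup \<equiv> Poly_Mapping.lookup"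
abbreviation "keys \<equiv> Poly_Mapping.keys"
abbreviation "single \<equiv> Poly_Mapping.single"
abbreviation "map_coeffs \<equiv> Poly_Mapping.map"

type_synonym weight = "nat \<Rightarrow>\<^sub>0 int"

section \<open>Ring homomorphisms and polynomial mappings\<close>

text \<open>Exactly the hypotheses under which evaluation of polynomials respects sums and products,
  so evaluations are themselves instances (\<open>rhom_mp_eval\<close>) and can be composed.\<close>

locale rhom =
  fixes h :: "'a::comm_ring_1 \<Rightarrow> 'b::comm_ring_1"
  assumes add: "h (a + b) = h a + h b"
    and mult: "h (a * b) = h a * h b"
    and one: "h 1 = 1"
begin

lemma zero: "h 0 = 0"
  using add[of 0 0] by simp

lemma diff: "h (a - b) = h a - h b"
  by (metis add add_diff_cancel_right' diff_add_cancel)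

lemma uminus: "h (- a) = - h a"
  using diff[of 0 a] by (simp add: zero)

lemma sum: "h (sum F S) = (\<Sum>s\<in>S. h (F s))"
  by (induction S rule: infinite_finite_induct) (auto simp: add zero)

lemma prod: "h (prod F S) = (\<Prod>s\<in>S. h (F s))"
  by (induction S rule: infinite_finite_induct) (auto simp: mult one)

lemma power: "h (a ^ n) = h a ^ n"
  by (induction n) (auto simp: mult one)

lemma of_int: "h (of_int z) = of_int z"
proof -
  have "h (of_nat n) = of_nat n" for n
    by (induction n) (simp_all add: add one zero)
  then show ?thesis
    by (cases z rule: int_diff_cases) (simp add: diff)
qed

lemma of_numeral: "h (numeral k) = numeral k"
  using of_int[of "numeral k"] by simp

lemma det: "h (det M) = det (map_matrix h M)"
  by (simp add: det_def map_matrix_def sum mult of_int prod)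

lemma matrix_mult: "map_matrix h (M ** N) = map_matrix h M ** map_matrix h N"
  by (simp add: map_matrix_def matrix_matrix_mult_def vec_eq_iff sum mult)

lemma matrix_one: "map_matrix h (mat 1) = mat 1"
  by (simp add: map_matrix_def mat_def vec_eq_iff one zero)

lemmas eval_add = mp_eval_add[of h, OF add mult one]
  and eval_mult = mp_eval_mult[of h, OF add mult one]
  and eval_1 = mp_eval_1[of h, OF add mult one]
  and eval_single = mp_eval_single[of h, OF add mult one]
  and eval_const = mp_eval_const[of h, OF add mult one]
  and eval_var = mp_eval_var[of h, OF add mult one]

end

lemma rhom_comp: "rhom f \<Longrightarrow> rhom g \<Longrightarrow> rhom (\<lambda>x. g (f x))"
  by (simp add: rhom_def)

lemma rhom_id: "rhom (\<lambda>x. x)" "rhom id"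
  by (simp_all add: rhom_def)

lemma rhom_to_ac: "rhom to_ac"
  by (simp add: rhom_def)

lemma rhom_mp_eval: "rhom h \<Longrightarrow> rhom (mp_eval h x)"
  by (simp add: rhom_def mp_eval_add mp_eval_mult)

lemma poly_mapping_sum_singles: "f = (\<Sum>m\<in>keys f. single m (lookup f m))"
  by (rule poly_mapping_eqI) (auto simp: lookup_sum lookup_single when_def in_keys_iff sum.delta)

lemma poly_mapping_induct [case_names zero single add]:
  fixes f :: "'x \<Rightarrow>\<^sub>0 'a::comm_monoid_add"
  assumes "P 0" "\<And>m c. P (single m c)" "\<And>f g. P f \<Longrightarrow> P g \<Longrightarrow> P (f + g)"
  shows "P f"
proof -
  have "P (\<Sum>m\<in>S. single m (lookup f m))" if "finite S" for S
    using that by (induction S rule: finite_induct) (auto intro: assms)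
  from this[of "keys f"] show ?thesis
    by (simp flip: poly_mapping_sum_singles)
qed

text \<open>Monomials span a monoid algebra, so an additive map is multiplicative as soon as it is
  so on monomials. Maps on coefficients and on exponents are handled this way.\<close>

lemma rhom_poly_mappingI:
  fixes F :: "('x::comm_monoid_add \<Rightarrow>\<^sub>0 'a::comm_ring_1) \<Rightarrow> 'b::comm_ring_1"
  assumes add: "\<And>f g. F (f + g) = F f + F g"
    and mult: "\<And>m n c d. F (single (m + n) (c * d)) = F (single m c) * F (single n d)"
    and one: "F (single 0 1) = 1"
  shows "rhom F"
proof
  have zero: "F 0 = 0"
    using add[of 0 0] by simp
  fix f g
  show "F (f * g) = F f * F g"
  proof (induction f rule: poly_mapping_induct)
    case (single m c)
    show ?case
      by (induction g rule: poly_mapping_induct) (auto simp: zero mult_single mult distrib_left add)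
  qed (auto simp: zero add distrib_right)
qed (use assms in \<open>auto simp: single_one\<close>)

lemma rhom_single: "rhom (single (0::'x::comm_monoid_add) :: 'a::comm_ring_1 \<Rightarrow> _)"
  by standard (simp_all add: single_add mult_single)

lemma rhom_mp_const: "rhom mp_const"
  unfolding mp_const_def by (rule rhom_single)

lemma single_power: "single m c ^ n = single (\<Sum>i<n. m) (c ^ n)"
  by (induction n) (simp_all add: mult_single add.commute)

lemma single_prod: "(\<Prod>i\<in>S. single (m i) (c i)) = single (\<Sum>i\<in>S. m i) (\<Prod>i\<in>S. c i)"
  by (induction S rule: infinite_finite_induct) (simp_all add: mult_single)

lemma sum_single_const: "(\<Sum>i<n. single a b) = single a (of_nat n * b)"
  by (induction n) (auto simp: single_add[symmetric] algebra_simps)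

text \<open>Applying a ring homomorphism to this identity shows that it is an evaluation
  (\<open>rhom_eq_mp_eval\<close>), hence determined by constants and variables
  (\<open>rhom_mpoly_eqI\<close>).\<close>

lemma mp_eval_self:
  fixes f :: "('x, 'a::comm_ring_1) mpoly"
  shows "mp_eval mp_const mp_var f = f"
proof -
  have "mp_const c * (\<Prod>i\<in>keys m. mp_var i ^ lookup m i) = single m c"
    for m :: "'x \<Rightarrow>\<^sub>0 nat" and c :: 'a
    by (simp add: mp_const_def mp_var_def single_power single_prod mult_single sum_single_const
        flip: poly_mapping_sum_singles)
  then show ?thesis
    by (simp add: mp_eval_def flip: poly_mapping_sum_singles)
qed

lemma rhom_mp_eval_comp:
  assumes "rhom u"
  shows "u (mp_eval h x f) = mp_eval (\<lambda>c. u (h c)) (\<lambda>i. u (x i)) f"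
proof -
  interpret rhom u by fact
  show ?thesis by (simp add: mp_eval_def sum mult prod power)
qed

lemma rhom_eq_mp_eval:
  assumes "rhom F"
  shows "F f = mp_eval (\<lambda>c. F (mp_const c)) (\<lambda>i. F (mp_var i)) f"
  using rhom_mp_eval_comp[OF assms, of mp_const mp_var f] by (simp add: mp_eval_self)

lemma rhom_mpoly_eqI:
  assumes "rhom F" "rhom G" "\<And>c. F (mp_const c) = G (mp_const c)" "\<And>i. F (mp_var i) = G (mp_var i)"
  shows "F f = G f"
  by (subst (1 2) rhom_eq_mp_eval) (use assms in auto)

subsection \<open>Maps on coefficients and on exponents\<close>

lemma lookup_map: "h 0 = 0 \<Longrightarrow> lookup (map_coeffs h f) m = h (lookup f m)"
  by transfer (auto simp: when_def)

lemma map_add: "(\<And>a b. h (a + b) = h a + h b) \<Longrightarrow> h 0 = 0 \<Longrightarrow>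
    map_coeffs h (f + g) = map_coeffs h f + map_coeffs h g"
  by (rule poly_mapping_eqI) (simp add: lookup_map lookup_add)

lemma (in rhom) rhom_map: "rhom (map_coeffs h :: ('x::comm_monoid_add \<Rightarrow>\<^sub>0 'a) \<Rightarrow> _)"
  by (rule rhom_poly_mappingI) (simp_all add: map_add add zero mult one mult_single flip: single_one)

lemma (in rhom) map_const: "map_coeffs h (mp_const c) = mp_const (h c)"
  by (simp add: mp_const_def zero)

lemma (in rhom) map_var: "map_coeffs h (mp_var i) = mp_var i"
  by (simp add: mp_var_def zero one)

lemma (in rhom) mp_eval_map:
  assumes "rhom k"
  shows "mp_eval k x (map_coeffs h f) = mp_eval (\<lambda>c. k (h c)) x f"
proof (rule rhom_mpoly_eqI[of "\<lambda>f. mp_eval k x (map_coeffs h f)"])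
  interpret k: rhom k by fact
  have kh: "rhom (\<lambda>c. k (h c))"
    by (rule rhom_comp[OF rhom_axioms assms])
  show "rhom (\<lambda>f. mp_eval k x (map_coeffs h f))"
    by (rule rhom_comp[OF rhom_map rhom_mp_eval[OF assms]])
  show "rhom (mp_eval (\<lambda>c. k (h c)) x)"
    by (rule rhom_mp_eval[OF kh])
  show "mp_eval k x (map_coeffs h (mp_const c)) = mp_eval (\<lambda>c. k (h c)) x (mp_const c)" for c
    by (simp add: map_const k.eval_const rhom.eval_const[OF kh])
  show "mp_eval k x (map_coeffs h (mp_var c)) = mp_eval (\<lambda>c. k (h c)) x (mp_var c)" for c
    by (simp add: map_var k.eval_var rhom.eval_var[OF kh])
qed

lemma push_forward_superset:
  assumes "finite S" "keys p \<subseteq> S"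
  shows "push_forward g p = (\<Sum>m\<in>S. single (g m) (lookup p m))"
  unfolding push_forward_def
  by (rule sum.mono_neutral_left) (use assms in \<open>auto simp: in_keys_iff\<close>)

lemma push_forward_add: "push_forward g (p + q) = push_forward g p + push_forward g q"
proof -
  let ?S = "keys p \<union> keys q"
  show ?thesis
    by (subst (1 2 3) push_forward_superset[of ?S])
      (auto simp: lookup_add single_add sum.distrib dest: subsetD[OF Poly_Mapping.keys_add])
qed

lemma push_forward_single: "push_forward g (single m c) = single (g m) c"
  by (simp add: push_forward_def)

text \<open>On group algebras these are the comorphisms between tori: doubling an exponent is
  comultiplication, sending it to 0 the counit, negating it the antipode, and placing it in one
  component of a pair a projection.\<close>

lemma rhom_push_forward:
  assumes "g 0 = 0" "\<And>a b. g (a + b) = g a + g b"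
  shows "rhom (push_forward g)"
  by (rule rhom_poly_mappingI)
    (simp_all add: push_forward_add push_forward_single assms mult_single flip: single_one)

subsection \<open>The degree filtration\<close>

definition mdeg :: "('x \<Rightarrow>\<^sub>0 nat) \<Rightarrow> nat"
  where "mdeg m = (\<Sum>i\<in>keys m. lookup m i)"

text \<open>A power of the ideal of the variables (see \<open>ideal_pow_var_ideal\<close>), in a
  form where membership is read off the coefficients.\<close>

definition order_ge :: "nat \<Rightarrow> ('x, 'k::comm_ring_1) mpoly set"
  where "order_ge d = {f. \<forall>m\<in>keys f. d \<le> mdeg m}"

lemma mdeg_superset: "finite S \<Longrightarrow> keys m \<subseteq> S \<Longrightarrow> mdeg m = (\<Sum>i\<in>S. lookup m i)"
  unfolding mdeg_def by (rule sum.mono_neutral_left) (auto simp: in_keys_iff)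

lemma mdeg_add: "mdeg (m + n) = mdeg m + mdeg n"
  by (subst (1 2 3) mdeg_superset[of "keys m \<union> keys n"])
    (auto simp: lookup_add sum.distrib dest: subsetD[OF Poly_Mapping.keys_add])

lemma mdeg_0 [simp]: "mdeg 0 = 0"
  by (simp add: mdeg_def)

lemma mdeg_eq_0: "mdeg m = 0 \<longleftrightarrow> m = 0"
  by (metis finite_keys in_keys_iff lookup_zero mdeg_0 mdeg_def poly_mapping_eqI sum_eq_0_iff)

lemma single_exponent_eq_iff: "single x (Suc 0) = single i (Suc 0) \<longleftrightarrow> x = i"
  by (metis lookup_single_eq lookup_single_not_eq nat.distinct(1))

lemma mdeg_single [simp]: "mdeg (single i d) = d"
  by (simp add: mdeg_def)

lemma order_geI: "(\<And>m. lookup f m \<noteq> 0 \<Longrightarrow> d \<le> mdeg m) \<Longrightarrow> f \<in> order_ge d"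
  by (auto simp: order_ge_def in_keys_iff)

lemma order_geD: "f \<in> order_ge d \<Longrightarrow> mdeg m < d \<Longrightarrow> lookup f m = 0"
  by (metis (no_types, lifting) in_keys_iff leD mem_Collect_eq order_ge_def)

lemma quadratic_form_order_ge: "quadratic_form q \<Longrightarrow> q \<in> order_ge 2"
  by (simp add: order_ge_def quadratic_form_def mdeg_def)

lemma order_ge_mono: "d \<le> d' \<Longrightarrow> order_ge d' \<subseteq> order_ge d"
  by (auto simp: order_ge_def)

lemma order_ge_0 [simp]: "order_ge 0 = UNIV"
  by (auto simp: order_ge_def)

lemma zero_in_order_ge [simp]: "0 \<in> order_ge d"
  by (simp add: order_ge_def)

lemma add_in_order_ge: "f \<in> order_ge d \<Longrightarrow> g \<in> order_ge d \<Longrightarrow> f + g \<in> order_ge d"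
  using Poly_Mapping.keys_add[of f g] by (auto simp: order_ge_def)

lemma diff_in_order_ge:
  fixes f g :: "('x, 'k::comm_ring_1) mpoly"
  shows "f \<in> order_ge d \<Longrightarrow> g \<in> order_ge d \<Longrightarrow> f - g \<in> order_ge d"
  by (rule order_geI) (metis diff_zero leI lookup_minus order_geD)

lemma mult_in_order_ge:
  assumes "f \<in> order_ge d" "g \<in> order_ge e"
  shows "f * g \<in> order_ge (d + e)"
  using keys_mult[of f g] assms by (fastforce simp: order_ge_def mdeg_add intro: add_mono)

lemma mult_in_order_ge2: "g \<in> order_ge e \<Longrightarrow> f * g \<in> order_ge e"
  using mult_in_order_ge[of f 0 g e] by simp

lemma sum_in_order_ge: "(\<And>s. s \<in> S \<Longrightarrow> F s \<in> order_ge d) \<Longrightarrow> sum F S \<in> order_ge d"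
  by (induction S rule: infinite_finite_induct) (auto intro: add_in_order_ge)

lemma single_in_order_ge: "d \<le> mdeg m \<Longrightarrow> single m c \<in> order_ge d"
  by (simp add: order_ge_def)

lemma var_in_order_ge: "mp_var i \<in> order_ge 1"
  unfolding mp_var_def by (rule single_in_order_ge) simp

lemma order_ge_induct [consumes 1, case_names zero single add]:
  assumes f: "f \<in> order_ge d"
    and P: "P 0" "\<And>m c. d \<le> mdeg m \<Longrightarrow> P (single m c)" "\<And>f g. P f \<Longrightarrow> P g \<Longrightarrow> P (f + g)"
  shows "P f"
proof -
  have "P (\<Sum>m\<in>S. single m (lookup f m))" if "finite S" "S \<subseteq> keys f" for S
    using that by (induction S rule: finite_induct) (use f in \<open>auto simp: order_ge_def intro: P\<close>)
  from this[of "keys f"] show ?thesis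
    by (simp flip: poly_mapping_sum_singles)
qed

text \<open>The induction step of the arguments by degree.\<close>

lemma single_factor_var:
  assumes "Suc d \<le> mdeg m"
  obtains i m' where "single m c = mp_var i * single m' c" "d \<le> mdeg m'" "m = single i 1 + m'"
proof -
  have "m \<noteq> 0" using assms by auto
  then obtain i where i: "lookup m i \<noteq> 0"
    by (metis lookup_zero poly_mapping_eqI)
  define m' where "m' = m - single i 1"
  have m: "m = single i 1 + m'"
    by (rule poly_mapping_eqI) (use i in \<open>auto simp: m'_def lookup_add lookup_minus lookup_single when_def\<close>)
  then have "single m c = mp_var i * single m' c"
    by (simp add: mp_var_def mult_single)
  moreover from m assms have "d \<le> mdeg m'"
    by (simp add: mdeg_add)
  ultimately show ?thesis using m that by blast
qed

lemma ring_ideal_iff: "ring_ideal I \<longleftrightarrow> 0 \<in> I \<and> (\<forall>x\<in>I. \<forall>y\<in>I. x + y \<in> I) \<and> (\<forall>c. \<forall>x\<in>I. c * x \<in> I)"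
  unfolding Modules.module.subspace_def[OF module_times] by auto

lemma ring_ideal_order_ge: "ring_ideal (order_ge d)"
  by (auto simp: ring_ideal_iff add_in_order_ge mult_in_order_ge2)

lemmas ideal_gen_minimal = Modules.module.span_minimal[OF module_times]
  and ideal_gen_base = Modules.module.span_base[OF module_times]
  and ideal_gen_add = Modules.module.span_add[OF module_times]
  and ideal_gen_mult = Modules.module.span_scale[OF module_times]
  and ideal_gen_zero = Modules.module.span_zero[OF module_times]
  and ideal_gen_sum = Modules.module.span_sum[OF module_times]

text \<open>A factor from the ideal of the variables raises the order by one; conversely a monomial
  of positive degree splits off a variable.\<close>

lemma ideal_pow_var_ideal: "ideal_pow var_ideal d = (order_ge d :: ('x, 'k::comm_ring_1) mpoly set)"
proof (induction d)
  case (Suc d)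
  have "var_ideal \<subseteq> (order_ge 1 :: ('x, 'k) mpoly set)"
    unfolding var_ideal_def by (rule ideal_gen_minimal) (use var_in_order_ge in \<open>auto simp: ring_ideal_order_ge\<close>)
  then have "ideal_prod var_ideal (order_ge d) \<subseteq> (order_ge (Suc d) :: ('x, 'k) mpoly set)"
    unfolding ideal_prod_def
    by (intro ideal_gen_minimal ring_ideal_order_ge) (use mult_in_order_ge[of _ 1 _ d] in auto)
  moreover have "f \<in> ideal_prod var_ideal (order_ge d)" if "f \<in> order_ge (Suc d)" for f :: "('x, 'k) mpoly"
    using that
  proof (induction rule: order_ge_induct)
    case (single m c)
    then obtain i m' where "single m c = mp_var i * single m' c" "d \<le> mdeg m'"
      by (rule single_factor_var)
    then show ?case
      unfolding ideal_prod_def var_ideal_def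
      by (intro ideal_gen_base) (use single_in_order_ge ideal_gen_base in blast)
  qed (auto simp: ideal_prod_def ideal_gen_zero ideal_gen_add)
  ultimately show ?case
    using Suc by auto
qed simp

lemma ideal_gen_singleton: "ideal_gen {q} = range (\<lambda>r. r * q)"
  by (rule Modules.module.span_singleton[OF module_times])

section \<open>Generic points and closed subgroups\<close>

text \<open>Supplies two points of the spectrum: the identity, and the generic point of the closed
  image of a torus, whose coordinate ring of Laurent polynomials is a domain.\<close>

lemma prime_ideal_kernel:
  fixes F :: "'r::comm_ring_1 \<Rightarrow> 'b::idom"
  assumes "rhom F"
  shows "prime_ideal {f. F f = 0}"
proof -
  interpret rhom F by fact
  have "1 \<notin> {f. F f = 0}"
    using one by simp
  then have "{f. F f = 0} \<noteq> UNIV"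
    by blast
  then show ?thesis
    by (auto simp: prime_ideal_def ring_ideal_iff zero add mult)
qed

text \<open>A prime ideal specialises to every larger prime ideal, so the two are in one component.\<close>

lemma spectrum_component:
  assumes "prime_ideal P" "prime_ideal Q" "I \<subseteq> P" "P \<subseteq> Q"
  shows "P \<in> connected_component_of_set (spectrum I) Q"
proof -
  let ?S = "range (\<lambda>f. {P. prime_ideal P \<and> I \<subseteq> P \<and> f \<notin> P})"
  \<comment> \<open>Every open set around Q contains P: this holds for the generating sets because f
    \<notin> Q implies f \<notin> P, and it survives unions and intersections.\<close>
  have spec: "P \<in> U" if "openin (spectrum I) U" "Q \<in> U" for U
  proof -
    from that have "generate_topology_on ?S U"
      by (simp add: spectrum_def openin_topology_generated_by_iff)
    then show ?thesis
      using that(2) by induction (use assms in auto)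
  qed
  have "1 \<notin> P" if "prime_ideal P" for P :: "'a set"
    using that by (auto simp: prime_ideal_def ring_ideal_iff) (metis mult.right_neutral)
  then have "{P, Q} \<subseteq> topspace (spectrum I)"
    using assms by (auto simp: spectrum_def)
  then have "connectedin (spectrum I) {P, Q}"
    unfolding connectedin using spec by (auto 4 3)
  then show ?thesis
    unfolding connected_component_of_def by blast
qed

text \<open>P is a point of the component, so the germ of f at P is 0: some s outside P has s * f
  \<in> I \<subseteq> P, and primality gives f \<in> P. Thus an irreducible closed subset through
  the identity lies in the identity component.\<close>

lemma identity_component_subset:
  fixes P :: "('m::finite, 'k::field) gl_poly set"
  assumes "prime_ideal P" "I \<subseteq> P" "P \<subseteq> {g. gl_counit g = 0}"
  shows "identity_component I \<subseteq> P"
proof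
  fix f assume f: "f \<in> identity_component I"
  have "prime_ideal {g :: ('m, 'k) gl_poly. gl_counit g = 0}"
    unfolding gl_counit_def by (rule prime_ideal_kernel[OF rhom_mp_eval[OF rhom_id(2)]])
  from spectrum_component[OF assms(1) this assms(2,3)] f
  obtain s where "s \<notin> P" "s * f \<in> I"
    unfolding identity_component_def by auto
  then show "f \<in> P"
    using assms(1,2) unfolding prime_ideal_def by auto
qed

lemma subset_identity_component: "I \<subseteq> identity_component I"
proof
  fix f assume f: "f \<in> I"
  show "f \<in> identity_component I"
    unfolding identity_component_def
  proof safe
    fix P assume "connected_component_of (spectrum I) {g. gl_counit g = 0} P"
    then have "P \<in> topspace (spectrum I)"
      using connected_component_in_topspace[of "spectrum I"] by blast
    then have "prime_ideal P"
      by (auto simp: spectrum_def)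
    then have "1 \<notin> P"
      by (auto simp: prime_ideal_def ring_ideal_iff) (metis mult.right_neutral)
    with f show "\<exists>s. s \<notin> P \<and> s * f \<in> I"
      by (intro exI[of _ 1]) auto
  qed
qed

section \<open>The group structure of the general linear group, evaluated at points\<close>

lemma comp_gl_point: "(\<lambda>v. u (gl_point M d v)) = gl_point (map_matrix u M) (u d)"
  by (auto simp: gl_point_def map_matrix_def split: gl_var.splits)

lemma mp_eval_gl_point_comp:
  "rhom u \<Longrightarrow> u (mp_eval h (gl_point M d) f) = mp_eval (\<lambda>c. u (h c)) (gl_point (map_matrix u M) (u d)) f"
  by (simp add: rhom_mp_eval_comp comp_gl_point)

text \<open>Let C be the identity matrix with column k replaced by x. Then M ** C is M with column k
  replaced by M x, and det C = x k. The coefficients are only a ring since matrices of Laurent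
  polynomials are meant.\<close>

lemma cramer_comm_ring:
  fixes M :: "'a::comm_ring_1^'n^'n"
  shows "det (\<chi> a b. if b = k then (M *v x) $ a else M $ a $ b) = det M * x $ k"
proof -
  define C :: "'a^'n^'n" where "C = (\<chi> a b. if b = k then x $ a else if a = b then 1 else 0)"
  have "(M ** C) $ a $ b = (if b = k then (M *v x) $ a else M $ a $ b)" for a b
    by (cases "b = k")
      (simp_all add: matrix_matrix_mult_def matrix_vector_mult_def C_def if_distrib[of "\<lambda>z. _ * z"] cong: if_cong)
  then have "M ** C = (\<chi> a b. if b = k then (M *v x) $ a else M $ a $ b)"
    by (simp add: vec_eq_iff)
  moreover have "det C = x $ k"
  proof -
    \<comment> \<open>Only the identity permutation contributes. If p moves a, then a itself or,
      when p a = k, the index k is moved to something other than k, and C has a zero entry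
      there.\<close>
    have zero: "(\<Prod>a\<in>UNIV. C $ a $ p a) = 0" if p: "p permutes UNIV" "p \<noteq> id" for p
    proof -
      obtain a where a: "p a \<noteq> a" using p(2) by (metis eq_id_iff)
      have inj: "inj p" using p(1) permutes_inj by blast
      have "\<exists>a. p a \<noteq> a \<and> p a \<noteq> k"
        using a inj by (metis injD)
      then obtain a where "p a \<noteq> a" "p a \<noteq> k" by blast
      then have "C $ a $ p a = 0" by (simp add: C_def)
      then show ?thesis by (meson UNIV_I finite prod_zero)
    qed
    have "det C = (\<Sum>p\<in>{p :: 'n \<Rightarrow> 'n. p permutes UNIV}. if p = id then (\<Prod>a\<in>UNIV. C $ a $ a) else 0)"
      unfolding det_def by (rule sum.cong) (auto simp: sign_id zero)
    also have "\<dots> = (\<Prod>a\<in>UNIV. C $ a $ a)"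
      by (simp add: sum.delta permutes_id finite_permutations)
    also have "\<dots> = (\<Prod>a\<in>UNIV. if a = k then x $ k else 1)"
      by (intro prod.cong) (auto simp: C_def)
    finally show ?thesis by (simp add: prod.delta)
  qed
  ultimately show ?thesis by (metis det_mul)
qed

text \<open>Column j of N solves M x = e_j. The determinant is the one in the definition of
  \<open>gl_antipode\<close>.\<close>

lemma cramer_inverse:
  fixes M N :: "'a::comm_ring_1^'n^'n"
  assumes "M ** N = mat 1"
  shows "det (\<chi> a b. if b = i then (if a = j then 1 else 0) else M $ a $ b) = det M * N $ i $ j"
proof -
  have "(M *v (\<chi> r. N $ r $ j)) $ a = (if a = j then 1 else 0)" for a
    using arg_cong[OF assms, of "\<lambda>A. A $ a $ j"]
    by (simp add: matrix_matrix_mult_def matrix_vector_mult_def mat_def)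
  then have v: "M *v (\<chi> r. N $ r $ j) = (\<chi> a. if a = j then 1 else 0)"
    by (simp add: vec_eq_iff)
  show ?thesis
    using cramer_comm_ring[of i M "\<chi> r. N $ r $ j"] unfolding v vec_lambda_beta .
qed

text \<open>By Cramer's rule M x = 0 implies det M * x i = 0 for all i, and det M is a unit.\<close>

lemma matrix_cancel_left:
  fixes M :: "'a::comm_ring_1^'n^'n"
  assumes d: "d * det M = 1" and eq: "M ** A = M ** B"
  shows "A = B"
proof -
  have "(A - B) $ i $ j = 0" for i j
  proof -
    have "(M *v (\<chi> r. (A - B) $ r $ j)) $ a = (M ** A) $ a $ j - (M ** B) $ a $ j" for a
      by (simp add: matrix_vector_mult_def matrix_matrix_mult_def right_diff_distrib sum_subtractf)
    with eq have "M *v (\<chi> r. (A - B) $ r $ j) = M *v 0"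
      by (simp add: vec_eq_iff matrix_vector_mult_0_right)
    then have "det M * (\<chi> r. (A - B) $ r $ j) $ i = det M * 0 $ i"
      by (simp only: cramer_comm_ring[of i M, symmetric])
    then have "det M * (A - B) $ i $ j = 0"
      by (simp only: vec_lambda_beta zero_index mult_zero_right)
    then have "(d * det M) * (A - B) $ i $ j = 0"
      by (simp only: mult.assoc mult_zero_right)
    with d show ?thesis by (simp del: vector_minus_component)
  qed
  then show ?thesis by (simp add: vec_eq_iff)
qed

text \<open>The inverse of the point (M, d) is (N, det M), because the inverse of det N is det
  M.\<close>

lemma eval_antipode:
  assumes h: "rhom h" and MN: "M ** N = mat 1" and d: "d * det M = 1"
  shows "mp_eval h (gl_point M d) (gl_antipode f) = mp_eval h (gl_point N (det M)) f"
proof -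
  interpret h: rhom h by fact
  let ?u = "mp_eval h (gl_point M d)"
  interpret u: rhom ?u by (rule rhom_mp_eval[OF h])
  have var: "?u (mp_var v) = gl_point M d v" for v
    by (simp add: h.eval_var)
  have entry: "?u (mp_var Inv_Det *
        det (\<chi> a b. if b = i then (if a = j then 1 else 0) else mp_var (Entry a b))) = N $ i $ j" for i j
  proof -
    have "map_matrix ?u (\<chi> a b. if b = i then (if a = j then 1 else 0) else mp_var (Entry a b)) =
        (\<chi> a b. if b = i then (if a = j then 1 else 0) else M $ a $ b)"
      by (auto simp: map_matrix_def vec_eq_iff var gl_point_def u.one u.zero)
    then have "?u (mp_var Inv_Det *
        det (\<chi> a b. if b = i then (if a = j then 1 else 0) else mp_var (Entry a b))) =
        d * (det M * N $ i $ j)"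
      by (simp add: u.mult u.det var cramer_inverse[OF MN]) (simp add: gl_point_def)
    then show ?thesis
      using d by (simp add: mult.assoc[symmetric])
  qed
  have det: "?u (det (var_matrix (\<lambda>v. v))) = det M"
    unfolding u.det
    by (rule arg_cong[of _ _ det]) (simp add: vec_eq_iff map_matrix_def var_matrix_def var gl_point_def)
  show ?thesis
    unfolding gl_antipode_def mp_eval_gl_point_comp[OF u.rhom_axioms] h.eval_const det
    by (rule arg_cong[of _ _ "\<lambda>N'. mp_eval h (gl_point N' (det M)) f"])
      (simp add: vec_eq_iff map_matrix_def entry)
qed

lemma eval_comult:
  assumes h: "rhom h"
  shows "mp_eval h (case_sum (gl_point M1 d1) (gl_point M2 d2)) (gl_comult f) =
    mp_eval h (gl_point (M1 ** M2) (d1 * d2)) f"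
proof -
  interpret h: rhom h by fact
  let ?u = "mp_eval h (case_sum (gl_point M1 d1) (gl_point M2 d2))"
  interpret u: rhom ?u by (rule rhom_mp_eval[OF h])
  have "map_matrix ?u (var_matrix Inl) = M1" "map_matrix ?u (var_matrix Inr) = M2"
    by (simp_all add: vec_eq_iff map_matrix_def var_matrix_def h.eval_var gl_point_def)
  then show ?thesis
    unfolding gl_comult_def mp_eval_gl_point_comp[OF u.rhom_axioms] h.eval_const u.matrix_mult u.mult
    by (simp add: h.eval_var gl_point_def)
qed

subsection \<open>Linear independence over a field acting through a ring homomorphism\<close>

text \<open>Linear independence over \<open>'k\<close> acting through h, with the family indexed by
  its own members; meant for finite S.\<close>

definition lin_indep :: "('k::comm_ring_1 \<Rightarrow> 'b::comm_ring_1) \<Rightarrow> 'b set \<Rightarrow> bool"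
  where "lin_indep h S \<longleftrightarrow> (\<forall>a. (\<Sum>c\<in>S. h (a c) * c) = 0 \<longrightarrow> (\<forall>c\<in>S. a c = 0))"

lemma finite_lin_indep_basis:
  fixes h :: "'k::field \<Rightarrow> 'b::comm_ring_1"
  assumes "rhom h" "finite C"
  obtains S where "S \<subseteq> C" "finite S" "lin_indep h S" "\<forall>c\<in>C. \<exists>a. c = (\<Sum>s\<in>S. h (a s) * s)"
proof -
  interpret rhom h by fact
  interpret V: vector_space "\<lambda>c x. h c * x"
    by unfold_locales (simp_all add: add mult one algebra_simps)
  obtain S where S: "S \<subseteq> C" "V.independent S" "C \<subseteq> V.span S"
    by (rule V.maximal_independent_subset)
  have fin: "finite S" using S(1) assms(2) by (rule finite_subset)
  show ?thesis
  proof (rule that[OF S(1) fin])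
    show "lin_indep h S"
      using S(2) unfolding V.dependent_finite[OF fin] lin_indep_def by blast
    show "\<forall>c\<in>C. \<exists>a. c = (\<Sum>s\<in>S. h (a s) * s)"
      using S(3) unfolding V.span_finite[OF fin] by blast
  qed
qed

text \<open>The isomorphism of k[X, Y] with the tensor product of k[X] and k[Y]: products f(X) g(Y)
  are closed under multiplication and contain constants and variables, hence all monomials.\<close>

lemma mpoly_split:
  fixes F :: "('x + 'x, 'k::comm_ring_1) mpoly"
  obtains f g where "F = (\<Sum>m\<in>keys F.
    mp_eval mp_const (\<lambda>v. mp_var (Inl v)) (f m) * mp_eval mp_const (\<lambda>v. mp_var (Inr v)) (g m))"
proof -
  let ?L = "mp_eval mp_const (\<lambda>v. mp_var (Inl v)) :: ('x,'k) mpoly \<Rightarrow> ('x + 'x, 'k) mpoly"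
  let ?R = "mp_eval mp_const (\<lambda>v. mp_var (Inr v)) :: ('x,'k) mpoly \<Rightarrow> ('x + 'x, 'k) mpoly"
  interpret c: rhom "mp_const :: 'k \<Rightarrow> ('x + 'x, 'k) mpoly" by (rule rhom_mp_const)
  interpret L: rhom ?L by (intro rhom_mp_eval rhom_mp_const)
  interpret R: rhom ?R by (intro rhom_mp_eval rhom_mp_const)
  define P where "P z \<longleftrightarrow> (\<exists>f g. z = ?L f * ?R g)" for z
  have mult: "P (a * b)" if "P a" "P b" for a b
  proof -
    from that obtain f g f' g' where "a = ?L f * ?R g" "b = ?L f' * ?R g'"
      unfolding P_def by blast
    then have "a * b = ?L (f * f') * ?R (g * g')"
      by (simp add: L.mult R.mult ac_simps)
    then show ?thesis unfolding P_def by blast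
  qed
  have const: "P (mp_const c)" for c
    unfolding P_def
    by (rule exI[of _ "mp_const c"], rule exI[of _ 1]) (simp add: c.eval_const c.eval_1)
  have one: "P 1"
    using const[of 1] by (simp add: c.one)
  have var: "P (mp_var v)" for v
  proof (cases v)
    case (Inl i)
    then show ?thesis unfolding P_def
      by (intro exI[of _ "mp_var i"] exI[of _ 1]) (simp add: c.eval_var c.eval_1)
  next
    case (Inr i)
    then show ?thesis unfolding P_def
      by (intro exI[of _ 1] exI[of _ "mp_var i"]) (simp add: c.eval_var c.eval_1)
  qed
  have power: "P (a ^ n)" if "P a" for a n
    using that by (induction n) (auto intro: mult one)
  have prod: "P (prod z S)" if "\<And>s. P (z s)" for z :: "'x + 'x \<Rightarrow> _" and S
    using that by (induction S rule: infinite_finite_induct) (auto intro: mult one)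
  have "P (mp_const (lookup F m) * (\<Prod>i\<in>keys m. mp_var i ^ lookup m i))" for m
    by (intro mult const prod power var)
  then obtain f g where "mp_const (lookup F m) * (\<Prod>i\<in>keys m. mp_var i ^ lookup m i) = ?L (f m) * ?R (g m)" for m
    unfolding P_def by metis
  then have "F = (\<Sum>m\<in>keys F. ?L (f m) * ?R (g m))"
    using mp_eval_self[of F] by (simp add: mp_eval_def)
  then show ?thesis by (rule that)
qed

text \<open>The product behaves as a pure tensor in the group algebra of pairs.\<close>

lemma lookup_pair:
  fixes A B :: "'g::comm_monoid_add \<Rightarrow>\<^sub>0 'b::comm_ring_1"
  shows "lookup (push_forward (\<lambda>m. (m, 0)) A * push_forward (\<lambda>m. (0, m)) B) (\<mu>, \<nu>) = lookup A \<mu> * lookup B \<nu>"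
proof -
  have zero: "push_forward g (0 :: 'g \<Rightarrow>\<^sub>0 'b) = 0" for g :: "'g \<Rightarrow> 'g \<times> 'g"
    by (simp add: push_forward_def)
  show ?thesis
  proof (induction A rule: poly_mapping_induct)
    case (single m a)
    have "lookup (single (m, 0) a * push_forward (Pair 0) B) (\<mu>, \<nu>) = lookup (single m a) \<mu> * lookup B \<nu>"
      by (induction B rule: poly_mapping_induct)
        (auto simp: zero push_forward_single push_forward_add mult_single lookup_add lookup_single
          when_def distrib_left)
    then show ?case by (simp add: push_forward_single)
  qed (auto simp: zero push_forward_add lookup_add distrib_right)
qed

lemma lookup_single_zero_mult: "lookup (single 0 c * s) \<nu> = c * lookup s \<nu>"
  by (subst mult_map_scale_conv_mult[symmetric]) (simp add: lookup_map)

text \<open>The comultiplication of the closed image of a homomorphism: after writing an element of the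
  kernel in terms of second components that are independent on the image, the first components
  vanish on the image.\<close>

lemma tensor_kernel:
  fixes "to" :: "'k::field \<Rightarrow> 'l::field" and x :: "'x \<Rightarrow> ('g::comm_monoid_add \<Rightarrow>\<^sub>0 'l)"
  defines "h \<equiv> \<lambda>c. single 0 (to c)"
  defines "I \<equiv> {f. mp_eval h x f = 0}"
  assumes to: "rhom to"
    and indep: "\<And>S. finite S \<Longrightarrow> S \<subseteq> range (mp_eval h x) \<Longrightarrow> lin_indep h S \<Longrightarrow> lin_indep (single 0) S"
    and F: "mp_eval (\<lambda>c. single 0 (to c))
      (case_sum (\<lambda>v. push_forward (\<lambda>m. (m, 0)) (x v)) (\<lambda>v. push_forward (\<lambda>m. (0, m)) (x v))) F = 0"
  shows "F \<in> ideal_gen (mp_eval mp_const (\<lambda>v. mp_var (Inl v)) ` I \<union>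
                        mp_eval mp_const (\<lambda>v. mp_var (Inr v)) ` I)" (is "F \<in> ideal_gen ?G")
proof -
  let ?L = "mp_eval mp_const (\<lambda>v. mp_var (Inl v)) :: ('x,'k) mpoly \<Rightarrow> ('x + 'x, 'k) mpoly"
  let ?R = "mp_eval mp_const (\<lambda>v. mp_var (Inr v)) :: ('x,'k) mpoly \<Rightarrow> ('x + 'x, 'k) mpoly"
  let ?p1 = "push_forward (\<lambda>m. (m, 0)) :: ('g \<Rightarrow>\<^sub>0 'l) \<Rightarrow> _"
  let ?p2 = "push_forward (\<lambda>m. (0, m)) :: ('g \<Rightarrow>\<^sub>0 'l) \<Rightarrow> _"
  let ?h2 = "\<lambda>c. single (0::'g \<times> 'g) (to c)"
  let ?ev2 = "mp_eval ?h2 (case_sum (\<lambda>v. ?p1 (x v)) (\<lambda>v. ?p2 (x v)))"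
  let ?ev = "mp_eval h x"
  have h: "rhom h" unfolding h_def by (rule rhom_comp[OF to rhom_single])
  have h2: "rhom ?h2" by (rule rhom_comp[OF to rhom_single])
  interpret L: rhom ?L by (intro rhom_mp_eval rhom_mp_const)
  interpret R: rhom ?R by (intro rhom_mp_eval rhom_mp_const)
  interpret p1: rhom ?p1 by (rule rhom_push_forward) (auto simp: zero_prod_def)
  interpret p2: rhom ?p2 by (rule rhom_push_forward) (auto simp: zero_prod_def)
  interpret ev: rhom ?ev by (rule rhom_mp_eval[OF h])
  interpret ev2: rhom ?ev2 by (rule rhom_mp_eval[OF h2])
  have hp: "?p1 (h c) = ?h2 c" "?p2 (h c) = ?h2 c" for c
    by (simp_all add: h_def push_forward_single zero_prod_def)
  have ev2L: "?ev2 (?L f) = ?p1 (?ev f)" for f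
    unfolding rhom_mp_eval_comp[OF ev2.rhom_axioms] rhom_mp_eval_comp[OF p1.rhom_axioms]
    by (simp add: rhom.eval_const[OF h2] rhom.eval_var[OF h2] hp)
  have ev2R: "?ev2 (?R f) = ?p2 (?ev f)" for f
    unfolding rhom_mp_eval_comp[OF ev2.rhom_axioms] rhom_mp_eval_comp[OF p2.rhom_axioms]
    by (simp add: rhom.eval_const[OF h2] rhom.eval_var[OF h2] hp)
  define K where "K = keys F"
  obtain f g where fg: "F = (\<Sum>m\<in>K. ?L (f m) * ?R (g m))"
    unfolding K_def by (rule mpoly_split)
  have finK: "finite K" by (simp add: K_def)
  obtain S where S: "S \<subseteq> (\<lambda>m. ?ev (g m)) ` K" "finite S" "lin_indep h S"
    "\<forall>c \<in> (\<lambda>m. ?ev (g m)) ` K. \<exists>a. c = (\<Sum>s\<in>S. h (a s) * s)"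
    by (rule finite_lin_indep_basis[OF h finite_imageI[OF finK, of "\<lambda>m. ?ev (g m)"]])
  then have "\<forall>m\<in>K. \<exists>a. ?ev (g m) = (\<Sum>s\<in>S. h (a s) * s)" by blast
  then obtain a where a: "\<And>m. m \<in> K \<Longrightarrow> ?ev (g m) = (\<Sum>s\<in>S. h (a m s) * s)" by metis
  have "\<forall>s\<in>S. \<exists>G. ?ev G = s" using S(1) by blast
  then obtain G where G: "\<And>s. s \<in> S \<Longrightarrow> ?ev (G s) = s" by metis
  \<comment> \<open>r m is g m minus a preimage of the expansion of its value in the basis S, so r m
    lies in the kernel.\<close>
  define r where "r m = g m - (\<Sum>s\<in>S. mp_const (a m s) * G s)" for m
  have r: "?ev (r m) = 0" if "m \<in> K" for m
    unfolding r_def using that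
    by (simp add: ev.diff ev.sum ev.mult rhom.eval_const[OF h] G a)
  define Fs where "Fs s = (\<Sum>m\<in>K. mp_const (a m s) * f m)" for s
  have LR: "?L (mp_const c) = ?R (mp_const c)" for c
    by (simp add: rhom.eval_const[OF rhom_mp_const])
  have split: "F = (\<Sum>m\<in>K. ?L (f m) * ?R (r m)) + (\<Sum>s\<in>S. ?L (Fs s) * ?R (G s))"
  proof -
    have "(\<Sum>s\<in>S. ?L (Fs s) * ?R (G s)) =
        (\<Sum>s\<in>S. \<Sum>m\<in>K. ?L (f m) * ?R (mp_const (a m s) * G s))"
      by (simp add: Fs_def L.sum L.mult R.mult LR sum_distrib_right sum_distrib_left ac_simps)
    also have "\<dots> = (\<Sum>m\<in>K. \<Sum>s\<in>S. ?L (f m) * ?R (mp_const (a m s) * G s))"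
      by (rule sum.swap)
    finally have "(\<Sum>m\<in>K. ?L (f m) * ?R (r m)) + (\<Sum>s\<in>S. ?L (Fs s) * ?R (G s)) =
        (\<Sum>m\<in>K. ?L (f m) * ?R (g m))"
      by (simp add: r_def R.diff R.sum sum_distrib_left right_diff_distrib sum_subtractf)
    with fg show ?thesis by (rule trans[OF _ sym])
  qed
  have "(\<Sum>s\<in>S. ?p1 (?ev (Fs s)) * ?p2 s) = 0"
    using F r G unfolding split
    by (simp add: ev2.add ev2.sum ev2.mult ev2L ev2R p2.zero)
  \<comment> \<open>Fixing the first exponent \<mu> turns the vanishing of the tensor into a linear
    relation over \<open>'l\<close> among the members of S, which are independent over
    \<open>'l\<close> by assumption.\<close>
  then have "(\<Sum>s\<in>S. lookup (?ev (Fs s)) \<mu> * lookup s \<nu>) = 0" for \<mu> \<nu>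
    by (metis (mono_tags, lifting) lookup_pair lookup_sum lookup_zero sum.cong)
  then have "(\<Sum>s\<in>S. single 0 (lookup (?ev (Fs s)) \<mu>) * s) = 0" for \<mu>
    by (intro poly_mapping_eqI) (simp add: lookup_sum lookup_single_zero_mult)
  moreover have "lin_indep (single 0 :: 'l \<Rightarrow> _) S"
    by (rule indep) (use S in auto)
  ultimately have "lookup (?ev (Fs s)) \<mu> = 0" if "s \<in> S" for s \<mu>
    using that unfolding lin_indep_def by (auto dest: spec[of _ "\<lambda>s. lookup (?ev (Fs s)) \<mu>"])
  then have Fs: "?ev (Fs s) = 0" if "s \<in> S" for s
    using that by (intro poly_mapping_eqI) simp
  show ?thesis
    unfolding split
  proof (intro ideal_gen_add ideal_gen_sum)
    fix m assume "m \<in> K"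
    then show "?L (f m) * ?R (r m) \<in> ideal_gen ?G"
      using r by (intro ideal_gen_mult ideal_gen_base) (auto simp: I_def)
  next
    fix s assume "s \<in> S"
    then show "?L (Fs s) * ?R (G s) \<in> ideal_gen ?G"
      using Fs by (subst mult.commute) (intro ideal_gen_mult ideal_gen_base, auto simp: I_def)
  qed
qed

section \<open>Closed images of homomorphisms from diagonalizable groups\<close>

lemma push_forward_comp: "push_forward g (push_forward f p) = push_forward (\<lambda>m. g (f m)) p"
proof (induction p rule: poly_mapping_induct)
  case zero
  show ?case by (simp add: push_forward_def)
qed (simp_all add: push_forward_single push_forward_add)

lemma push_forward_ident: "push_forward (\<lambda>m. m) p = p"
  unfolding push_forward_def by (rule poly_mapping_sum_singles[symmetric])

lemma unit_inverse_unique: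
  fixes a b c :: "'a::comm_ring_1"
  shows "a * b = 1 \<Longrightarrow> c * b = 1 \<Longrightarrow> a = c"
  by (metis mult.assoc mult.commute mult_1)

lemma rhom_field_eq_0: "rhom h \<Longrightarrow> h x = 0 \<Longrightarrow> x = 0"
  for h :: "'a::field \<Rightarrow> 'b::comm_ring_1"
  by (metis mult_zero_left rhom.mult rhom.one right_inverse zero_neq_one)

text \<open>\<open>'g\<close> is the character group and M the generic point of a representation;
  the second axiom reads M(s t) = M(s) M(t).\<close>

locale comult_point =
  fixes M :: "('g::ab_group_add \<Rightarrow>\<^sub>0 'l::field)^'m^'m::finite" and d :: "'g \<Rightarrow>\<^sub>0 'l"
  assumes inv_det: "d * det M = 1"
    and comult: "map_matrix (push_forward (\<lambda>m. (m, m))) M =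
      map_matrix (push_forward (\<lambda>m. (m, 0))) M ** map_matrix (push_forward (\<lambda>m. (0, m))) M"
begin

lemma map_matrix_comp: "map_matrix f (map_matrix g A) = map_matrix (\<lambda>x. f (g x)) A"
  by (simp add: map_matrix_def vec_eq_iff)

lemma map_matrix_ident: "map_matrix (\<lambda>x. x) A = A"
  by (simp add: map_matrix_def vec_eq_iff)

lemma push_forward_ident': "push_forward (\<lambda>m. m) = (\<lambda>p. p)"
  by (simp add: fun_eq_iff push_forward_ident)

text \<open>Homomorphisms from pairs of exponents are substitutions for (s, t) in M(s t) = M(s)
  M(t). The first projection sets t = 1, the difference of the components sets t to the inverse of
  s.\<close>

lemma specialise_comult:
  assumes "g (0, 0) = (0 :: 'h::comm_monoid_add)" "\<And>a b. g (a + b) = g a + g b"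
  shows "map_matrix (push_forward (\<lambda>m. g (m, m))) M =
    map_matrix (push_forward (\<lambda>m. g (m, 0))) M ** map_matrix (push_forward (\<lambda>m. g (0, m))) M"
proof -
  interpret rhom "push_forward g :: ('g \<times> 'g \<Rightarrow>\<^sub>0 'l) \<Rightarrow> _"
    by (rule rhom_push_forward) (use assms in \<open>auto simp: zero_prod_def\<close>)
  from arg_cong[OF comult, of "map_matrix (push_forward g)"] show ?thesis
    by (simp add: matrix_mult map_matrix_comp push_forward_comp)
qed

text \<open>With t = 1 the axiom gives M = M ** M(1), and M can be cancelled since its determinant
  is a unit.\<close>

lemma counit: "map_matrix (push_forward (\<lambda>m. 0)) M = (mat 1 :: ('h::comm_monoid_add \<Rightarrow>\<^sub>0 'l)^'m^'m)"
proof -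
  have "M ** map_matrix (push_forward (\<lambda>m. 0)) M = M"
    by (rule specialise_comult[of fst, symmetric,
          simplified fst_conv fst_zero fst_add push_forward_ident' map_matrix_ident simp_thms]) simp_all
  then have 1: "map_matrix (push_forward (\<lambda>m. 0 :: 'g)) M = mat 1"
    by (subst matrix_cancel_left[OF inv_det, of _ "mat 1"]) simp_all
  interpret rhom "push_forward (\<lambda>m. 0 :: 'h) :: ('g \<Rightarrow>\<^sub>0 'l) \<Rightarrow> _"
    by (rule rhom_push_forward) auto
  show ?thesis
    using arg_cong[OF 1, of "map_matrix (push_forward (\<lambda>m. 0 :: 'h))"]
    by (simp add: map_matrix_comp push_forward_comp matrix_one)
qed

lemma inverse: "M ** map_matrix (push_forward uminus) M = mat 1"
proof -
  have "map_matrix (push_forward (\<lambda>m. 0)) M = M ** map_matrix (push_forward uminus) M"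
    using specialise_comult[of "\<lambda>(a, b). a - b"] by (simp add: push_forward_ident map_matrix_def split_beta)
  then show ?thesis by (simp add: counit)
qed

text \<open>Counit and antipode come from sending exponents to 0 and negating them, comultiplication
  from \<open>tensor_kernel\<close>. The map \<open>to\<close> allows one proof for the group over
  the closure (\<open>to\<close> the identity) and for its form over k.\<close>

lemma closed_subgroup_kernel:
  fixes "to" :: "'k::field \<Rightarrow> 'l"
  defines "h \<equiv> \<lambda>c. single 0 (to c)"
  defines "I \<equiv> {f. mp_eval h (gl_point M d) f = 0}"
  assumes to: "rhom to"
    and indep: "\<And>S. finite S \<Longrightarrow> S \<subseteq> range (mp_eval h (gl_point M d)) \<Longrightarrow> lin_indep h S \<Longrightarrow>
      lin_indep (single 0) S"
  shows "closed_subgroup I"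
proof -
  have h: "rhom h" unfolding h_def by (rule rhom_comp[OF to rhom_single])
  interpret h: rhom h by (rule h)
  interpret ev: rhom "mp_eval h (gl_point M d)" by (rule rhom_mp_eval[OF h])
  have ring: "ring_ideal I"
    using ev.rhom_axioms unfolding ring_ideal_iff I_def by (auto simp: ev.add ev.mult ev.zero)
  have "map_matrix (mp_eval h (gl_point M d)) (var_matrix (\<lambda>v. v)) = M"
    by (simp add: vec_eq_iff map_matrix_def var_matrix_def h.eval_var gl_point_def)
  then have rel: "gl_relation \<in> I"
    by (simp add: I_def gl_relation_def ev.diff ev.mult ev.det ev.one h.eval_var)
      (simp add: gl_point_def inv_det)
  have counit': "gl_counit f = 0" if "f \<in> I" for f
  proof -
    interpret u: rhom "push_forward (\<lambda>m. 0 :: 'g) :: ('g \<Rightarrow>\<^sub>0 'l) \<Rightarrow> _"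
      by (rule rhom_push_forward) auto
    have hh: "push_forward (\<lambda>m. 0) (h c) = h c" for c
      by (simp add: h_def push_forward_single)
    have "push_forward (\<lambda>m. 0) d = (1 :: 'g \<Rightarrow>\<^sub>0 'l)"
      using arg_cong[OF inv_det, of "push_forward (\<lambda>m. 0 :: 'g)"]
      by (simp add: u.mult u.det u.one counit)
    then have "mp_eval h (gl_point (mat 1) 1) f = push_forward (\<lambda>m. 0) (mp_eval h (gl_point M d) f)"
      by (simp only: mp_eval_gl_point_comp[OF u.rhom_axioms] hh counit)
    with that have "mp_eval h (gl_point (mat 1) 1) f = 0"
      by (simp add: I_def u.zero)
    then have "h (gl_counit f) = 0"
      by (simp add: gl_counit_def mp_eval_gl_point_comp[OF h] h.matrix_one h.one)
    then show ?thesis by (rule rhom_field_eq_0[OF h])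
  qed
  have antipode: "gl_antipode f \<in> I" if "f \<in> I" for f
  proof -
    let ?N = "map_matrix (push_forward uminus) M"
    interpret u: rhom "push_forward uminus :: ('g \<Rightarrow>\<^sub>0 'l) \<Rightarrow> _"
      by (rule rhom_push_forward) auto
    have hh: "push_forward uminus (h c) = h c" for c
      by (simp add: h_def push_forward_single)
    \<comment> \<open>No axiom mentions the image of d under maps of exponents; it is found as the
      unique inverse of a determinant.\<close>
    have "push_forward uminus d * det ?N = 1"
      using arg_cong[OF inv_det, of "push_forward uminus"] by (simp add: u.mult u.det u.one)
    moreover have "det M * det ?N = 1"
      using arg_cong[OF inverse, of det] by (simp add: det_mul)
    ultimately have d: "push_forward uminus d = det M"
      by (rule unit_inverse_unique)
    have "mp_eval h (gl_point M d) (gl_antipode f) = push_forward uminus (mp_eval h (gl_point M d) f)"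
      unfolding eval_antipode[OF h inverse inv_det] mp_eval_gl_point_comp[OF u.rhom_axioms] hh d ..
    with that show ?thesis by (simp add: I_def u.zero)
  qed
  have comult': "gl_comult f \<in> ideal_gen (mp_eval mp_const (\<lambda>v. mp_var (Inl v)) ` I \<union>
                 mp_eval mp_const (\<lambda>v. mp_var (Inr v)) ` I)" if "f \<in> I" for f
    unfolding I_def h_def
  proof (rule tensor_kernel[OF to])
    fix S assume "finite S" "S \<subseteq> range (mp_eval (\<lambda>c. single 0 (to c)) (gl_point M d))"
      "lin_indep (\<lambda>c. single (0::'g) (to c)) S"
    then show "lin_indep (single (0::'g)) S" by (intro indep) (simp_all add: h_def)
  next
    let ?p1 = "push_forward (\<lambda>m. (m, 0)) :: ('g \<Rightarrow>\<^sub>0 'l) \<Rightarrow> ('g \<times> 'g \<Rightarrow>\<^sub>0 'l)"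
    let ?p2 = "push_forward (\<lambda>m. (0, m)) :: ('g \<Rightarrow>\<^sub>0 'l) \<Rightarrow> ('g \<times> 'g \<Rightarrow>\<^sub>0 'l)"
    let ?p = "push_forward (\<lambda>m. (m, m)) :: ('g \<Rightarrow>\<^sub>0 'l) \<Rightarrow> ('g \<times> 'g \<Rightarrow>\<^sub>0 'l)"
    let ?h2 = "\<lambda>c. single (0 :: 'g \<times> 'g) (to c)"
    interpret p1: rhom ?p1 by (rule rhom_push_forward) (auto simp: zero_prod_def)
    interpret p2: rhom ?p2 by (rule rhom_push_forward) (auto simp: zero_prod_def)
    interpret p: rhom ?p by (rule rhom_push_forward) (auto simp: zero_prod_def)
    have h2: "rhom ?h2" by (rule rhom_comp[OF to rhom_single])
    have inv: "?p d * det (map_matrix ?p M) = 1" "?p1 d * det (map_matrix ?p1 M) = 1"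
        "?p2 d * det (map_matrix ?p2 M) = 1"
      by (simp_all flip: p.det p1.det p2.det p.mult p1.mult p2.mult add: inv_det p.one p1.one p2.one)
    have "(?p1 d * ?p2 d) * det (map_matrix ?p M) =
        (?p1 d * det (map_matrix ?p1 M)) * (?p2 d * det (map_matrix ?p2 M))"
      unfolding comult det_mul by (simp only: ac_simps)
    then have "(?p1 d * ?p2 d) * det (map_matrix ?p M) = 1"
      unfolding inv by simp
    with inv(1) have d: "?p d = ?p1 d * ?p2 d"
      by (rule unit_inverse_unique)
    have hh: "?p (h c) = ?h2 c" for c
      by (simp add: h_def push_forward_single zero_prod_def)
    have "mp_eval ?h2 (case_sum (\<lambda>v. ?p1 (gl_point M d v)) (\<lambda>v. ?p2 (gl_point M d v))) (gl_comult f) =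
        ?p (mp_eval h (gl_point M d) f)"
      unfolding comp_gl_point eval_comult[OF h2] mp_eval_gl_point_comp[OF p.rhom_axioms] hh d comult ..
    with that show "mp_eval ?h2 (case_sum (\<lambda>v. ?p1 (gl_point M d v)) (\<lambda>v. ?p2 (gl_point M d v)))
        (gl_comult f) = 0"
      by (simp add: I_def p.zero)
  qed
  show ?thesis
    unfolding closed_subgroup_def using ring rel counit' antipode comult' by blast
qed

end

subsection \<open>Descent from an extension field\<close>

text \<open>V is linearly disjoint from \<open>'l\<close> over \<open>'k\<close>: members of
  \<open>'l\<close> that are independent over \<open>'k\<close> stay independent with coefficients
  in V. For subspaces of a k-form of the Laurent ring this holds, and it is all that descent
  uses.\<close>

definition descends :: "('k::comm_ring_1 \<Rightarrow> 'l::comm_ring_1) \<Rightarrow> ('g::comm_monoid_add \<Rightarrow>\<^sub>0 'l) set \<Rightarrow> bool"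
  where "descends to V \<longleftrightarrow> (\<forall>S r. finite S \<and> lin_indep to S \<and> (\<forall>b\<in>S. r b \<in> V) \<and>
    (\<Sum>b\<in>S. single 0 b * r b) = 0 \<longrightarrow> (\<forall>b\<in>S. r b = 0))"

lemma descendsD: "descends to V \<Longrightarrow> finite S \<Longrightarrow> lin_indep to S \<Longrightarrow> (\<And>b. b \<in> S \<Longrightarrow> r b \<in> V) \<Longrightarrow>
    (\<Sum>b\<in>S. single 0 b * r b) = 0 \<Longrightarrow> b \<in> S \<Longrightarrow> r b = 0"
  unfolding descends_def by blast

lemma descends_subset: "descends to V \<Longrightarrow> W \<subseteq> V \<Longrightarrow> descends to W"
  unfolding descends_def by blast

text \<open>Expand the coefficients \<gamma> c in a set B independent over \<open>'k\<close>. The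
  coefficient r b of each b is then a combination of S over \<open>'k\<close>, so it lies in the
  range; disjointness gives r b = 0, and independence of S over \<open>'k\<close> finishes.\<close>

lemma lin_indep_extend:
  fixes "to" :: "'k::field \<Rightarrow> 'l::field" and x :: "'x \<Rightarrow> ('g::comm_monoid_add \<Rightarrow>\<^sub>0 'l)"
  assumes to: "rhom to" and V: "descends to (range (mp_eval (\<lambda>c. single 0 (to c)) x))" (is "descends _ (range ?ev)")
    and S: "finite S" "S \<subseteq> range (mp_eval (\<lambda>c. single 0 (to c)) x)" "lin_indep (\<lambda>c. single (0::'g) (to c)) S"
  shows "lin_indep (single 0) S"
  unfolding lin_indep_def
proof safe
  fix \<gamma> c assume \<gamma>: "(\<Sum>c\<in>S. single 0 (\<gamma> c) * c) = 0" and c: "c \<in> S"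
  have h: "rhom (\<lambda>c. single (0::'g) (to c))" by (rule rhom_comp[OF to rhom_single])
  interpret h: rhom "\<lambda>c. single (0::'g) (to c)" by (rule h)
  interpret ev: rhom ?ev by (rule rhom_mp_eval[OF h])
  interpret s: rhom "single (0::'g) :: 'l \<Rightarrow> _" by (rule rhom_single)
  obtain B where B: "B \<subseteq> \<gamma> ` S" "finite B" "lin_indep to B" "\<forall>y\<in>\<gamma> ` S. \<exists>a. y = (\<Sum>b\<in>B. to (a b) * b)"
    by (rule finite_lin_indep_basis[OF to finite_imageI[OF S(1)]])
  then have "\<forall>c\<in>S. \<exists>a. \<gamma> c = (\<Sum>b\<in>B. to (a b) * b)" by blast
  then obtain a where a: "\<And>c. c \<in> S \<Longrightarrow> \<gamma> c = (\<Sum>b\<in>B. to (a c b) * b)" by metis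
  define r where "r b = (\<Sum>c\<in>S. single (0::'g) (to (a c b)) * c)" for b
  have "\<forall>c\<in>S. \<exists>g. ?ev g = c" using S(2) by blast
  then obtain G where G: "\<And>c. c \<in> S \<Longrightarrow> ?ev (G c) = c" by metis
  have "r b = ?ev (\<Sum>c\<in>S. mp_const (a c b) * G c)" for b
    by (simp add: r_def ev.sum ev.mult h.eval_const G)
  then have rV: "r b \<in> range ?ev" for b by blast
  have "(\<Sum>b\<in>B. single 0 b * r b) = (\<Sum>b\<in>B. \<Sum>c\<in>S. single 0 (to (a c b) * b) * c)"
    by (simp add: r_def sum_distrib_left s.mult ac_simps)
  also have "\<dots> = (\<Sum>c\<in>S. \<Sum>b\<in>B. single 0 (to (a c b) * b) * c)"
    by (rule sum.swap)
  also have "\<dots> = (\<Sum>c\<in>S. single 0 (\<gamma> c) * c)"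
    by (simp add: a s.sum sum_distrib_right)
  finally have sum: "(\<Sum>b\<in>B. single 0 b * r b) = (\<Sum>c\<in>S. single 0 (\<gamma> c) * c)" .
  have "r b = 0" if "b \<in> B" for b
    by (rule descendsD[OF V B(2,3), of r]) (simp_all only: rV sum \<gamma> that)
  then have "a c b = 0" if "b \<in> B" for b
    using S(3) that c unfolding lin_indep_def r_def by (auto dest: spec[of _ "\<lambda>c. a c b"])
  then show "\<gamma> c = 0"
    using a[OF c] by (simp add: rhom.zero[OF to])
qed

text \<open>Write f = \<Sum> b F_b with F_b over k and the b independent over k. Its value is \<Sum>
  b ev(F_b), so disjointness puts every F_b into the kernel over k.\<close>

lemma base_change_kernel:
  fixes x :: "'x \<Rightarrow> ('g::comm_monoid_add \<Rightarrow>\<^sub>0 'k::field alg_closure)"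
  assumes V: "descends to_ac (range (mp_eval (\<lambda>c. single 0 (to_ac c)) x))" (is "descends _ (range ?ev)")
  shows "base_change {f. mp_eval (\<lambda>c. single 0 (to_ac c)) x f = 0} = {f. mp_eval (single 0) x f = 0}"
proof
  interpret to: rhom "to_ac :: 'k \<Rightarrow> _" by (rule rhom_to_ac)
  interpret s: rhom "single (0::'g) :: 'k alg_closure \<Rightarrow> _" by (rule rhom_single)
  interpret E: rhom "mp_eval (single 0) x" by (rule rhom_mp_eval[OF rhom_single])
  interpret c: rhom "mp_const :: _ \<Rightarrow> ('x, 'k alg_closure) mpoly" by (rule rhom_mp_const)
  have ev: "mp_eval (single 0) x (map_coeffs to_ac f) = ?ev f" for f
    by (rule to.mp_eval_map[OF rhom_single])
  show "base_change {f. ?ev f = 0} \<subseteq> {f. mp_eval (single 0) x f = 0}"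
    unfolding base_change_def
    by (rule ideal_gen_minimal) (auto simp: ring_ideal_iff E.add E.mult E.zero ev)
  show "{f. mp_eval (single 0) x f = 0} \<subseteq> base_change {f. ?ev f = 0}"
  proof
    fix f assume "f \<in> {f. mp_eval (single 0) x f = 0}"
    then have f: "mp_eval (single 0) x f = 0" by simp
    define K where "K = keys f"
    have K: "finite K" by (simp add: K_def)
    obtain S where S: "S \<subseteq> lookup f ` K" "finite S" "lin_indep to_ac S"
      "\<forall>y\<in>lookup f ` K. \<exists>a :: _ \<Rightarrow> 'k. y = (\<Sum>b\<in>S. to_ac (a b) * b)"
      by (rule finite_lin_indep_basis[OF rhom_to_ac finite_imageI[OF K]])
    then have "\<forall>m\<in>K. \<exists>a :: _ \<Rightarrow> 'k. lookup f m = (\<Sum>b\<in>S. to_ac (a b) * b)" by blast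
    then obtain a :: "_ \<Rightarrow> _ \<Rightarrow> 'k"
      where a: "\<And>m. m \<in> K \<Longrightarrow> lookup f m = (\<Sum>b\<in>S. to_ac (a m b) * b)" by metis
    define F where "F b = (\<Sum>m\<in>K. single m (a m b))" for b
    have "(\<Sum>b\<in>S. mp_const b * map_coeffs to_ac (F b)) =
        (\<Sum>b\<in>S. \<Sum>m\<in>K. single m (to_ac (a m b) * b))"
      by (simp add: F_def rhom.sum[OF to.rhom_map] mp_const_def sum_distrib_left mult_single ac_simps)
    also have "\<dots> = (\<Sum>m\<in>K. \<Sum>b\<in>S. single m (to_ac (a m b) * b))"
      by (rule sum.swap)
    also have "\<dots> = (\<Sum>m\<in>K. single m (lookup f m))"
      by (rule sum.cong) (simp_all add: a, induction S rule: infinite_finite_induct, simp_all add: single_add)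
    also have "\<dots> = f"
      unfolding K_def by (rule poly_mapping_sum_singles[symmetric])
    finally have split: "(\<Sum>b\<in>S. mp_const b * map_coeffs to_ac (F b)) = f" .
    from f have "(\<Sum>b\<in>S. single 0 b * ?ev (F b)) = 0"
      by (simp add: E.sum E.mult s.eval_const ev flip: split)
    from descendsD[OF V S(2,3) _ this] have "?ev (F b) = 0" if "b \<in> S" for b
      using that by blast
    then show "f \<in> base_change {f. ?ev f = 0}"
      unfolding split[symmetric] base_change_def
      by (intro ideal_gen_sum ideal_gen_mult ideal_gen_base) auto
  qed
qed

text \<open>The range makes the map a closed immersion of a split torus over the closure;
  disjointness makes its ideal the base change of an ideal over k.\<close>

lemma torus_kernel:
  fixes M :: "'k::field alg_closure laurent^'m^'m::finite"
  assumes "comult_point M d"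
    and range: "range (mp_eval (single 0) (gl_point M d)) = laurent_ring r"
    and V: "descends to_ac (range (mp_eval (\<lambda>c. single 0 (to_ac c)) (gl_point M d)))"
  shows "torus {f. mp_eval (\<lambda>c. single 0 (to_ac c)) (gl_point M d) f = 0}"
proof -
  interpret comult_point M d by fact
  have *: "closed_subgroup {f. mp_eval (\<lambda>c. single 0 (to_ac c)) (gl_point M d) f = 0}"
    by (rule closed_subgroup_kernel[OF rhom_to_ac], rule lin_indep_extend[OF rhom_to_ac V])
  have "closed_subgroup {f. mp_eval (single 0) (gl_point M d) f = 0}"
    by (rule closed_subgroup_kernel[OF rhom_id(1)])
  moreover have "push_forward (\<lambda>m. (m, m)) (M $ i $ j) =
        (\<Sum>k\<in>UNIV. push_forward (\<lambda>m. (m, 0)) (M $ i $ k) * push_forward (\<lambda>m. (0, m)) (M $ k $ j))" for i j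
    using arg_cong[OF comult, of "\<lambda>A. A $ i $ j"] by (simp add: map_matrix_def matrix_matrix_mult_def)
  ultimately have "split_torus {f. mp_eval (single 0) (gl_point M d) f = 0}"
    unfolding split_torus_def
    by (intro conjI exI[of _ r] exI[of _ M] exI[of _ d] allI) (simp_all only: range)
  with * show ?thesis
    by (simp only: torus_def base_change_kernel[OF V])
qed

text \<open>A form of the Laurent polynomial ring over the extension field: it is cut out by the
  automorphism of the exponents \<open>g\<close> together with conjugation of the square root \<open>s\<close>.\<close>

definition twisted_form :: "('k::field \<Rightarrow> 'l::field) \<Rightarrow> 'l \<Rightarrow> ('g \<Rightarrow> 'g) \<Rightarrow> ('g::comm_monoid_add \<Rightarrow>\<^sub>0 'l) set"
  where "twisted_form to s g = {r. r + push_forward g r \<in> range (map_coeffs to) \<and>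
    single 0 s * (r - push_forward g r) \<in> range (map_coeffs to)}"

text \<open>Membership in the form says that r has coefficients x + s y over k and that
  \<open>push_forward g\<close> replaces s by -s in them. Trace and difference express this without
  choosing an automorphism of the extension field.\<close>

locale twisting = rhom "to" for "to" :: "'k::field \<Rightarrow> 'l::field" +
  fixes s :: 'l and t :: 'k and g :: "'g::comm_monoid_add \<Rightarrow> 'g"
  assumes s: "s * s = to t" "s \<noteq> 0" and two: "(2 :: 'l) \<noteq> 0"
    and g: "g 0 = 0" "\<And>a b. g (a + b) = g a + g b"
begin

abbreviation "R \<equiv> twisted_form to s g"

lemmas m_rhom = rhom_map[where ?'x = 'g]

lemma g_rhom: "rhom (push_forward g :: ('g \<Rightarrow>\<^sub>0 'l) \<Rightarrow> _)"
  by (rule rhom_push_forward[OF g])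

lemmas m_add = rhom.add[OF m_rhom] and m_mult = rhom.mult[OF m_rhom] and m_zero = rhom.zero[OF m_rhom]
lemmas g_add = rhom.add[OF g_rhom] and g_mult = rhom.mult[OF g_rhom] and g_zero = rhom.zero[OF g_rhom]
  and g_sum = rhom.sum[OF g_rhom]

lemma range_map_add: "a \<in> range (map_coeffs to) \<Longrightarrow> b \<in> range (map_coeffs to) \<Longrightarrow>
    a + b \<in> range (map_coeffs to :: ('g \<Rightarrow>\<^sub>0 'k) \<Rightarrow> _)"
  by (auto simp flip: m_add)

lemma range_map_mult: "a \<in> range (map_coeffs to) \<Longrightarrow> b \<in> range (map_coeffs to) \<Longrightarrow>
    a * b \<in> range (map_coeffs to :: ('g \<Rightarrow>\<^sub>0 'k) \<Rightarrow> _)"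
  by (auto simp flip: m_mult)

lemma range_map_single: "single m (to a) \<in> range (map_coeffs to)"
  by (metis map_single rangeI zero)

lemma range_map_zero: "0 \<in> range (map_coeffs to :: ('g \<Rightarrow>\<^sub>0 'k) \<Rightarrow> _)"
  by (metis m_zero rangeI)

lemma const_in_R: "single 0 (to a) \<in> R"
  using range_map_add[OF range_map_single range_map_single, of 0 a 0 a]
  by (simp add: twisted_form_def push_forward_single g range_map_zero)

lemma add_in_R: "a \<in> R \<Longrightarrow> b \<in> R \<Longrightarrow> a + b \<in> R"
proof -
  assume ab: "a \<in> R" "b \<in> R"
  then have A: "a + push_forward g a \<in> range (map_coeffs to)"
      "b + push_forward g b \<in> range (map_coeffs to)"
      "single 0 s * (a - push_forward g a) \<in> range (map_coeffs to)"
      "single 0 s * (b - push_forward g b) \<in> range (map_coeffs to)"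
    by (simp_all add: twisted_form_def)
  have eq: "a + b + push_forward g (a + b) = (a + push_forward g a) + (b + push_forward g b)"
    "single 0 s * (a + b - push_forward g (a + b)) =
      single 0 s * (a - push_forward g a) + single 0 s * (b - push_forward g b)"
    by (simp_all add: g_add algebra_simps)
  show ?thesis
    by (simp only: twisted_form_def mem_Collect_eq eq range_map_add A)
qed

lemma mult_in_R: "a \<in> R \<Longrightarrow> b \<in> R \<Longrightarrow> a * b \<in> R"
proof -
  assume ab: "a \<in> R" "b \<in> R"
  define S H T where "S = single (0::'g) s" "H = single (0::'g) (to (1/2))" "T = single (0::'g) (to (1/t))"
  have to2: "to (1/2) * 2 = 1"
  proof -
    have "(2::'k) \<noteq> 0" using two of_numeral[of "num.Bit0 num.One"] zero by metis
    then have "(1/2 :: 'k) * 2 = 1" by simp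
    then show ?thesis by (metis mult of_numeral one)
  qed
  have "H * 2 = single 0 (to (1/2) * 2)"
    by (simp add: S_H_T_def mult_single flip: single_numeral)
  then have H: "H * 2 = 1"
    by (simp add: to2)
  have t: "t \<noteq> 0" using s zero by auto
  have "T * (S * S) = single 0 (to (1/t) * to t)"
    by (simp add: S_H_T_def mult_single s)
  then have T: "T * (S * S) = 1"
    using t by (simp flip: mult add: one)
  define a' b' where "a' = push_forward g a" "b' = push_forward g b"
  \<comment> \<open>Twice the trace of a product is the product of the traces plus the product of
    the differences. The factor T * (S * S) = 1 provides each difference with the factor s that
    makes it rational.\<close>
  have 1: "a * b + a' * b' = H * ((a + a') * (b + b') + T * ((S * (a - a')) * (S * (b - b'))))"
  proof -
    have "T * ((S * (a - a')) * (S * (b - b'))) = (T * (S * S)) * ((a - a') * (b - b'))"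
      by (simp only: ac_simps)
    then have "H * ((a + a') * (b + b') + T * ((S * (a - a')) * (S * (b - b')))) =
        H * ((a + a') * (b + b') + (a - a') * (b - b'))"
      by (simp add: T)
    also have "\<dots> = (H * 2) * (a * b + a' * b')"
      by (simp add: algebra_simps)
    finally show ?thesis by (simp add: H)
  qed
  have 2: "S * (a * b - a' * b') = H * ((a + a') * (S * (b - b')) + (S * (a - a')) * (b + b'))"
  proof -
    have "H * ((a + a') * (S * (b - b')) + (S * (a - a')) * (b + b')) = (H * 2) * (S * (a * b - a' * b'))"
      by (simp add: algebra_simps)
    then show ?thesis by (simp add: H)
  qed
  have "a + a' \<in> range (map_coeffs to)" "S * (a - a') \<in> range (map_coeffs to)"
    "b + b' \<in> range (map_coeffs to)" "S * (b - b') \<in> range (map_coeffs to)"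
    using ab by (simp_all add: twisted_form_def a'_b'_def S_H_T_def)
  moreover have "H \<in> range (map_coeffs to)" "T \<in> range (map_coeffs to)"
    by (simp_all only: S_H_T_def range_map_single)
  ultimately have "a * b + a' * b' \<in> range (map_coeffs to)"
      "S * (a * b - a' * b') \<in> range (map_coeffs to)"
    unfolding 1 2 by (simp_all only: range_map_add range_map_mult)
  then show ?thesis
    by (simp add: twisted_form_def g_mult a'_b'_def S_H_T_def)
qed

text \<open>A relation among the r b holds also for their images under g, hence for the traces and
  for s times the differences. These have coefficients in k, where independence applies
  coefficientwise; so trace and difference vanish and 2 r b = 0.\<close>

lemma descends_R: "descends to R"
proof -
  have main: "r b = 0" if S: "finite S" "lin_indep to S" "\<And>b. b \<in> S \<Longrightarrow> r b \<in> R"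
    and r: "(\<Sum>b\<in>S. single 0 b * r b) = 0" and b: "b \<in> S" for S :: "'l set" and r :: "'l \<Rightarrow> 'g \<Rightarrow>\<^sub>0 'l" and b
  proof -
  have *: "f b = 0" if f: "\<And>b. b \<in> S \<Longrightarrow> f b \<in> range (map_coeffs to)"
      "(\<Sum>b\<in>S. single 0 b * f b) = 0" for f :: "'l \<Rightarrow> 'g \<Rightarrow>\<^sub>0 'l"
  proof -
    obtain f' where f': "\<And>b. b \<in> S \<Longrightarrow> f b = map_coeffs to (f' b)"
      using bchoice[of S "\<lambda>b y. f b = map_coeffs to y"] f(1) by blast
    have "lookup (f' b) m = 0" for m
    proof -
      have "(\<Sum>b\<in>S. to (lookup (f' b) m) * b) = lookup (\<Sum>b\<in>S. single 0 b * f b) m"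
        by (simp add: lookup_sum lookup_single_zero_mult f' lookup_map zero mult.commute)
      with f(2) show ?thesis
        using S(2) b unfolding lin_indep_def by (auto dest: spec[of _ "\<lambda>b. lookup (f' b) m"])
    qed
    then have "f' b = 0" by (simp add: poly_mapping_eqI)
    then show ?thesis
      using b by (simp add: f' m_zero)
  qed
  have "(\<Sum>b\<in>S. single 0 b * push_forward g (r b)) = 0"
    using arg_cong[OF r, of "push_forward g"] by (simp add: g_sum g_mult g_zero push_forward_single g)
  with r have "(\<Sum>b\<in>S. single 0 b * (r b + push_forward g (r b))) = 0"
      "(\<Sum>b\<in>S. single 0 b * (single 0 s * (r b - push_forward g (r b)))) = 0"
    by (simp_all add: distrib_left right_diff_distrib sum.distrib sum_subtractf mult.left_commute[of _ "single 0 s"]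
        flip: sum_distrib_left)
  then have "r b + push_forward g (r b) = 0" "single 0 s * (r b - push_forward g (r b)) = 0"
    using *[of "\<lambda>b. r b + push_forward g (r b)"] *[of "\<lambda>b. single 0 s * (r b - push_forward g (r b))"] S(3)
    by (simp_all only: twisted_form_def mem_Collect_eq)
  then have eq: "lookup (r b + push_forward g (r b)) m = 0"
      "lookup (single 0 s * (r b - push_forward g (r b))) m = 0" for m
    by simp_all
  have "2 * lookup (r b) m = 0" for m
    using eq[of m] s(2) unfolding lookup_single_zero_mult lookup_add lookup_minus by simp
  with two show "r b = 0"
    by (simp add: poly_mapping_eqI)
  qed
  show ?thesis
    unfolding descends_def by (intro allI impI ballI) (use main in blast)
qed

end

section \<open>Lifting linear similitudes to algebra automorphisms\<close>

lemma mult_vec_scale: "A *v (c *s x) = c *s (A *v x)" for c :: "'b::comm_ring_1"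
  by (simp add: vec_eq_iff matrix_vector_mult_def sum_distrib_left ac_simps)

lemma mult_vec_sum: "A *v (\<Sum>i\<in>S. f i) = (\<Sum>i\<in>S. A *v f i)"
  for A :: "'b::comm_ring_1^'n^'m"
  by (induction S rule: infinite_finite_induct) (simp_all add: matrix_vector_mult_0_right matrix_vector_right_distrib)

lemma mult_vec_axis: "(A *v axis j 1) $ k = A $ k $ j" for A :: "'b::comm_ring_1^'n^'m"
  by (simp add: matrix_vector_mult_def axis_def if_distrib cong: if_cong)

lemma matrix_eq_axisI:
  fixes A B :: "'b::comm_ring_1^'n^'m"
  assumes "\<And>j. A *v axis j 1 = B *v axis j 1"
  shows "A = B"
  using assms by (metis mult_vec_axis vec_eq_iff)

lemma vec_axis_sum: "u = (\<Sum>j\<in>UNIV. u $ j *s axis j 1)" for u :: "'b::comm_ring_1^'m"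
  by (simp add: vec_eq_iff axis_def if_distrib cong: if_cong)

lemma mult_const_single: "mp_const c * single m d = single m (c * d)"
  by (simp add: mp_const_def mult_single)

lemma power_in_order_ge: "f \<in> order_ge d \<Longrightarrow> f ^ n \<in> order_ge (n * d)"
  by (induction n) (auto intro: mult_in_order_ge)

lemma prod_in_order_ge: "(\<And>i. i \<in> S \<Longrightarrow> f i \<in> order_ge (d i)) \<Longrightarrow> prod f S \<in> order_ge (sum d S)"
  by (induction S rule: infinite_finite_induct) (auto intro: mult_in_order_ge)

lemma (in rhom) map_in_order_ge: "f \<in> order_ge d \<Longrightarrow> map_coeffs h f \<in> order_ge d"
  by (rule order_geI) (metis lookup_map zero order_geD linorder_not_le)

subsection \<open>Linear substitutions\<close>

definition linear_form :: "('n \<Rightarrow> 'b) \<Rightarrow> ('n::finite, 'b::comm_ring_1) mpoly"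
  where "linear_form c = (\<Sum>j\<in>UNIV. mp_const (c j) * mp_var j)"

text \<open>Column i of g is the image of variable i, so substitutions compose in the order of the
  matrix product.\<close>

definition lin_subst :: "'b^'n^'n \<Rightarrow> ('n::finite, 'b::comm_ring_1) mpoly \<Rightarrow> ('n, 'b) mpoly"
  where "lin_subst g = mp_eval mp_const (\<lambda>i. linear_form (\<lambda>j. g $ j $ i))"

lemma rhom_lin_subst: "rhom (lin_subst g)"
  unfolding lin_subst_def by (rule rhom_mp_eval[OF rhom_mp_const])

lemma lin_subst_const: "lin_subst g (mp_const c) = mp_const c"
  by (simp add: lin_subst_def rhom.eval_const[OF rhom_mp_const])

lemma lin_subst_var: "lin_subst g (mp_var i) = linear_form (\<lambda>j. g $ j $ i)"
  by (simp add: lin_subst_def rhom.eval_var[OF rhom_mp_const])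

lemma lin_subst_linear_form:
  "lin_subst g (linear_form c) = linear_form (\<lambda>k. \<Sum>j\<in>UNIV. g $ k $ j * c j)"
proof -
  interpret c: rhom mp_const by (rule rhom_mp_const)
  have "lin_subst g (linear_form c) = (\<Sum>j\<in>UNIV. \<Sum>k\<in>UNIV. mp_const (g $ k $ j * c j) * mp_var k)"
    by (simp add: linear_form_def[of c] rhom.sum[OF rhom_lin_subst] rhom.mult[OF rhom_lin_subst]
        lin_subst_const lin_subst_var) (simp add: linear_form_def sum_distrib_left c.mult ac_simps)
  also have "\<dots> = (\<Sum>k\<in>UNIV. \<Sum>j\<in>UNIV. mp_const (g $ k $ j * c j) * mp_var k)"
    by (rule sum.swap)
  finally show ?thesis
    by (simp add: linear_form_def c.sum sum_distrib_right)
qed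

lemma lin_subst_comp: "lin_subst g (lin_subst g' F) = lin_subst (g ** g') F"
proof (rule rhom_mpoly_eqI[of "\<lambda>F. lin_subst g (lin_subst g' F)"])
  show "rhom (\<lambda>F. lin_subst g (lin_subst g' F))"
    by (rule rhom_comp[OF rhom_lin_subst rhom_lin_subst])
qed (simp_all add: rhom_lin_subst lin_subst_const lin_subst_var lin_subst_linear_form matrix_matrix_mult_def)

lemma lin_subst_one: "lin_subst (mat 1) F = F"
proof (rule rhom_mpoly_eqI[of "lin_subst (mat 1)" "\<lambda>F. F"])
  have "linear_form (\<lambda>j. mat 1 $ j $ i) = (mp_var i :: ('a, 'b) mpoly)" for i
  proof -
    have "mp_const (mat 1 $ j $ i) * mp_var j = (if j = i then mp_var i else 0 :: ('a, 'b) mpoly)" for j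
      by (simp add: mat_def mp_const_def)
    then show ?thesis by (simp add: linear_form_def)
  qed
  then show "lin_subst (mat 1) (mp_var i) = (mp_var i :: ('a, 'b) mpoly)" for i
    by (simp add: lin_subst_var)
qed (simp_all add: rhom_lin_subst rhom_id lin_subst_const)

lemma lookup_linear_form: "lookup (linear_form c) (single i (Suc 0)) = c i"
  by (simp add: linear_form_def lookup_sum mp_var_def mult_const_single lookup_single when_def
      single_exponent_eq_iff)

lemma linear_form_in_order_ge: "linear_form c \<in> order_ge 1"
  unfolding linear_form_def by (intro sum_in_order_ge mult_in_order_ge2 var_in_order_ge)

lemma lin_subst_in_order_ge:
  assumes "F \<in> order_ge d"
  shows "lin_subst g F \<in> order_ge d"
  using assms
proof (induction rule: order_ge_induct)
  case (single m c)
  have "(\<Prod>i\<in>keys m. linear_form (\<lambda>j. g $ j $ i) ^ lookup m i) \<in> order_ge (\<Sum>i\<in>keys m. lookup m i * 1)"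
    by (intro prod_in_order_ge power_in_order_ge linear_form_in_order_ge)
  then have "lin_subst g (single m c) \<in> order_ge (mdeg m)"
    by (simp add: lin_subst_def rhom.eval_single[OF rhom_mp_const] mdeg_def mult_in_order_ge2)
  with single show ?case using order_ge_mono by blast
qed (simp_all add: rhom.zero[OF rhom_lin_subst] rhom.add[OF rhom_lin_subst] add_in_order_ge)

lemma (in rhom) map_linear_form: "map_coeffs h (linear_form c) = linear_form (\<lambda>j. h (c j))"
  by (simp add: linear_form_def rhom.sum[OF rhom_map] rhom.mult[OF rhom_map] map_const map_var)

lemma (in rhom) map_lin_subst:
  "map_coeffs h (lin_subst g F) = lin_subst (map_matrix h g) (map_coeffs h F)"
proof (rule rhom_mpoly_eqI[of "\<lambda>F. map_coeffs h (lin_subst g F)"])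
  show "rhom (\<lambda>F. map_coeffs h (lin_subst g F))"
    by (rule rhom_comp[OF rhom_lin_subst rhom_map])
  show "rhom (\<lambda>F. lin_subst (map_matrix h g) (map_coeffs h F))"
    by (rule rhom_comp[OF rhom_map rhom_lin_subst])
qed (simp_all add: lin_subst_const lin_subst_var map_const map_var map_linear_form map_matrix_def)

lemma map_map_hom:
  assumes "rhom u" "rhom h"
  shows "map_coeffs u (map_coeffs h f) = map_coeffs (\<lambda>c. u (h c)) f"
  using rhom.zero[OF assms(1)] rhom.zero[OF assms(2)] by (intro poly_mapping_eqI) (simp add: lookup_map)

section \<open>Coordinates of the algebra after extension of scalars\<close>

context comm_algebra
begin

lemma rhom_smul: "rhom (\<lambda>c. smul c 1)"
  by standard (simp_all add: scale_left_distrib smul_mult[symmetric] flip: scale_scale)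

lemma smul_eq: "smul c x = smul c 1 * x"
  by (simp flip: smul_mult)

text \<open>The coordinates of x \<otimes> 1.\<close>

definition hcoord :: "('m::finite \<Rightarrow> 'a) \<Rightarrow> ('k \<Rightarrow> 'b::comm_ring_1) \<Rightarrow> 'a \<Rightarrow> 'b^'m"
  where "hcoord e h x = (\<chi> k. h (coord e x $ k))"

lemma tensor_mult_add:
  "tensor_mult e h (u + u') v = tensor_mult e h u v + tensor_mult e h u' v"
  "tensor_mult e h u (v + v') = tensor_mult e h u v + tensor_mult e h u v'"
  by (simp_all add: tensor_mult_def vec_eq_iff algebra_simps sum.distrib)

lemma tensor_mult_scale:
  "tensor_mult e h (c *s u) v = c *s tensor_mult e h u v"
  "tensor_mult e h u (c *s v) = c *s tensor_mult e h u v"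
  by (simp_all add: tensor_mult_def vec_eq_iff sum_distrib_left ac_simps)

lemma tensor_mult_0: "tensor_mult e h 0 v = 0" "tensor_mult e h v 0 = 0"
  by (simp_all add: tensor_mult_def vec_eq_iff)

lemma tensor_one_eq: "tensor_one e h = hcoord e h 1"
  by (simp add: tensor_one_def hcoord_def)

context
  fixes e :: "'m::finite \<Rightarrow> 'a"
  assumes basis: "is_basis e"
begin

lemma basis_facts: "inj e" "independent (range e)" "x \<in> span (range e)"
  using basis by (auto simp: is_basis_def)

lemma coord_add: "coord e (x + y) = coord e x + coord e y"
  by (simp add: coord_def vec_eq_iff representation_add basis_facts)

lemma coord_smul: "coord e (smul c x) = c *s coord e x"
  by (simp add: coord_def vec_eq_iff representation_scale basis_facts)

lemma coord_zero: "coord e 0 = 0"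
  using coord_smul[of 0 0] by (simp add: vec_eq_iff)

lemma coord_sum: "coord e (sum f S) = (\<Sum>i\<in>S. coord e (f i))"
  by (induction S rule: infinite_finite_induct) (simp_all add: coord_zero coord_add)

lemma coord_basis: "coord e (e j) = axis j 1"
  using basis_facts(1) by (auto simp: coord_def vec_eq_iff axis_def representation_basis basis_facts inj_eq)

lemma coord_expand: "(\<Sum>j\<in>UNIV. smul (coord e x $ j) (e j)) = x"
proof -
  have "(\<Sum>b\<in>range e. smul (representation (range e) x b) b) = x"
    by (rule sum_representation_eq) (auto simp: basis_facts)
  then show ?thesis
    by (simp add: coord_def sum.reindex basis_facts(1))
qed

lemma coord_eq_0: "coord e x = 0 \<Longrightarrow> x = 0"
  using coord_expand[of x] by simp

lemma hcoord_mult: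
  assumes "rhom h"
  shows "tensor_mult e h (hcoord e h x) (hcoord e h y) = hcoord e h (x * y)"
proof -
  interpret rhom h by fact
  have "x * y = (\<Sum>i\<in>UNIV. \<Sum>j\<in>UNIV. smul (coord e x $ i * coord e y $ j) (e i * e j))"
  proof -
    have "x * y = (\<Sum>i\<in>UNIV. smul (coord e x $ i) (e i)) * (\<Sum>j\<in>UNIV. smul (coord e y $ j) (e j))"
      by (simp only: coord_expand)
    then show ?thesis
      by (simp add: sum_product smul_mult[symmetric] mult.commute[of "e _" "smul _ _"] flip: scale_scale)
        (simp add: smul_mult[symmetric] mult.commute)
  qed
  then have "coord e (x * y) $ k = (\<Sum>i\<in>UNIV. \<Sum>j\<in>UNIV. coord e x $ i * coord e y $ j * coord e (e i * e j) $ k)" for k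
    by (simp add: coord_sum coord_smul)
  then show ?thesis
    by (simp add: vec_eq_iff tensor_mult_def hcoord_def sum mult)
qed

lemma hcoord_add: "rhom h \<Longrightarrow> hcoord e h (x + y) = hcoord e h x + hcoord e h y"
  by (simp add: hcoord_def vec_eq_iff coord_add rhom.add)

lemma hcoord_smul: "rhom h \<Longrightarrow> hcoord e h (smul c x) = h c *s hcoord e h x"
  by (simp add: hcoord_def vec_eq_iff coord_smul rhom.mult)

lemma hcoord_zero: "rhom h \<Longrightarrow> hcoord e h 0 = 0"
  by (simp add: hcoord_def vec_eq_iff coord_zero rhom.zero)

lemma hcoord_basis: "rhom h \<Longrightarrow> hcoord e h (e j) = axis j 1"
  by (simp add: hcoord_def vec_eq_iff coord_basis axis_def rhom.zero rhom.one)

end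

end

text \<open>The map \<phi> is a parameter because the construction is carried out for a second
  presentation with the same e, q and l, adapted to the torus.\<close>

locale presentation = comm_algebra smul
  for smul :: "'k::field \<Rightarrow> 'a::comm_ring_1 \<Rightarrow> 'a" +
  fixes e :: "'m::finite \<Rightarrow> 'a" and \<phi> :: "('n::finite, 'k) mpoly \<Rightarrow> 'a"
    and q :: "('n, 'k) mpoly" and l :: nat
  assumes basis: "is_basis e"
    and hom: "algebra_hom mp_scale smul \<phi>"
    and surj: "surj \<phi>"
    and ker: "{f. \<phi> f = 0} = {f + g | f g. f \<in> order_ge l \<and> g \<in> ideal_gen {q}}"
begin

lemma phi_rhom: "rhom \<phi>"
  using hom by (auto simp: algebra_hom_def rhom_def Vector_Spaces.linear_iff)

sublocale phi: rhom \<phi>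
  by (rule phi_rhom)

lemma phi_scale: "\<phi> (mp_const c * f) = smul c (\<phi> f)"
  using hom unfolding algebra_hom_def Vector_Spaces.linear_iff mp_scale_def by blast

lemma phi_const: "\<phi> (mp_const c) = smul c 1"
  using phi_scale[of c 1] by (simp add: phi.one)

lemma phi_single: "\<phi> (single m c) = smul c (\<phi> (single m 1))"
  using phi_scale[of c "single m 1"] by (simp add: mult_const_single)

lemma phi_eq_0E:
  assumes "\<phi> f = 0"
  obtains a r where "a \<in> order_ge l" "f = a + r * q"
  using assms ker unfolding ideal_gen_singleton by blast

lemma phi_eq_0I: "a \<in> order_ge l \<Longrightarrow> \<phi> (a + r * q) = 0"
  using ker unfolding ideal_gen_singleton by blast

lemma phi_order_ge: "a \<in> order_ge l \<Longrightarrow> \<phi> a = 0"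
  using phi_eq_0I[of a 0] by simp

lemma phi_q: "\<phi> q = 0"
  using phi_eq_0I[of 0 1] by simp

lemma kernel_order_ge:
  assumes "q \<in> order_ge d" "d \<le> l" "\<phi> f = 0"
  shows "f \<in> order_ge d"
proof -
  obtain a r where "a \<in> order_ge l" "f = a + r * q"
    using assms(3) by (rule phi_eq_0E)
  then show ?thesis
    using order_ge_mono[OF assms(2)] assms(1) by (auto intro: add_in_order_ge mult_in_order_ge2)
qed

lemma phi_ex: "\<exists>f. a = \<phi> f"
  using surj by (metis surjD)

text \<open>The extension of \<phi> to polynomials with coefficients in B, followed by
  coordinates.\<close>

definition base_change_coord :: "('k \<Rightarrow> 'b::comm_ring_1) \<Rightarrow> ('n, 'b) mpoly \<Rightarrow> 'b^'m"
  where "base_change_coord h F = (\<Sum>m\<in>keys F. lookup F m *s hcoord e h (\<phi> (single m 1)))"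

definition basis_lift :: "'m \<Rightarrow> ('n, 'k) mpoly"
  where "basis_lift j = (SOME f. \<phi> f = e j)"

text \<open>The endomorphism of A \<otimes> B induced by a linear substitution. The columns depend
  on the chosen preimages of the basis unless g is a similitude of q.\<close>

definition lift :: "('k \<Rightarrow> 'b::comm_ring_1) \<Rightarrow> 'b^'n^'n \<Rightarrow> 'b^'m^'m"
  where "lift h g = (\<chi> k j. base_change_coord h (lin_subst g (map_coeffs h (basis_lift j))) $ k)"

definition similitude :: "('k \<Rightarrow> 'b::comm_ring_1) \<Rightarrow> 'b^'n^'n \<Rightarrow> 'b \<Rightarrow> bool"
  where "similitude h g c \<longleftrightarrow> lin_subst g (map_coeffs h q) = mp_const c * map_coeffs h q"

lemma phi_basis_lift: "\<phi> (basis_lift j) = e j"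
  unfolding basis_lift_def by (rule someI_ex) (metis phi_ex)

context
  fixes h :: "'k \<Rightarrow> 'b::comm_ring_1"
  assumes h: "rhom h"
begin

lemmas hc_add = hcoord_add[OF basis h] and hc_smul = hcoord_smul[OF basis h] and hc_zero = hcoord_zero[OF basis h]
  and hc_mult = hcoord_mult[OF basis h] and hc_basis = hcoord_basis[OF basis h]

abbreviation "kap \<equiv> base_change_coord h"

lemma kap_superset:
  assumes "finite S" "keys F \<subseteq> S"
  shows "kap F = (\<Sum>m\<in>S. lookup F m *s hcoord e h (\<phi> (single m 1)))"
  unfolding base_change_coord_def
  by (rule sum.mono_neutral_left) (use assms in \<open>auto simp: in_keys_iff\<close>)

lemma kap_add: "kap (F + G) = kap F + kap G"
proof -
  let ?S = "keys F \<union> keys G"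
  show ?thesis
    by (subst (1 2 3) kap_superset[of ?S])
      (auto simp: lookup_add vector_sadd_rdistrib sum.distrib dest: subsetD[OF Poly_Mapping.keys_add])
qed

lemma kap_single: "kap (single m c) = c *s hcoord e h (\<phi> (single m 1))"
  by (simp add: base_change_coord_def)

lemma kap_zero: "kap 0 = 0"
  by (simp add: base_change_coord_def)

lemma kap_diff: "kap (F - G) = kap F - kap G"
  by (metis kap_add add_diff_cancel_right' diff_add_cancel)

lemma kap_sum: "kap (sum F S) = (\<Sum>i\<in>S. kap (F i))"
  by (induction S rule: infinite_finite_induct) (simp_all add: kap_zero kap_add)

lemma kap_scale: "kap (mp_const c * F) = c *s kap F"
  by (induction F rule: poly_mapping_induct)
    (simp_all add: kap_zero mult_const_single kap_single distrib_left kap_add vector_smult_assoc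
      vector_add_ldistrib)

lemma kap_mult: "kap (F * G) = tensor_mult e h (kap F) (kap G)"
proof (induction F rule: poly_mapping_induct)
  case (single m c)
  show ?case
  proof (induction G rule: poly_mapping_induct)
    case (single n d)
    have "\<phi> (single m 1) * \<phi> (single n 1) = \<phi> (single (m + n) 1)"
      by (simp add: mult_single flip: phi.mult)
    then show ?case
      by (simp add: mult_single kap_single tensor_mult_scale hc_mult vector_smult_assoc mult.commute)
  qed (simp_all add: kap_zero tensor_mult_0 distrib_left kap_add tensor_mult_add)
qed (simp_all add: kap_zero tensor_mult_0 distrib_right kap_add tensor_mult_add)

lemma kap_map: "kap (map_coeffs h f) = hcoord e h (\<phi> f)"
proof (induction f rule: poly_mapping_induct)
  case (single m c)
  show ?case
    by (simp add: rhom.zero[OF h] kap_single phi_single[of m c] hc_smul)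
qed (simp_all add: kap_zero phi.zero hc_zero kap_add phi.add hc_add rhom.zero[OF rhom.rhom_map[OF h]]
    rhom.add[OF rhom.rhom_map[OF h]])

lemma kap_order_ge: "F \<in> order_ge l \<Longrightarrow> kap F = 0"
  by (induction rule: order_ge_induct)
    (simp_all add: kap_zero kap_add kap_single phi_order_ge single_in_order_ge hc_zero)

lemma kap_1: "kap 1 = tensor_one e h"
  using kap_map[of 1] by (simp add: rhom.one[OF rhom.rhom_map[OF h]] phi.one tensor_one_eq)

lemma kap_surj: "\<exists>U. kap U = u"
proof
  show "kap (\<Sum>j\<in>UNIV. mp_const (u $ j) * map_coeffs h (basis_lift j)) = u"
    by (simp add: kap_sum kap_scale kap_map phi_basis_lift hc_basis flip: vec_axis_sum)
qed

text \<open>Linear substitutions preserve the order, and a similitude sends q to a multiple of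
  itself; so both parts of the kernel are preserved.\<close>

lemma kap_lin_subst_kernel:
  assumes g: "similitude h g c" and f: "\<phi> f = 0"
  shows "kap (lin_subst g (map_coeffs h f)) = 0"
proof -
  obtain a r where a: "a \<in> order_ge l" and f': "f = a + r * q"
    using f by (rule phi_eq_0E)
  have "kap (lin_subst g (map_coeffs h a)) = 0"
    by (intro kap_order_ge lin_subst_in_order_ge rhom.map_in_order_ge[OF h] a)
  then show ?thesis
    using g unfolding f' similitude_def
    by (simp add: rhom.add[OF rhom.rhom_map[OF h]] rhom.mult[OF rhom.rhom_map[OF h]]
        rhom.add[OF rhom_lin_subst] rhom.mult[OF rhom_lin_subst] kap_add kap_mult kap_scale kap_map
        phi_q hc_zero tensor_mult_0)
qed

lemma lift_basis: "lift h g *v axis j 1 = kap (lin_subst g (map_coeffs h (basis_lift j)))"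
  by (simp add: vec_eq_iff mult_vec_axis) (simp add: lift_def)

text \<open>The polynomial f and the combination of the chosen preimages with the coordinates of
  \<phi> f differ by an element of the kernel, which the substitution keeps there.\<close>

lemma lift_hcoord:
  assumes g: "similitude h g c"
  shows "lift h g *v hcoord e h (\<phi> f) = kap (lin_subst g (map_coeffs h f))"
proof -
  let ?u = "coord e (\<phi> f)"
  define f' where "f' = (\<Sum>j\<in>UNIV. mp_const (?u $ j) * basis_lift j)"
  have "\<phi> f' = \<phi> f"
    by (simp add: f'_def phi.sum phi_scale phi_basis_lift coord_expand[OF basis])
  then have "kap (lin_subst g (map_coeffs h (f - f'))) = 0"
    by (intro kap_lin_subst_kernel[OF g]) (simp add: phi.diff)
  then have 1: "kap (lin_subst g (map_coeffs h f)) = kap (lin_subst g (map_coeffs h f'))"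
    by (simp add: rhom.diff[OF rhom.rhom_map[OF h]] rhom.diff[OF rhom_lin_subst] kap_diff)
  have "(\<Sum>j\<in>UNIV. h (?u $ j) *s axis j 1) = hcoord e h (\<phi> f)"
    by (subst (2) vec_axis_sum) (simp add: hcoord_def)
  then show ?thesis
    unfolding 1
    by (simp flip: \<open>_ = hcoord e h (\<phi> f)\<close>)
      (simp add: f'_def rhom.sum[OF rhom.rhom_map[OF h]] rhom.mult[OF rhom.rhom_map[OF h]]
        rhom.sum[OF rhom_lin_subst] rhom.mult[OF rhom_lin_subst] rhom.map_const[OF h] lin_subst_const
        kap_sum kap_scale mult_vec_sum mult_vec_scale lift_basis)
qed

lemma lift_kap:
  assumes g: "similitude h g c"
  shows "lift h g *v kap F = kap (lin_subst g F)"
proof (induction F rule: poly_mapping_induct)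
  case (single m a)
  have "single m a = mp_const a * map_coeffs h (single m 1)"
    by (simp add: rhom.zero[OF h] rhom.one[OF h] mult_const_single)
  then show ?case
    by (simp only: kap_scale mult_vec_scale rhom.mult[OF rhom_lin_subst] lin_subst_const kap_map
        lift_hcoord[OF g])
qed (simp_all add: kap_zero rhom.zero[OF rhom_lin_subst] matrix_vector_mult_0_right kap_add
    rhom.add[OF rhom_lin_subst] matrix_vector_right_distrib)

lemma lift_mult:
  assumes "similitude h g c" "similitude h g' c'"
  shows "lift h (g ** g') = lift h g ** lift h g'"
  by (rule matrix_eq_axisI)
    (simp add: lift_basis lift_kap[OF assms(1)] lin_subst_comp flip: matrix_vector_mul_assoc)

lemma lift_one: "lift h (mat 1) = mat 1"
  by (rule matrix_eq_axisI)
    (simp add: lift_basis lin_subst_one kap_map phi_basis_lift hc_basis matrix_vector_mul_lid)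

lemma lift_tensor_aut:
  assumes g: "similitude h g c" "similitude h g' c'" and gg': "g ** g' = mat 1"
  shows "tensor_aut e h (lift h g)"
proof -
  have "det (lift h g) * det (lift h g') = 1"
    unfolding det_mul[symmetric] lift_mult[OF g, symmetric] gg' lift_one by simp
  then have "det (lift h g) dvd 1"
    by (metis dvd_triv_left)
  moreover have "lift h g *v tensor_one e h = tensor_one e h"
    by (simp add: lift_kap[OF g(1)] rhom.one[OF rhom_lin_subst] flip: kap_1)
  moreover have "lift h g *v tensor_mult e h u v = tensor_mult e h (lift h g *v u) (lift h g *v v)" for u v
  proof -
    obtain U V where "u = kap U" "v = kap V" using kap_surj by metis
    then show ?thesis
      by (simp add: lift_kap[OF g(1)] rhom.mult[OF rhom_lin_subst] flip: kap_mult)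
  qed
  ultimately show ?thesis by (simp add: tensor_aut_def)
qed

end

lemma kap_natural:
  assumes h: "rhom h" and u: "rhom u"
  shows "(\<chi> k. u (base_change_coord h F $ k)) = base_change_coord (\<lambda>c. u (h c)) (map_coeffs u F)"
proof -
  have uh: "rhom (\<lambda>c. u (h c))" by (rule rhom_comp[OF h u])
  interpret u: rhom u by (rule u)
  show ?thesis
  proof (induction F rule: poly_mapping_induct)
    case zero
    show ?case by (simp add: kap_zero[OF h] kap_zero[OF uh] vec_eq_iff u.zero rhom.zero[OF u.rhom_map])
  next
    case (single m c)
    show ?case
      by (simp add: kap_single[OF h] kap_single[OF uh] vec_eq_iff u.zero u.mult) (simp add: hcoord_def)
  next
    case (add f g)
    then show ?case
      by (simp add: kap_add[OF h] kap_add[OF uh] rhom.add[OF u.rhom_map] vec_eq_iff u.add)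
  qed
qed

lemma lift_natural:
  assumes h: "rhom h" and u: "rhom u"
  shows "map_matrix u (lift h g) = lift (\<lambda>c. u (h c)) (map_matrix u g)"
proof -
  have "u (base_change_coord h F $ k) = base_change_coord (\<lambda>c. u (h c)) (map_coeffs u F) $ k" for F k
    using arg_cong[OF kap_natural[OF assms], of "\<lambda>v. v $ k"] by simp
  then show ?thesis
    by (simp add: vec_eq_iff map_matrix_def lift_def rhom.map_lin_subst[OF u] map_map_hom[OF u h])
qed

end

section \<open>A rotation plane of an anisotropic form\<close>

definition dotp :: "'b::comm_ring_1^'n \<Rightarrow> 'b^'n \<Rightarrow> 'b"
  where "dotp a b = (\<Sum>i\<in>UNIV. a $ i * b $ i)"

definition outer :: "'b::comm_ring_1^'n \<Rightarrow> 'b^'m \<Rightarrow> 'b^'m^'n"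
  where "outer a b = (\<chi> i j. a $ i * b $ j)"

lemma dotp_commute: "dotp a b = dotp b a"
  by (simp add: dotp_def mult.commute)

lemma outer_mult_vec: "outer a b *v c = dotp b c *s a"
  by (simp add: outer_def matrix_vector_mult_def dotp_def vec_eq_iff sum_distrib_left ac_simps)

lemma mult_outer: "A ** outer a b = outer (A *v a) b"
  by (simp add: outer_def matrix_matrix_mult_def matrix_vector_mult_def vec_eq_iff sum_distrib_left ac_simps)

lemma outer_mult: "outer a b ** A = outer a (transpose A *v b)"
  by (simp add: outer_def matrix_matrix_mult_def matrix_vector_mult_def vec_eq_iff transpose_def
      sum_distrib_left ac_simps)

lemma transpose_outer: "transpose (outer a b) = outer b a"
  by (simp add: outer_def transpose_def vec_eq_iff mult.commute)

lemma outer_scale: "outer (c *s a) b = mat c ** outer a b" "outer a (c *s b) = mat c ** outer a b"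
proof -
  have "(mat c ** outer a b) $ i $ j = c * (a $ i * b $ j)" for i j
    by (simp add: outer_def matrix_matrix_mult_def mat_def if_distrib[of "\<lambda>x. x * _"] cong: if_cong)
  then show "outer (c *s a) b = mat c ** outer a b" "outer a (c *s b) = mat c ** outer a b"
    by (simp_all add: vec_eq_iff) (simp_all add: outer_def ac_simps)
qed

lemma dotp_linear:
  "dotp (a + b) c = dotp a c + dotp b c" "dotp a (b + c) = dotp a b + dotp a c"
  "dotp (a - b) c = dotp a c - dotp b c" "dotp a (b - c) = dotp a b - dotp a c"
  "dotp (x *s a) b = x * dotp a b" "dotp a (x *s b) = x * dotp a b"
  by (simp_all add: dotp_def algebra_simps sum.distrib sum_subtractf sum_distrib_left)

lemma mat_scalar_component: "(mat c ** A) $ i $ j = c * A $ i $ j"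
  by (simp add: matrix_matrix_mult_def mat_def if_distrib[of "\<lambda>x. x * _"] cong: if_cong)

lemma mat_scalar_mult: "(mat c ** A) ** (mat d ** B) = mat (c * d) ** (A ** B)" for c :: "'b::comm_ring_1"
proof -
  have "((mat c ** A) ** (mat d ** B)) $ i $ j = c * d * (A ** B) $ i $ j" for i j
    by (subst (1) matrix_matrix_mult_def)
      (simp add: mat_scalar_component, simp add: matrix_matrix_mult_def sum_distrib_left ac_simps)
  then show ?thesis by (simp add: vec_eq_iff mat_scalar_component)
qed

lemma mat_scalar_mult_vec: "(mat c ** A) *v x = c *s (A *v x)" for c :: "'b::comm_ring_1"
  by (simp add: vec_eq_iff matrix_vector_mult_def mat_scalar_component sum_distrib_left ac_simps)

lemma transpose_mat_scalar: "transpose (mat c ** A) = mat c ** transpose A"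
  by (simp add: vec_eq_iff transpose_def mat_scalar_component)

lemma transpose_add: "transpose (A + B) = transpose A + transpose B"
  by (simp add: vec_eq_iff transpose_def)

lemma transpose_diff: "transpose (A - B) = transpose A - transpose B"
  by (simp add: vec_eq_iff transpose_def)

lemma matrix_mult_diff_left: "A ** (B - C) = A ** B - A ** C" for A :: "'b::comm_ring_1^'n^'m"
  by (simp add: vec_eq_iff matrix_matrix_mult_def right_diff_distrib sum_subtractf)

lemma matrix_mult_diff_right: "(B - C) ** A = B ** A - C ** A" for A :: "'b::comm_ring_1^'n^'m"
  by (simp add: vec_eq_iff matrix_matrix_mult_def left_diff_distrib sum_subtractf)

lemma matrix_mult_zero: "A ** 0 = 0" "0 ** A = 0" for A :: "'b::comm_ring_1^'n^'m"
  by (simp_all add: vec_eq_iff matrix_matrix_mult_def)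

lemma matrix_add_mult: "A ** (B + C) = A ** B + A ** C" "(B + C) ** A = B ** A + C ** A"
  for A B C :: "'b::comm_ring_1^'n^'n"
  by (simp_all add: vec_eq_iff matrix_matrix_mult_def distrib_left distrib_right sum.distrib)

lemma mat_scalar_1: "mat 1 ** A = A" for A :: "'b::comm_ring_1^'n^'n"
  by (simp add: matrix_mul_lid)

text \<open>Gram-Schmidt on two basis vectors; anisotropy makes the norms Q1 and Q2 nonzero. The
  functionals p1, p2 are dual to v1, v2, and t = - Q2 / Q1. If x * x = t, the nonzero vector x v1 +
  v2 would be isotropic.\<close>

lemma orthogonal_plane:
  fixes Q :: "'k::field^'n^'n::finite" and i j :: 'n
  assumes sym: "transpose Q = Q"
    and aniso: "\<And>c. dotp c (Q *v c) = 0 \<Longrightarrow> c = 0"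
    and ij: "i \<noteq> j"
  obtains v1 v2 p1 p2 Q1 t where
    "dotp p1 v1 = 1" "dotp p1 v2 = 0" "dotp p2 v1 = 0" "dotp p2 v2 = 1"
    "Q *v v1 = Q1 *s p1" "Q *v v2 = (- t * Q1) *s p2" "t \<noteq> 0" "\<And>x. x * x \<noteq> t"
proof -
  have symm: "dotp a (Q *v b) = dotp b (Q *v a)" for a b
  proof -
    have "dotp a (Q *v b) = (\<Sum>x\<in>UNIV. \<Sum>y\<in>UNIV. a $ x * (Q $ x $ y * b $ y))"
      by (simp add: dotp_def matrix_vector_mult_def sum_distrib_left)
    also have "\<dots> = (\<Sum>y\<in>UNIV. \<Sum>x\<in>UNIV. a $ x * (Q $ x $ y * b $ y))"
      by (rule sum.swap)
    also have "\<dots> = (\<Sum>y\<in>UNIV. \<Sum>x\<in>UNIV. b $ y * (Q $ y $ x * a $ x))"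
      using arg_cong[OF sym, of "\<lambda>A. A $ _ $ _"] by (simp add: transpose_def ac_simps)
    finally show ?thesis
      by (simp add: dotp_def matrix_vector_mult_def sum_distrib_left)
  qed
  define v1 :: "'k^'n" where "v1 = axis i 1"
  define Q1 where "Q1 = dotp v1 (Q *v v1)"
  have "v1 \<noteq> 0" by (auto simp: v1_def axis_def vec_eq_iff)
  then have Q1: "Q1 \<noteq> 0" using aniso by (auto simp: Q1_def)
  define c where "c = dotp v1 (Q *v axis j 1) / Q1"
  define v2 where "v2 = axis j 1 - c *s v1"
  have v2j: "v2 $ j = 1" using ij by (simp add: v2_def v1_def axis_def)
  then have "v2 \<noteq> 0" by auto
  define Q2 where "Q2 = dotp v2 (Q *v v2)"
  have Q2: "Q2 \<noteq> 0" using \<open>v2 \<noteq> 0\<close> aniso by (auto simp: Q2_def)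
  have orth: "dotp v1 (Q *v v2) = 0"
    using Q1 by (simp add: v2_def matrix_vector_mult_diff_distrib mult_vec_scale dotp_linear c_def Q1_def)
  then have orth': "dotp v2 (Q *v v1) = 0" by (simp add: symm)
  define p1 where "p1 = (1 / Q1) *s (Q *v v1)"
  define p2 where "p2 = (1 / Q2) *s (Q *v v2)"
  have dots: "dotp p1 v1 = 1" "dotp p1 v2 = 0" "dotp p2 v1 = 0" "dotp p2 v2 = 1"
    using Q1 Q2 orth orth' by (simp_all add: p1_def p2_def dotp_linear dotp_commute[of "Q *v _"] flip: Q1_def Q2_def)
  define t where "t = - (Q2 / Q1)"
  have Qv: "Q *v v1 = Q1 *s p1" "Q *v v2 = (- t * Q1) *s p2"
    using Q1 Q2 by (simp_all add: p1_def p2_def t_def vector_smult_assoc)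
  have "x * x \<noteq> t" for x
  proof
    assume x: "x * x = t"
    have "dotp (x *s v1 + v2) (Q *v (x *s v1 + v2)) = x * x * Q1 + Q2"
      by (simp add: matrix_vector_right_distrib mult_vec_scale dotp_linear orth orth' flip: Q1_def Q2_def)
    also have "\<dots> = 0" using Q1 by (simp add: x t_def)
    finally have "x *s v1 + v2 = 0" by (rule aniso)
    then have "(x *s v1 + v2) $ j = 0" by simp
    then show False using ij v2j by (simp add: v1_def axis_def)
  qed
  moreover have "t \<noteq> 0" using Q1 Q2 by (simp add: t_def)
  ultimately show ?thesis
    using that dots Qv by blast
qed

locale rotation_plane = rhom "to" for "to" :: "'k::field \<Rightarrow> 'l::field" +
  fixes Q :: "'k^'n^'n::finite" and v1 v2 p1 p2 :: "'k^'n" and Q1 t :: 'k and s :: 'l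
  assumes dots: "dotp p1 v1 = 1" "dotp p1 v2 = 0" "dotp p2 v1 = 0" "dotp p2 v2 = 1"
    and Qv: "Q *v v1 = Q1 *s p1" "Q *v v2 = (- t * Q1) *s p2"
    and sym: "transpose Q = Q"
    and t: "t \<noteq> 0" and s: "s * s = to t" and two: "(2 :: 'l) \<noteq> 0"
begin

definition tov :: "'k^'n \<Rightarrow> 'l^'n" where "tov a = (\<chi> i. to (a $ i))"

text \<open>On the plane q is Q1 (p1^2 - t p2^2), which factors over k(s) into the linear forms a1
  and a2, up to Q1. The vectors b1, b2 form the dual basis of isotropic vectors. E1, E2, E0 project
  coefficient vectors of linear forms to the two lines and to the complement.\<close>

definition "a1 = tov p1 + s *s tov p2"
definition "a2 = tov p1 - s *s tov p2"
definition "b1 = (1 / 2) *s (tov v1 + (1 / s) *s tov v2)"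
definition "b2 = (1 / 2) *s (tov v1 - (1 / s) *s tov v2)"
definition "E1 = outer a1 b1"
definition "E2 = outer a2 b2"
definition "E0 = mat 1 - E1 - E2"

lemma s_nonzero: "s \<noteq> 0"
proof
  assume "s = 0"
  then have "to t = 0" using s by simp
  with t show False by (simp add: rhom_field_eq_0[OF rhom_axioms])
qed

lemma dotp_tov: "dotp (tov a) (tov b) = to (dotp a b)"
  by (simp add: dotp_def tov_def sum mult)

lemma dotp_ab: "dotp b1 a1 = 1" "dotp b1 a2 = 0" "dotp b2 a1 = 0" "dotp b2 a2 = 1"
  using two s_nonzero
  by (simp_all add: a1_def a2_def b1_def b2_def dotp_linear dotp_tov dots dotp_commute[of v1] dotp_commute[of v2]
      zero one)

lemma Qb: "map_matrix to Q *v b1 = (to Q1 / 2) *s a2" "map_matrix to Q *v b2 = (to Q1 / 2) *s a1"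
proof -
  have v: "map_matrix to Q *v tov v = tov (Q *v v)" for v
    by (simp add: vec_eq_iff map_matrix_def matrix_vector_mult_def tov_def sum mult)
  have sc: "tov (c *s v) = to c *s tov v" for c v
    by (simp add: vec_eq_iff tov_def mult)
  have "to (- t * Q1) = - (s * s * to Q1)"
    by (simp add: s mult uminus)
  then have Qv': "map_matrix to Q *v tov v1 = to Q1 *s tov p1"
      "map_matrix to Q *v tov v2 = - (s * s * to Q1) *s tov p2"
    by (simp_all only: v Qv sc)
  show "map_matrix to Q *v b1 = (to Q1 / 2) *s a2" "map_matrix to Q *v b2 = (to Q1 / 2) *s a1"
    using s_nonzero
    by (simp_all add: b1_def b2_def a1_def a2_def mult_vec_scale matrix_vector_right_distrib
        matrix_vector_mult_diff_distrib Qv')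
qed

lemma E_mult: "E1 ** E1 = E1" "E1 ** E2 = 0" "E2 ** E1 = 0" "E2 ** E2 = E2"
    "E1 ** E0 = 0" "E2 ** E0 = 0" "E0 ** E1 = 0" "E0 ** E2 = 0" "E0 ** E0 = E0"
proof -
  have outer0: "outer (0 :: 'l^'n) b = (0 :: 'l^'n^'n)" for b :: "'l^'n"
    by (simp add: outer_def vec_eq_iff)
  show 1: "E1 ** E1 = E1" "E1 ** E2 = 0" "E2 ** E1 = 0" "E2 ** E2 = E2"
    by (simp_all add: E1_def E2_def mult_outer outer_mult_vec dotp_ab outer0)
  then show "E1 ** E0 = 0" "E2 ** E0 = 0" "E0 ** E1 = 0" "E0 ** E2 = 0" "E0 ** E0 = E0"
    by (simp_all add: E0_def matrix_mult_diff_left matrix_mult_diff_right matrix_mul_lid matrix_mul_rid)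
qed

lemma E_sum: "E1 + E2 + E0 = mat 1"
  by (simp add: E0_def)

lemma E_vec: "E1 *v a1 = a1" "E2 *v a1 = 0" "E0 *v a1 = 0" "E1 *v a2 = 0" "E2 *v a2 = a2" "E0 *v a2 = 0"
  by (simp_all add: E0_def E1_def E2_def outer_mult_vec dotp_ab matrix_vector_mult_diff_rdistrib)

text \<open>By \<open>Qb\<close>, Q pairs each of the two lines only with the other one. A matrix
  acting by u, w, z on the three summands therefore multiplies the plane block of Q by u * w and the
  complementary block by z * z.\<close>

lemma EQE: "E1 ** map_matrix to Q ** transpose E1 = 0" "E2 ** map_matrix to Q ** transpose E2 = 0"
   "E1 ** map_matrix to Q ** transpose E0 = 0" "E0 ** map_matrix to Q ** transpose E1 = 0"
   "E2 ** map_matrix to Q ** transpose E0 = 0" "E0 ** map_matrix to Q ** transpose E2 = 0"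
   "E1 ** map_matrix to Q ** transpose E2 + E2 ** map_matrix to Q ** transpose E1 +
    E0 ** map_matrix to Q ** transpose E0 = map_matrix to Q"
proof -
  let ?Q = "map_matrix to Q"
  let ?k = "to Q1 / 2"
  have symQ: "transpose ?Q = ?Q"
    using arg_cong[OF sym, of "map_matrix to"] by (simp add: transpose_def map_matrix_def vec_eq_iff)
  have EQ: "E1 ** ?Q = mat ?k ** outer a1 a2" "E2 ** ?Q = mat ?k ** outer a2 a1"
    by (simp_all add: E1_def E2_def outer_mult symQ Qb outer_scale)
  have QE: "?Q ** transpose E1 = mat ?k ** outer a2 a1" "?Q ** transpose E2 = mat ?k ** outer a1 a2"
    by (simp_all add: E1_def E2_def transpose_outer mult_outer Qb outer_scale)
  have outer0: "outer a (0 :: 'l^'n) = (0 :: 'l^'n^'n)" for a :: "'l^'n"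
    by (simp add: outer_def vec_eq_iff)
  have outer0': "outer (0 :: 'l^'n) a = (0 :: 'l^'n^'n)" for a :: "'l^'n"
    by (simp add: outer_def vec_eq_iff)
  have k0: "mat ?k ** (0 :: 'l^'n^'n) = 0" by (simp add: matrix_mult_zero)
  have oE: "outer a a1 ** transpose E1 = outer a a1" "outer a a2 ** transpose E1 = 0"
      "outer a a1 ** transpose E2 = 0" "outer a a2 ** transpose E2 = outer a a2"
      "outer a a1 ** transpose E0 = 0" "outer a a2 ** transpose E0 = 0" for a :: "'l^'n"
    by (simp_all add: outer_mult E_vec outer0)
  have Eo: "E0 ** outer a1 a = 0" "E0 ** outer a2 a = 0" for a :: "'l^'n"
    by (simp_all add: mult_outer E_vec outer0')
  have tE0: "transpose E0 = mat 1 - transpose E1 - transpose E2"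
    by (simp add: E0_def transpose_diff transpose_mat)
  show z: "E1 ** ?Q ** transpose E1 = 0" "E2 ** ?Q ** transpose E2 = 0"
     "E1 ** ?Q ** transpose E0 = 0" "E2 ** ?Q ** transpose E0 = 0"
    by (simp_all add: EQ matrix_mul_assoc[symmetric] oE k0)
  show z': "E0 ** ?Q ** transpose E1 = 0" "E0 ** ?Q ** transpose E2 = 0"
  proof -
    have "E0 ** (mat ?k ** outer a b) = mat ?k ** (E0 ** outer a b)" for a b :: "'l^'n"
      using mat_scalar_mult[of 1 E0 ?k "outer a b"] by (simp add: mat_scalar_1)
    then show "E0 ** ?Q ** transpose E1 = 0" "E0 ** ?Q ** transpose E2 = 0"
      by (simp_all add: QE matrix_mul_assoc[symmetric] Eo k0)
  qed
  have "?Q = (E1 + E2 + E0) ** ?Q ** transpose (E1 + E2 + E0)"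
    by (simp add: E_sum transpose_mat matrix_mul_lid matrix_mul_rid)
  also have "\<dots> = E1 ** ?Q ** transpose E2 + E2 ** ?Q ** transpose E1 + E0 ** ?Q ** transpose E0"
    by (simp add: transpose_add matrix_add_mult z z')
  finally show "E1 ** ?Q ** transpose E2 + E2 ** ?Q ** transpose E1 + E0 ** ?Q ** transpose E0 = ?Q" ..
qed

text \<open>Rational and irrational parts of the conjugate projections E1 and E2. The division by t
  in \<open>Yc\<close> comes from 1 / s = s / t.\<close>

definition Xc :: "'k^'n^'n" where "Xc = (\<chi> i j. (p1 $ i * v1 $ j + p2 $ i * v2 $ j) / 2)"
definition Yc :: "'k^'n^'n" where "Yc = (\<chi> i j. (p2 $ i * v1 $ j + p1 $ i * v2 $ j / t) / 2)"

lemma to_divide: "to (x / y) = to x / to y"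
proof (cases "y = 0")
  case False
  have "to (x / y) * to y = to (x / y * y)" by (simp only: mult)
  also have "\<dots> = to x" using False by simp
  finally have "to (x / y) * to y = to x" .
  moreover have "to y * to (1 / y) = to (y * (1 / y))" by (simp only: mult)
  then have "to y * to (1 / y) = 1" using False by (simp add: one)
  then have "to y \<noteq> 0" by auto
  ultimately show ?thesis by (simp add: field_simps)
qed (simp add: zero)

lemma E_XY: "E1 $ i $ j = to (Xc $ i $ j) + s * to (Yc $ i $ j)" "E2 $ i $ j = to (Xc $ i $ j) - s * to (Yc $ i $ j)"
proof -
  have t': "to t = s * s" by (simp add: s)
  have "(2 :: 'l) * 2 \<noteq> 0" using two by (metis mult_eq_0_iff)
  then have four: "(4 :: 'l) \<noteq> 0" by simp
  show "E1 $ i $ j = to (Xc $ i $ j) + s * to (Yc $ i $ j)" "E2 $ i $ j = to (Xc $ i $ j) - s * to (Yc $ i $ j)"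
    using s_nonzero two four
    by (simp_all add: E1_def E2_def outer_def a1_def a2_def b1_def b2_def tov_def Xc_def Yc_def to_divide
        add mult of_numeral t') (simp_all add: field_simps)
qed

end

section \<open>Subalgebras that contain all matrix entries\<close>

locale subalg = rhom h for h :: "'k::comm_ring_1 \<Rightarrow> 'b::comm_ring_1" +
  fixes S :: "'b set"
  assumes const_in: "h c \<in> S"
    and add_in: "a \<in> S \<Longrightarrow> b \<in> S \<Longrightarrow> a + b \<in> S"
    and mult_in: "a \<in> S \<Longrightarrow> b \<in> S \<Longrightarrow> a * b \<in> S"
begin

lemma zero_in: "0 \<in> S" using const_in[of 0] by (simp add: zero)
lemma one_in: "1 \<in> S" using const_in[of 1] by (simp add: one)

lemma sum_in: "(\<And>i. i \<in> A \<Longrightarrow> f i \<in> S) \<Longrightarrow> sum f A \<in> S"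
  by (induction A rule: infinite_finite_induct) (auto intro: add_in zero_in)

lemma prod_in: "(\<And>i. i \<in> A \<Longrightarrow> f i \<in> S) \<Longrightarrow> prod f A \<in> S"
  by (induction A rule: infinite_finite_induct) (auto intro: mult_in one_in)

lemma power_in: "a \<in> S \<Longrightarrow> a ^ n \<in> S"
  by (induction n) (auto intro: mult_in one_in)

lemma eval_in: "(\<And>v. x v \<in> S) \<Longrightarrow> mp_eval h x f \<in> S"
  unfolding mp_eval_def
  by (rule sum_in, rule mult_in, rule const_in, rule prod_in, rule power_in, assumption)

lemma det_in: "(\<And>i j. M $ i $ j \<in> S) \<Longrightarrow> det M \<in> S"
proof -
  assume M: "\<And>i j. M $ i $ j \<in> S"
  have int: "of_int z \<in> S" for z
    using const_in[of "of_int z"] by (simp add: of_int)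
  show "det M \<in> S"
    unfolding det_def by (rule sum_in, rule mult_in, rule int, rule prod_in, rule M)
qed

lemma coeffs_single_in: "c \<in> S \<Longrightarrow> lookup (single m c) k \<in> S"
  by (simp add: lookup_single when_def zero_in)

lemma coeffs_subalgebra: "subalg (\<lambda>c. mp_const (h c)) {F :: ('x, 'b) mpoly. \<forall>m. lookup F m \<in> S}"
proof
  fix F G :: "('x, 'b) mpoly"
  assume F: "F \<in> {F. \<forall>m. lookup F m \<in> S}" and G: "G \<in> {F. \<forall>m. lookup F m \<in> S}"
  show "F + G \<in> {F. \<forall>m. lookup F m \<in> S}"
    using F G by (simp add: lookup_add add_in)
  have FG: "F * G = (\<Sum>m\<in>keys F. \<Sum>n\<in>keys G. single (m + n) (lookup F m * lookup G n))"
    by (subst (1) poly_mapping_sum_singles[of F], subst (1) poly_mapping_sum_singles[of G])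
      (simp add: sum_product mult_single)
  have "lookup (F * G) k \<in> S" for k
    unfolding FG lookup_sum by (intro sum_in coeffs_single_in mult_in) (use F G in auto)
  then show "F * G \<in> {F. \<forall>m. lookup F m \<in> S}" by simp
qed (auto simp: mp_const_def add mult one single_add mult_single coeffs_single_in const_in)

lemma lin_subst_in:
  assumes g: "\<And>i j. g $ i $ j \<in> S"
  shows "lookup (lin_subst g (map_coeffs h f)) m \<in> S"
proof -
  interpret coeffs: subalg "\<lambda>c. mp_const (h c)" "{F :: ('a, 'b) mpoly. \<forall>m. lookup F m \<in> S}"
    by (rule coeffs_subalgebra)
  have "linear_form (\<lambda>j. g $ j $ i) \<in> {F. \<forall>m. lookup F m \<in> S}" for i
    unfolding linear_form_def
  proof (rule coeffs.sum_in, rule coeffs.mult_in)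
    show "mp_const (g $ j $ i) \<in> {F. \<forall>m. lookup F m \<in> S}" for j
      by (simp add: mp_const_def coeffs_single_in g)
    show "mp_var j \<in> {F. \<forall>m. lookup F m \<in> S}" for j :: 'a
      by (simp add: mp_var_def coeffs_single_in one_in)
  qed
  then have "mp_eval (\<lambda>c. mp_const (h c)) (\<lambda>i. linear_form (\<lambda>j. g $ j $ i)) f \<in> {F. \<forall>m. lookup F m \<in> S}"
    by (rule coeffs.eval_in)
  then show ?thesis
    by (simp add: lin_subst_def mp_eval_map[OF rhom_mp_const])
qed

end

text \<open>The entries of the lift are polynomials over k in the entries of g. This bounds the
  coordinate ring from above, both by Laurent polynomials and by the twisted form.\<close>

lemma (in presentation) lift_in_subalg:
  assumes "subalg h S" "\<And>i j. g $ i $ j \<in> S"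
  shows "lift h g $ k $ j \<in> S"
proof -
  interpret subalg h S by fact
  show ?thesis
    unfolding lift_def base_change_coord_def
    by (simp add: hcoord_def) (intro sum_in mult_in lin_subst_in assms(2) const_in)
qed

subsection \<open>The symmetric matrix of a quadratic form\<close>

definition quad_poly :: "'k^'n^'n \<Rightarrow> ('n::finite, 'k::comm_ring_1) mpoly"
  where "quad_poly Q = (\<Sum>a\<in>UNIV. \<Sum>b\<in>UNIV. mp_const (Q $ a $ b) * (mp_var a * mp_var b))"

lemma quad_poly_add: "quad_poly (Q + Q') = quad_poly Q + quad_poly Q'"
  by (simp add: quad_poly_def rhom.add[OF rhom_mp_const] distrib_right sum.distrib)

lemma quad_poly_unit: "quad_poly (\<chi> a b. if a = i \<and> b = j then c else 0) = mp_const c * (mp_var i * mp_var j)"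
proof -
  have "(\<Sum>b\<in>UNIV. mp_const (if a = i \<and> b = j then c else 0) * (mp_var a * mp_var b)) =
      (if a = i then mp_const c * (mp_var i * mp_var j) else 0)" for a
    by (cases "a = i") (simp_all add: if_distrib[of mp_const] if_distrib[of "\<lambda>z. z * _"]
        rhom.zero[OF rhom_mp_const] cong: if_cong)
  then show ?thesis
    by (simp add: quad_poly_def)
qed

text \<open>Each monomial c X_i X_j is shared equally between positions (i, j) and (j, i). For i = j
  both halves fall on the same diagonal entry and add up to c.\<close>

lemma quadratic_form_matrix:
  fixes q :: "('n::finite, 'k::field) mpoly"
  assumes q: "quadratic_form q" and two: "(2 :: 'k) \<noteq> 0"
  obtains Q where "transpose Q = Q" "q = quad_poly Q"
proof -
  have single: "\<exists>Q. transpose Q = Q \<and> single m c = quad_poly Q" if m: "mdeg m = 2"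
    for m :: "'n \<Rightarrow>\<^sub>0 nat" and c :: 'k
  proof -
    have "Suc 1 \<le> mdeg m" using m by simp
    then obtain i m' where i: "single m c = mp_var i * single m' c" "m = single i 1 + m'"
      by (rule single_factor_var)
    have m': "mdeg m' = 1" using m unfolding i(2) mdeg_add by simp
    then have "Suc 0 \<le> mdeg m'" by simp
    then obtain j m'' where j: "single m' c = mp_var j * single m'' c" "m' = single j 1 + m''"
      by (rule single_factor_var)
    have "mdeg m'' = 0" using m' unfolding j(2) mdeg_add by simp
    then have "m'' = 0" by (simp add: mdeg_eq_0)
    then have s: "single m c = mp_const c * (mp_var i * mp_var j)"
      by (simp only: i(1) j(1) mp_const_def ac_simps)
    let ?U = "\<lambda>i j. (\<chi> a b. if a = i \<and> b = j then c / 2 else 0) :: 'k^'n^'n"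
    have "c / 2 + c / 2 = c" using two by (simp add: field_simps)
    then have "single m c = quad_poly (?U i j + ?U j i)"
      by (simp add: s quad_poly_add quad_poly_unit mult.commute[of "mp_var j"]
          flip: distrib_right rhom.add[OF rhom_mp_const])
    moreover have "transpose (?U i j) = ?U j i" for i j
      by (simp add: transpose_def vec_eq_iff conj_commute)
    then have "transpose (?U i j + ?U j i) = ?U i j + ?U j i"
      by (simp only: transpose_add add.commute)
    ultimately show ?thesis by blast
  qed
  have "\<exists>Q. transpose Q = Q \<and> (\<Sum>m\<in>S. single m (lookup q m)) = quad_poly Q" if "S \<subseteq> keys q" "finite S" for S
    using that(2,1)
  proof (induction S rule: finite_induct)
    case empty
    show ?case
      by (rule exI[of _ 0]) (simp add: quad_poly_def transpose_def vec_eq_iff rhom.zero[OF rhom_mp_const])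
  next
    case (insert m S)
    then obtain Q where "transpose Q = Q" "(\<Sum>m\<in>S. single m (lookup q m)) = quad_poly Q" by auto
    moreover obtain Q' where "transpose Q' = Q'" "single m (lookup q m) = quad_poly Q'"
      using single[of m "lookup q m"] q insert(4) by (auto simp: quadratic_form_def mdeg_def)
    ultimately show ?case using insert(1,2)
      by (intro exI[of _ "Q' + Q"]) (simp add: quad_poly_add transpose_add)
  qed
  from this[of "keys q"] show ?thesis
    using that by (auto simp flip: poly_mapping_sum_singles)
qed

lemma eval_quad_poly: "mp_eval id c (quad_poly Q) = dotp (\<chi> i. c i) (Q *v (\<chi> i. c i))"
proof -
  interpret i: rhom "id :: 'a \<Rightarrow> 'a" by (rule rhom_id(2))
  interpret e: rhom "mp_eval id c" by (rule rhom_mp_eval[OF rhom_id(2)])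
  show ?thesis
    by (simp add: quad_poly_def e.sum e.mult i.eval_const i.eval_var dotp_def matrix_vector_mult_def
        sum_distrib_left ac_simps)
qed

lemma lin_subst_quad_poly: "lin_subst g (quad_poly Q) = quad_poly (g ** Q ** transpose g)"
proof -
  interpret s: rhom "lin_subst g" by (rule rhom_lin_subst)
  interpret c: rhom mp_const by (rule rhom_mp_const)
  have "lin_subst g (quad_poly Q) = (\<Sum>a\<in>UNIV. \<Sum>b\<in>UNIV. \<Sum>i\<in>UNIV. \<Sum>j\<in>UNIV.
      mp_const (g $ i $ a * Q $ a $ b * g $ j $ b) * (mp_var i * mp_var j))"
  proof -
    have "mp_const (Q $ a $ b) * (linear_form (\<lambda>j. g $ j $ a) * linear_form (\<lambda>j. g $ j $ b)) =
        (\<Sum>i\<in>UNIV. \<Sum>j\<in>UNIV. mp_const (g $ i $ a * Q $ a $ b * g $ j $ b) * (mp_var i * mp_var j))" for a b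
      unfolding linear_form_def sum_product unfolding sum_distrib_left
      by (intro sum.cong refl) (simp add: c.mult ac_simps)
    then show ?thesis
      by (simp add: quad_poly_def s.sum s.mult lin_subst_const lin_subst_var)
  qed
  also have "\<dots> = (\<Sum>a\<in>UNIV. \<Sum>i\<in>UNIV. \<Sum>b\<in>UNIV. \<Sum>j\<in>UNIV.
      mp_const (g $ i $ a * Q $ a $ b * g $ j $ b) * (mp_var i * mp_var j))"
    by (intro sum.cong refl sum.swap)
  also have "\<dots> = (\<Sum>i\<in>UNIV. \<Sum>a\<in>UNIV. \<Sum>b\<in>UNIV. \<Sum>j\<in>UNIV.
      mp_const (g $ i $ a * Q $ a $ b * g $ j $ b) * (mp_var i * mp_var j))"
    by (rule sum.swap)
  also have "\<dots> = (\<Sum>i\<in>UNIV. \<Sum>a\<in>UNIV. \<Sum>j\<in>UNIV. \<Sum>b\<in>UNIV.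
      mp_const (g $ i $ a * Q $ a $ b * g $ j $ b) * (mp_var i * mp_var j))"
    by (intro sum.cong refl sum.swap)
  also have "\<dots> = (\<Sum>i\<in>UNIV. \<Sum>j\<in>UNIV. \<Sum>a\<in>UNIV. \<Sum>b\<in>UNIV.
      mp_const (g $ i $ a * Q $ a $ b * g $ j $ b) * (mp_var i * mp_var j))"
    by (intro sum.cong refl sum.swap)
  also have "\<dots> = (\<Sum>i\<in>UNIV. \<Sum>j\<in>UNIV. mp_const (\<Sum>a\<in>UNIV. \<Sum>b\<in>UNIV.
      g $ i $ a * Q $ a $ b * g $ j $ b) * (mp_var i * mp_var j))"
    by (simp add: c.sum sum_distrib_right)
  also have "\<dots> = quad_poly (g ** Q ** transpose g)"
  proof -
    have "(\<Sum>a\<in>UNIV. \<Sum>b\<in>UNIV. g $ i $ a * Q $ a $ b * g $ j $ b) = (g ** Q ** transpose g) $ i $ j" for i j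
    proof -
      have "(\<Sum>a\<in>UNIV. \<Sum>b\<in>UNIV. g $ i $ a * Q $ a $ b * g $ j $ b) =
          (\<Sum>b\<in>UNIV. \<Sum>a\<in>UNIV. g $ i $ a * Q $ a $ b * g $ j $ b)"
        by (rule sum.swap)
      also have "\<dots> = (g ** Q ** transpose g) $ i $ j"
        by (simp add: matrix_matrix_mult_def transpose_def sum_distrib_right)
      finally show ?thesis .
    qed
    then show ?thesis by (simp add: quad_poly_def)
  qed
  finally show ?thesis .
qed

lemma (in rhom) map_quad_poly: "map_coeffs h (quad_poly Q) = quad_poly (map_matrix h Q)"
  by (simp add: quad_poly_def rhom.sum[OF rhom_map] rhom.mult[OF rhom_map] map_const map_var)

lemma quad_poly_scale: "quad_poly (mat c ** Q) = mp_const c * quad_poly Q"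
  by (simp add: quad_poly_def mat_scalar_component rhom.mult[OF rhom_mp_const] sum_distrib_left ac_simps)

lemma (in presentation) similitudeI:
  assumes "rhom h" "q = quad_poly Q" "g ** map_matrix h Q ** transpose g = mat c ** map_matrix h Q"
  shows "similitude h g c"
  unfolding similitude_def
  by (simp add: assms rhom.map_quad_poly lin_subst_quad_poly quad_poly_scale)

section \<open>Similitudes that are diagonal on the two isotropic lines and scalar on the
  complement\<close>

context rotation_plane
begin

definition rotation :: "('l \<Rightarrow> 'b::comm_ring_1) \<Rightarrow> 'b \<Rightarrow> 'b \<Rightarrow> 'b \<Rightarrow> 'b^'n^'n"
  where "rotation h u w z = mat u ** map_matrix h E1 + mat w ** map_matrix h E2 + mat z ** map_matrix h E0"

context
  fixes h :: "'l \<Rightarrow> 'b::comm_ring_1"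
  assumes h: "rhom h"
begin

interpretation h: rhom h by (rule h)

lemma map_E_mult: "map_matrix h A ** map_matrix h B = map_matrix h (A ** B)"
  by (simp add: h.matrix_mult)

lemma map_zero: "map_matrix h 0 = 0"
  by (simp add: map_matrix_def vec_eq_iff h.zero)

lemma map_plus: "map_matrix h (A + B) = map_matrix h A + map_matrix h B"
  by (simp add: map_matrix_def vec_eq_iff h.add)

lemma map_transpose: "transpose (map_matrix h A) = map_matrix h (transpose A)"
  by (simp add: map_matrix_def vec_eq_iff transpose_def)

lemma rotation_mult: "rotation h u w z ** rotation h u' w' z' = rotation h (u * u') (w * w') (z * z')"
  by (simp add: rotation_def matrix_add_mult mat_scalar_mult map_E_mult E_mult map_zero matrix_mult_zero)

lemma rotation_one: "rotation h 1 1 1 = mat 1"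
  by (simp add: rotation_def mat_scalar_1 map_plus[symmetric] E_sum h.matrix_one)

lemma rotation_scalar: "rotation h u u u = mat u"
proof -
  have "rotation h u u u = mat u ** rotation h 1 1 1"
    by (simp add: rotation_def matrix_add_mult mat_scalar_1)
  then show ?thesis by (simp add: rotation_one matrix_mul_rid)
qed

text \<open>The plane block of Q is multiplied by u * w and the complement by z * z; the two factors
  must agree unless there is no complement.\<close>

lemma rotation_similitude:
  assumes "z * z = u * w \<or> E0 = 0"
  shows "rotation h u w z ** map_matrix h (map_matrix to Q) ** transpose (rotation h u w z) =
    mat (u * w) ** map_matrix h (map_matrix to Q)"
proof -
  let ?Q = "map_matrix to Q"
  have 1: "(mat x ** A) ** map_matrix h ?Q ** (mat y ** B) = mat (x * y) ** (A ** map_matrix h ?Q ** B)"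
    for x y and A B :: "'b^'n^'n"
    using mat_scalar_mult[of x A 1 "map_matrix h ?Q"] mat_scalar_mult[of x "A ** map_matrix h ?Q" y B]
    by (simp add: mat_scalar_1)
  have "rotation h u w z ** map_matrix h ?Q ** transpose (rotation h u w z) =
      mat (u * w) ** map_matrix h (E1 ** ?Q ** transpose E2) + mat (u * w) ** map_matrix h (E2 ** ?Q ** transpose E1)
      + mat (z * z) ** map_matrix h (E0 ** ?Q ** transpose E0)"
    by (simp add: rotation_def transpose_add transpose_mat_scalar map_transpose matrix_add_mult 1 map_E_mult
        EQE(1-6) map_zero matrix_mult_zero mult.commute[of w u])
  also have "mat (z * z) ** map_matrix h (E0 ** ?Q ** transpose E0) =
      mat (u * w) ** map_matrix h (E0 ** ?Q ** transpose E0)"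
    using assms by (auto simp: matrix_mult_zero map_zero)
  finally show ?thesis
    by (simp only: matrix_add_mult(1)[symmetric] map_plus[symmetric] EQE(7))
qed

lemma rotation_eigen:
  "rotation h u w z *v (\<chi> i. h (a1 $ i)) = u *s (\<chi> i. h (a1 $ i))"
  "rotation h u w z *v (\<chi> i. h (a2 $ i)) = w *s (\<chi> i. h (a2 $ i))"
  "rotation h u w z *v (\<chi> i. h ((E0 *v x) $ i)) = z *s (\<chi> i. h ((E0 *v x) $ i))"
proof -
  have v: "map_matrix h A *v (\<chi> i. h (c $ i)) = (\<chi> i. h ((A *v c) $ i))" for A c
    by (simp add: map_matrix_def matrix_vector_mult_def vec_eq_iff h.sum h.mult)
  have 0: "(\<chi> i. h 0) = (0 :: 'b^'n)" "c *s (0 :: 'b^'n) = 0" for c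
    by (simp_all add: vec_eq_iff h.zero)
  have "A *v (E0 *v x) = (A ** E0) *v x" for A :: "'l^'n^'n"
    by (simp add: matrix_vector_mul_assoc)
  then show "rotation h u w z *v (\<chi> i. h ((E0 *v x) $ i)) = z *s (\<chi> i. h ((E0 *v x) $ i))"
    by (simp add: rotation_def matrix_vector_mult_add_rdistrib mat_scalar_mult_vec v E_mult 0)
  show "rotation h u w z *v (\<chi> i. h (a1 $ i)) = u *s (\<chi> i. h (a1 $ i))"
    "rotation h u w z *v (\<chi> i. h (a2 $ i)) = w *s (\<chi> i. h (a2 $ i))"
    by (simp_all add: rotation_def matrix_vector_mult_add_rdistrib mat_scalar_mult_vec v E_vec 0)
qed

lemma rotation_natural:
  assumes "rhom f"
  shows "map_matrix f (rotation h u w z) = rotation (\<lambda>c. f (h c)) (f u) (f w) (f z)"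
  by (simp add: rotation_def vec_eq_iff map_matrix_def[of f] map_matrix_def[of "\<lambda>c. f (h c)"] mat_scalar_component
      rhom.add[OF assms] rhom.mult[OF assms])

lemma rotation_entry: "rotation h u w z $ i $ j = u * h (to (Xc $ i $ j) + s * to (Yc $ i $ j)) +
   w * h (to (Xc $ i $ j) - s * to (Yc $ i $ j)) + z * h (to ((mat 1 - Xc - Xc) $ i $ j))"
proof -
  have "E0 $ i $ j = to ((mat 1 - Xc - Xc) $ i $ j)"
    by (simp add: E0_def E_XY diff mult of_numeral) (simp add: mat_def one zero)
  then show ?thesis
    by (simp add: rotation_def mat_scalar_component) (simp add: map_matrix_def E_XY)
qed

end

end

section \<open>A torus containing the scaling action\<close>

lemma laurent_ring_subalg:
  fixes "to" :: "'k::comm_ring_1 \<Rightarrow> 'l::field"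
  assumes "rhom to"
  shows "subalg (\<lambda>c. single 0 (to c)) (laurent_ring r)"
proof -
  interpret rhom "\<lambda>c. single 0 (to c)" by (rule rhom_comp[OF assms rhom_single])
  show ?thesis
  proof
    fix a b :: "'l laurent"
    assume ab: "a \<in> laurent_ring r" "b \<in> laurent_ring r"
    show "a + b \<in> laurent_ring r"
      using ab Poly_Mapping.keys_add[of a b] unfolding laurent_ring_def by blast
    show "a * b \<in> laurent_ring r"
      unfolding laurent_ring_def
    proof (safe)
      fix m x assume "m \<in> keys (a * b)" and x: "x \<in> keys m"
      then obtain i j where "m = i + j" "i \<in> keys a" "j \<in> keys b"
        using keys_mult[of a b] by blast
      then show "x < r"
        using x ab Poly_Mapping.keys_add[of i j] unfolding laurent_ring_def by blast
    qed
  qed (simp add: laurent_ring_def)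
qed

lemma laurent_ring_single: "keys m \<subseteq> {..<r} \<Longrightarrow> single m c \<in> laurent_ring r"
  by (simp add: laurent_ring_def)

lemma map_to_ac_eq_0: "map_coeffs to_ac p = 0 \<Longrightarrow> p = 0"
  by (auto simp: map_eq_zero_iff in_keys_iff poly_mapping_eqI)

text \<open>\<alpha>, \<beta>, \<gamma> are the characters of a torus of rank 2 on a1, a2 and the
  complement, and \<iota> is the effect on characters of s \<mapsto> -s, which exchanges the two
  lines. \<open>weights\<close> is the similitude condition, and \<open>generate\<close> makes the
  representation a closed immersion; \<gamma> counts there only if the complement is
  nonzero.\<close>

locale torus_data =
  presentation smul e \<phi> q l + rotation_plane to_ac Q v1 v2 p1 p2 Q1 t s
  for smul :: "'k::field \<Rightarrow> 'a::comm_ring_1 \<Rightarrow> 'a" and e :: "'m::finite \<Rightarrow> 'a"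
    and \<phi> :: "('n::finite, 'k) mpoly \<Rightarrow> 'a" and q l
    and Q :: "'k^'n^'n" and v1 v2 p1 p2 Q1 t and s :: "'k alg_closure" +
  fixes \<alpha> \<beta> \<gamma> :: "weight" and \<iota> :: "weight \<Rightarrow> weight"
  assumes q_eq: "q = quad_poly Q"
    and l_ge: "2 \<le> l"
    and nonsquare: "x * x \<noteq> t"
    and weights: "\<gamma> + \<gamma> = \<alpha> + \<beta> \<or> E0 = 0"
    and iota: "\<iota> 0 = 0" "\<iota> (a + b) = \<iota> a + \<iota> b" "\<iota> \<alpha> = \<beta>" "\<iota> \<beta> = \<alpha>" "\<iota> \<gamma> = \<gamma>"
    and support: "keys \<alpha> \<subseteq> {..<2}" "keys \<beta> \<subseteq> {..<2}" "keys \<gamma> \<subseteq> {..<2}"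
    and generate: "\<And>S m. keys m \<subseteq> {..<2} \<Longrightarrow> 0 \<in> S \<Longrightarrow> (\<And>a b. a \<in> S \<Longrightarrow> b \<in> S \<Longrightarrow> a + b \<in> S) \<Longrightarrow>
      (\<And>a. a \<in> S \<Longrightarrow> - a \<in> S) \<Longrightarrow> \<alpha> \<in> S \<Longrightarrow> \<beta> \<in> S \<Longrightarrow> (E0 \<noteq> 0 \<Longrightarrow> \<gamma> \<in> S) \<Longrightarrow> m \<in> S"
    and alpha_neq_beta: "\<alpha> \<noteq> \<beta>"
begin

abbreviation mon :: "'g \<Rightarrow> 'g \<Rightarrow>\<^sub>0 'k alg_closure" where "mon a \<equiv> single a 1"
abbreviation hl :: "'k \<Rightarrow> 'g::comm_monoid_add \<Rightarrow>\<^sub>0 'k alg_closure" where "hl \<equiv> \<lambda>c. single 0 (to_ac c)"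

lemma rhom_hl: "rhom hl"
  by (rule rhom_comp[OF rhom_to_ac rhom_single])

text \<open>The torus at the point described by a homomorphism g of characters: the identity gives
  the generic point, negation its inverse, maps to pairs the factors of the
  comultiplication.\<close>

definition action :: "(weight \<Rightarrow> 'g) \<Rightarrow> ('g::ab_group_add \<Rightarrow>\<^sub>0 'k alg_closure)^'m^'m"
  where "action g = lift hl (rotation (single 0) (mon (g \<alpha>)) (mon (g \<beta>)) (mon (g \<gamma>)))"

lemma rotation_similar:
  assumes "rhom h" "z * z = u * w \<or> E0 = 0"
  shows "similitude (\<lambda>c. h (to_ac c)) (rotation h u w z) (u * w)"
proof (rule similitudeI[OF rhom_comp[OF rhom_to_ac assms(1)] q_eq])
  have "map_matrix (\<lambda>c. h (to_ac c)) Q = map_matrix h (map_matrix to_ac Q)"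
    by (simp add: map_matrix_def)
  then show "rotation h u w z ** map_matrix (\<lambda>c. h (to_ac c)) Q ** transpose (rotation h u w z) =
      mat (u * w) ** map_matrix (\<lambda>c. h (to_ac c)) Q"
    using rotation_similitude[OF assms] by simp
qed

lemma rotation_action_similar:
  fixes g :: "weight \<Rightarrow> 'g::ab_group_add"
  assumes "\<And>a b. g (a + b) = g a + g b"
  shows "similitude hl (rotation (single 0) (mon (g \<alpha>)) (mon (g \<beta>)) (mon (g \<gamma>))) (mon (g \<alpha>) * mon (g \<beta>))"
  using weights assms[of \<gamma> \<gamma>] assms[of \<alpha> \<beta>]
  by (intro rotation_similar[OF rhom_single]) (auto simp: mult_single)

lemma action_mult:
  fixes g g' :: "weight \<Rightarrow> 'g::ab_group_add"
  assumes "\<And>a b. g (a + b) = g a + g b" "\<And>a b. g' (a + b) = g' a + g' b"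
  shows "action g ** action g' = action (\<lambda>m. g m + g' m)"
  unfolding action_def
    lift_mult[OF rhom_hl rotation_action_similar[of g, OF assms(1)] rotation_action_similar[of g', OF assms(2)], symmetric]
  by (simp add: rotation_mult[OF rhom_single] mult_single)

lemma action_zero: "action (\<lambda>m. 0) = mat 1"
  by (simp add: action_def rotation_one[OF rhom_single] lift_one[OF rhom_hl])

lemma action_natural:
  fixes f :: "'g::ab_group_add \<Rightarrow> 'h::ab_group_add"
  assumes "f 0 = 0" "\<And>a b. f (a + b) = f a + f b"
  shows "map_matrix (push_forward f) (action g) = action (\<lambda>m. f (g m))"
proof -
  have u: "rhom (push_forward f :: ('g \<Rightarrow>\<^sub>0 'k alg_closure) \<Rightarrow> _)"
    by (rule rhom_push_forward[OF assms])
  show ?thesis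
    unfolding action_def
    by (simp add: lift_natural[OF rhom_hl u] rotation_natural[OF rhom_single u] push_forward_single assms(1))
qed

definition "M = action (\<lambda>m. m)"
definition "d = det (action uminus)"

lemma M_inverse: "M ** action uminus = mat 1"
  unfolding M_def by (subst action_mult) (simp_all add: action_zero)

lemma inv_det: "d * det M = 1"
  using arg_cong[OF M_inverse, of det] by (simp add: det_mul d_def mult.commute)

lemma comult_point_M: "comult_point M d"
proof
  show "d * det M = 1" by (rule inv_det)
  have eqs: "map_matrix (push_forward (\<lambda>m. (m, m))) M = action (\<lambda>m. (m, m))"
    "map_matrix (push_forward (\<lambda>m. (m, 0))) M = action (\<lambda>m. (m, 0))"
    "map_matrix (push_forward (\<lambda>m. (0, m))) M = action (\<lambda>m. (0, m))"
    unfolding M_def by (subst action_natural; simp add: zero_prod_def)+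
  show "map_matrix (push_forward (\<lambda>m. (m, m))) M =
      map_matrix (push_forward (\<lambda>m. (m, 0))) M ** map_matrix (push_forward (\<lambda>m. (0, m))) M"
    unfolding eqs by (subst action_mult) simp_all
qed

definition torus_ideal :: "('m, 'k) gl_poly set"
  where "torus_ideal = {f. mp_eval hl (gl_point M d) f = 0}"

lemma prime_torus_ideal: "prime_ideal torus_ideal"
  unfolding torus_ideal_def by (intro prime_ideal_kernel rhom_mp_eval rhom_hl)

lemma M_tensor_aut: "tensor_aut e hl M"
  unfolding M_def action_def
proof (rule lift_tensor_aut[OF rhom_hl])
  show "similitude hl (rotation (single 0) (mon \<alpha>) (mon \<beta>) (mon \<gamma>)) (mon \<alpha> * mon \<beta>)"
    using rotation_action_similar[of "\<lambda>m. m"] by simp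
  show "similitude hl (rotation (single 0) (mon (- \<alpha>)) (mon (- \<beta>)) (mon (- \<gamma>))) (mon (- \<alpha>) * mon (- \<beta>))"
    using rotation_action_similar[of uminus] by simp
  show "rotation (single 0) (mon \<alpha>) (mon \<beta>) (mon \<gamma>) **
      rotation (single 0) (mon (- \<alpha>)) (mon (- \<beta>)) (mon (- \<gamma>)) = mat 1"
    by (simp add: rotation_mult[OF rhom_single] mult_single rotation_one[OF rhom_single])
qed

lemma aut_ideal_subset: "aut_ideal e \<subseteq> torus_ideal"
proof -
  interpret hl: rhom "hl :: 'k \<Rightarrow> weight \<Rightarrow>\<^sub>0 'k alg_closure" by (rule rhom_hl)
  show ?thesis
    using aut_ideal_points[OF hl.add hl.mult hl.one, where e = e and M = M and d = d] inv_det M_tensor_aut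
    by (auto simp: torus_ideal_def)
qed

subsubsection \<open>Descent\<close>

lemma twisting_iota: "twisting to_ac s t \<iota>"
  by standard (use s s_nonzero two iota in auto)

text \<open>Conjugation exchanges E1 and E2 while \<iota> exchanges their weights, so the two
  together fix the entries. In the sum with the \<iota>-image the terms with s cancel; in the
  difference only multiples of s remain, and multiplying by s leaves t.\<close>

lemma rotation_twisted:
  assumes "\<And>a b. g (a + b) = g a + g b" "\<And>a. \<iota> (g a) = g (\<iota> a)"
  shows "rotation (single 0) (mon (g \<alpha>)) (mon (g \<beta>)) (mon (g \<gamma>)) $ i $ j \<in> twisted_form to_ac s \<iota>"
proof -
  interpret tw: twisting to_ac s t \<iota> by (rule twisting_iota)
  define x y z where "x = Xc $ i $ j" "y = Yc $ i $ j" "z = (mat 1 - Xc - Xc) $ i $ j"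
  have r: "rotation (single 0) (mon (g \<alpha>)) (mon (g \<beta>)) (mon (g \<gamma>)) $ i $ j =
      single (g \<alpha>) (to_ac x + s * to_ac y) + single (g \<beta>) (to_ac x - s * to_ac y) + single (g \<gamma>) (to_ac z)"
    by (simp add: rotation_entry[OF rhom_single] mult_single x_y_z_def)
  have p: "push_forward \<iota> (rotation (single 0) (mon (g \<alpha>)) (mon (g \<beta>)) (mon (g \<gamma>)) $ i $ j) =
      single (g \<beta>) (to_ac x + s * to_ac y) + single (g \<alpha>) (to_ac x - s * to_ac y) + single (g \<gamma>) (to_ac z)"
    unfolding r push_forward_add push_forward_single assms(2) iota ..
  have 1: "single (g \<alpha>) (to_ac x + s * to_ac y) + single (g \<beta>) (to_ac x - s * to_ac y) + single (g \<gamma>) (to_ac z) +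
      (single (g \<beta>) (to_ac x + s * to_ac y) + single (g \<alpha>) (to_ac x - s * to_ac y) + single (g \<gamma>) (to_ac z)) =
      single (g \<alpha>) (to_ac (x + x)) + single (g \<beta>) (to_ac (x + x)) + single (g \<gamma>) (to_ac (z + z))"
    by (simp only: to_ac_add single_add single_diff) (simp add: algebra_simps)
  have 2: "single 0 s * (single (g \<alpha>) (to_ac x + s * to_ac y) + single (g \<beta>) (to_ac x - s * to_ac y) + single (g \<gamma>) (to_ac z) -
      (single (g \<beta>) (to_ac x + s * to_ac y) + single (g \<alpha>) (to_ac x - s * to_ac y) + single (g \<gamma>) (to_ac z))) =
      single (g \<alpha>) (to_ac (t * (y + y))) + single (g \<beta>) (to_ac (- (t * (y + y))))"
  proof -
    have "single 0 s * (single (g \<alpha>) (to_ac x + s * to_ac y) + single (g \<beta>) (to_ac x - s * to_ac y) + single (g \<gamma>) (to_ac z) -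
      (single (g \<beta>) (to_ac x + s * to_ac y) + single (g \<alpha>) (to_ac x - s * to_ac y) + single (g \<gamma>) (to_ac z))) =
      single 0 s * (single (g \<alpha>) (s * to_ac (y + y)) - single (g \<beta>) (s * to_ac (y + y)))"
      by (rule arg_cong[of _ _ "\<lambda>u. single 0 s * u"]) 
        (simp only: to_ac_add single_add single_diff distrib_left, simp add: algebra_simps)
    also have "\<dots> = single (g \<alpha>) ((s * s) * to_ac (y + y)) - single (g \<beta>) ((s * s) * to_ac (y + y))"
      by (simp add: right_diff_distrib mult_single ac_simps)
    also have "\<dots> = single (g \<alpha>) (to_ac (t * (y + y))) + single (g \<beta>) (to_ac (- (t * (y + y))))"
      unfolding s by (simp add: single_uminus)
    finally show ?thesis .
  qed
  show ?thesis
    unfolding twisted_form_def mem_Collect_eq p unfolding r 1 2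
    by (simp only: tw.range_map_add tw.range_map_single)
qed

lemma subalgebra_twisted: "subalg hl (twisted_form to_ac s \<iota>)"
proof -
  interpret tw: twisting to_ac s t \<iota> by (rule twisting_iota)
  interpret rhom "hl :: 'k \<Rightarrow> weight \<Rightarrow>\<^sub>0 'k alg_closure" by (rule rhom_hl)
  show ?thesis
    by standard (simp_all only: tw.const_in_R tw.add_in_R tw.mult_in_R)
qed

lemma M_descends: "descends to_ac (range (mp_eval hl (gl_point M d)))"
proof -
  interpret tw: twisting to_ac s t \<iota> by (rule twisting_iota)
  interpret S: subalg hl "twisted_form to_ac s \<iota>" by (rule subalgebra_twisted)
  have neg: "\<iota> (- a) = - \<iota> a" for a
    using iota(2)[of a "- a"] by (simp add: iota(1) add_eq_0_iff)
  have "M $ i $ j \<in> twisted_form to_ac s \<iota>" for i j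
    unfolding M_def action_def
    by (rule lift_in_subalg[OF subalgebra_twisted], rule rotation_twisted) simp_all
  moreover have "d \<in> twisted_form to_ac s \<iota>"
    unfolding d_def action_def
    by (rule S.det_in, rule lift_in_subalg[OF subalgebra_twisted], rule rotation_twisted) (simp_all add: neg)
  ultimately have "gl_point M d v \<in> twisted_form to_ac s \<iota>" for v
    by (simp add: gl_point_def split: gl_var.split)
  then have "range (mp_eval hl (gl_point M d)) \<subseteq> twisted_form to_ac s \<iota>"
    using S.eval_in by blast
  with tw.descends_R show ?thesis by (rule descends_subset)
qed

subsubsection \<open>Generation of the coordinate ring\<close>

lemma q_order: "q \<in> order_ge 2"
proof -
  have "mp_var a * mp_var b \<in> (order_ge 2 :: ('n, 'k) mpoly set)" for a b
    using mult_in_order_ge[OF var_in_order_ge var_in_order_ge] by (simp add: numeral_2_eq_2)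
  then show ?thesis
    unfolding q_eq quad_poly_def by (intro sum_in_order_ge) (rule mult_in_order_ge2)
qed

lemmas kernel_order = kernel_order_ge[OF q_order l_ge]

text \<open>The kernel of \<phi> has order at least 2, so linear coefficients are well-defined
  functionals on A.\<close>

lemma degree_one_functional:
  "(\<Sum>k\<in>UNIV. coord e (\<phi> f) $ k * lookup (basis_lift k) (single i (Suc 0))) = lookup f (single i (Suc 0))"
proof -
  let ?f = "\<Sum>k\<in>UNIV. mp_const (coord e (\<phi> f) $ k) * basis_lift k"
  have "\<phi> (?f - f) = 0"
    by (simp add: phi.diff phi.sum phi_scale phi_basis_lift coord_expand[OF basis])
  then have "lookup (?f - f) (single i (Suc 0)) = 0"
    by (intro order_geD[OF kernel_order]) simp_all
  then show ?thesis
    by (simp add: lookup_minus lookup_sum mp_const_def lookup_single_zero_mult)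
qed

lemma phi_linear_form_nonzero: "c \<noteq> 0 \<Longrightarrow> \<phi> (linear_form (\<lambda>i. c $ i)) \<noteq> 0"
proof
  assume "c \<noteq> 0" "\<phi> (linear_form (\<lambda>i. c $ i)) = 0"
  then have "lookup (linear_form (\<lambda>i. c $ i)) (single i (Suc 0)) = 0" for i
    by (intro order_geD[OF kernel_order]) simp_all
  with \<open>c \<noteq> 0\<close> show False
    unfolding lookup_linear_form by (simp add: vec_eq_iff)
qed

definition linear_vec :: "('k \<Rightarrow> 'b::comm_ring_1) \<Rightarrow> 'b^'n \<Rightarrow> 'b^'m"
  where "linear_vec h c = base_change_coord h (linear_form (\<lambda>i. c $ i))"

lemma linear_vec_eq:
  assumes "rhom h"
  shows "linear_vec h c = (\<Sum>i\<in>UNIV. c $ i *s hcoord e h (\<phi> (mp_var i)))"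
proof -
  have "base_change_coord h (mp_var i) = hcoord e h (\<phi> (mp_var i))" for i
    using kap_map[OF assms, of "mp_var i"] by (simp add: rhom.map_var[OF assms])
  then show ?thesis
    by (simp add: linear_vec_def linear_form_def kap_sum[OF assms] kap_scale[OF assms])
qed

lemma linear_vec_add: "rhom h \<Longrightarrow> linear_vec h (c + c') = linear_vec h c + linear_vec h c'"
  by (simp add: linear_vec_eq vector_sadd_rdistrib sum.distrib)

lemma linear_vec_scale: "rhom h \<Longrightarrow> linear_vec h (a *s c) = a *s linear_vec h c"
  by (simp add: linear_vec_eq vec_eq_iff sum_distrib_left ac_simps)

lemma linear_vec_diff: "rhom h \<Longrightarrow> linear_vec h (c - c') = linear_vec h c - linear_vec h c'"
  by (simp add: linear_vec_eq vec_eq_iff left_diff_distrib sum_subtractf)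

lemma vec_nth_lambda: "($) (\<chi> i. f i) = f"
  by (simp add: fun_eq_iff)

lemma linear_vec_const:
  "linear_vec hl (\<chi> i. single 0 (c $ i)) = (\<chi> k. single 0 (linear_vec to_ac c $ k))"
  unfolding linear_vec_def kap_natural[OF rhom_to_ac rhom_single]
  by (simp add: rhom.map_linear_form[OF rhom_single] vec_nth_lambda)

text \<open>The degree-one functional, extended to the closure, recovers each c i from the
  coordinates.\<close>

lemma linear_vec_to_ac_nonzero:
  assumes "c \<noteq> 0"
  obtains k where "linear_vec to_ac c $ k \<noteq> 0"
proof -
  obtain i where i: "c $ i \<noteq> 0" using assms by (auto simp: vec_eq_iff)
  have var: "(\<Sum>k\<in>UNIV. coord e (\<phi> (mp_var j)) $ k * lookup (basis_lift k) (single i (Suc 0))) = (if j = i then 1 else 0)" for j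
    unfolding degree_one_functional by (simp add: mp_var_def lookup_single when_def single_exponent_eq_iff)
  have "(\<Sum>k\<in>UNIV. linear_vec to_ac c $ k * to_ac (lookup (basis_lift k) (single i (Suc 0)))) =
      (\<Sum>k\<in>UNIV. \<Sum>j\<in>UNIV. c $ j * to_ac (coord e (\<phi> (mp_var j)) $ k * lookup (basis_lift k) (single i (Suc 0))))"
    by (simp add: linear_vec_eq[OF rhom_to_ac] hcoord_def sum_distrib_right mult.assoc)
  also have "\<dots> = (\<Sum>j\<in>UNIV. \<Sum>k\<in>UNIV. c $ j * to_ac (coord e (\<phi> (mp_var j)) $ k * lookup (basis_lift k) (single i (Suc 0))))"
    by (rule sum.swap)
  also have "\<dots> = (\<Sum>j\<in>UNIV. c $ j * to_ac (if j = i then 1 else 0))"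
    unfolding var[symmetric] to_ac_sum sum_distrib_left ..
  also have "\<dots> = c $ i"
    by (simp add: if_distrib cong: if_cong)
  finally have "\<exists>k. linear_vec to_ac c $ k \<noteq> 0"
    using i by (metis (no_types, lifting) mult_zero_left sum.neutral)
  then show ?thesis using that by blast
qed

lemma action_linear_vec:
  fixes g :: "weight \<Rightarrow> 'g::ab_group_add"
  assumes g: "\<And>a b. g (a + b) = g a + g b"
    and c: "rotation (single 0) (mon (g \<alpha>)) (mon (g \<beta>)) (mon (g \<gamma>)) *v c = z *s c"
  shows "action g *v linear_vec hl c = z *s linear_vec hl c"
proof -
  let ?G = "rotation (single 0) (mon (g \<alpha>)) (mon (g \<beta>)) (mon (g \<gamma>))"
  have "action g *v linear_vec hl c = base_change_coord hl (lin_subst ?G (linear_form (\<lambda>i. c $ i)))"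
    unfolding action_def linear_vec_def
    by (rule lift_kap[OF rhom_hl rotation_action_similar[of g, OF g]])
  also have "\<dots> = linear_vec hl (?G *v c)"
    by (simp add: linear_vec_def lin_subst_linear_form) (simp add: matrix_vector_mult_def)
  also have "\<dots> = z *s linear_vec hl c"
    unfolding c by (rule linear_vec_scale[OF rhom_hl])
  finally show ?thesis .
qed

text \<open>A constant eigenvector turns its eigenvalue into a combination of matrix entries with
  constant coefficients: compare one nonzero coordinate and divide by it.\<close>

lemma mon_in_range:
  fixes A :: "(weight \<Rightarrow>\<^sub>0 'k alg_closure)^'m^'m"
  assumes S: "subalg (single 0) S" and A: "\<And>i j. A $ i $ j \<in> S"
    and c: "c \<noteq> 0" and eig: "A *v linear_vec hl (\<chi> i. single 0 (c $ i)) = mon m *s linear_vec hl (\<chi> i. single 0 (c $ i))"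
  shows "mon m \<in> S"
proof -
  interpret S: subalg "single 0" S by (rule S)
  obtain k where k: "linear_vec to_ac c $ k \<noteq> 0"
    using linear_vec_to_ac_nonzero[OF c] .
  have "(A *v linear_vec hl (\<chi> i. single 0 (c $ i))) $ k \<in> S"
    unfolding linear_vec_const matrix_vector_mult_def
    by (simp add: S.sum_in S.mult_in S.const_in A)
  then have "mon m * single 0 (linear_vec to_ac c $ k) \<in> S"
    unfolding eig unfolding linear_vec_const by simp
  then have "mon m * single 0 (linear_vec to_ac c $ k) * single 0 (1 / linear_vec to_ac c $ k) \<in> S"
    by (rule S.mult_in[OF _ S.const_in])
  moreover have "mon m * single 0 (linear_vec to_ac c $ k) * single 0 (1 / linear_vec to_ac c $ k) = mon m"
    using k by (simp add: mult_single)
  ultimately show ?thesis by (simp only:)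
qed

lemma a_nonzero: "a1 \<noteq> 0" "a2 \<noteq> 0"
  using dotp_ab by (auto simp: dotp_def)

text \<open>The monomials \<alpha>, \<beta> and, if there is a complement, \<gamma> are eigenvalues
  of M with constant eigenvectors. Their inverses are eigenvalues of the inverse of M, whose entries
  come from the antipode. By \<open>generate\<close> all monomials are reached.\<close>

lemma range_M: "range (mp_eval (single 0) (gl_point M d)) = laurent_ring 2"
proof
  have idem: "subalg (single 0) (laurent_ring 2 :: 'k alg_closure laurent set)"
    by (rule laurent_ring_subalg[OF rhom_id(1)])
  interpret L: subalg "single 0" "laurent_ring 2 :: 'k alg_closure laurent set" by (rule idem)
  have rot: "rotation (single 0) (mon a) (mon b) (mon c) $ i $ j \<in> laurent_ring 2"
    if "keys a \<subseteq> {..<2}" "keys b \<subseteq> {..<2}" "keys c \<subseteq> {..<2}" for a b c :: "weight" and i j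
    unfolding rotation_entry[OF rhom_single]
    by (intro L.add_in L.mult_in L.const_in laurent_ring_single that)
  have "M $ i $ j \<in> laurent_ring 2" for i j
    unfolding M_def action_def
    by (rule lift_in_subalg[OF laurent_ring_subalg[OF rhom_to_ac]], rule rot) (use support in auto)
  moreover have "d \<in> laurent_ring 2"
    unfolding d_def action_def
    by (rule L.det_in, rule lift_in_subalg[OF laurent_ring_subalg[OF rhom_to_ac]], rule rot)
      (use support in auto)
  ultimately have "gl_point M d v \<in> laurent_ring 2" for v
    by (simp add: gl_point_def split: gl_var.split)
  then show "range (mp_eval (single 0) (gl_point M d)) \<subseteq> laurent_ring 2"
    using L.eval_in by blast
next
  let ?S = "range (mp_eval (single 0) (gl_point M d))"
  interpret s: rhom "single (0 :: weight) :: 'k alg_closure \<Rightarrow> _" by (rule rhom_single)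
  have S: "subalg (single 0) ?S"
  proof
    show "single 0 c \<in> ?S" for c
      by (rule range_eqI[of _ _ "mp_const c"]) (simp add: s.eval_const)
    show "a + b \<in> ?S" if "a \<in> ?S" "b \<in> ?S" for a b
      using that by (auto simp flip: s.eval_add)
    show "a * b \<in> ?S" if "a \<in> ?S" "b \<in> ?S" for a b
      using that by (auto simp flip: s.eval_mult)
  qed
  interpret S: subalg "single 0" ?S by (rule S)
  have M: "M $ i $ j \<in> ?S" for i j
    by (rule range_eqI[of _ _ "mp_var (Entry i j)"]) (simp add: s.eval_var gl_point_def)
  have N: "action uminus $ i $ j \<in> ?S" for i j
    by (rule range_eqI[of _ _ "gl_antipode (mp_var (Entry i j))"])
      (simp add: eval_antipode[OF rhom_single M_inverse inv_det] s.eval_var gl_point_def)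
  have both: "mon m \<in> ?S" "mon (- m) \<in> ?S"
    if c: "c \<noteq> 0" and eig: "\<And>g :: weight \<Rightarrow> weight.
      rotation (single 0) (mon (g \<alpha>)) (mon (g \<beta>)) (mon (g \<gamma>)) *v (\<chi> i. single 0 (c $ i)) = mon (g m) *s (\<chi> i. single 0 (c $ i))"
    for c m
  proof -
    show "mon m \<in> ?S"
      by (rule mon_in_range[OF S M c], unfold M_def, rule action_linear_vec) (simp_all add: eig[of "\<lambda>m. m"])
    show "mon (- m) \<in> ?S"
      by (rule mon_in_range[OF S N c], rule action_linear_vec) (simp_all add: eig[of uminus])
  qed
  have "mon m \<in> ?S \<and> mon (- m) \<in> ?S" if m: "keys m \<subseteq> {..<2}" for m
  proof -
    have "m \<in> {m. mon m \<in> ?S \<and> mon (- m) \<in> ?S}"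
    proof (rule generate[OF m])
      show "0 \<in> {m. mon m \<in> ?S \<and> mon (- m) \<in> ?S}"
        using S.one_in by simp
      show "a + b \<in> {m. mon m \<in> ?S \<and> mon (- m) \<in> ?S}"
        if "a \<in> {m. mon m \<in> ?S \<and> mon (- m) \<in> ?S}" "b \<in> {m. mon m \<in> ?S \<and> mon (- m) \<in> ?S}" for a b
      proof -
        have "mon (a + b) = mon a * mon b" "mon (- (a + b)) = mon (- a) * mon (- b)"
          by (simp_all add: mult_single)
        then show ?thesis using that by (simp only: mem_Collect_eq S.mult_in)
      qed
      show "- a \<in> {m. mon m \<in> ?S \<and> mon (- m) \<in> ?S}" if "a \<in> {m. mon m \<in> ?S \<and> mon (- m) \<in> ?S}" for a
        using that by simp
      show "\<alpha> \<in> {m. mon m \<in> ?S \<and> mon (- m) \<in> ?S}"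
        using both[OF a_nonzero(1), of \<alpha>] rotation_eigen(1)[OF rhom_single] by blast
      show "\<beta> \<in> {m. mon m \<in> ?S \<and> mon (- m) \<in> ?S}"
        using both[OF a_nonzero(2), of \<beta>] rotation_eigen(2)[OF rhom_single] by blast
      assume "E0 \<noteq> 0"
      then obtain x where "E0 *v x \<noteq> 0"
        using matrix_eq_axisI[of E0 0] by (metis matrix_vector_mult_0)
      from both[OF this, of \<gamma>] rotation_eigen(3)[OF rhom_single]
      show "\<gamma> \<in> {m. mon m \<in> ?S \<and> mon (- m) \<in> ?S}" by blast
    qed
    then show ?thesis by simp
  qed
  note mon = this
  show "laurent_ring 2 \<subseteq> ?S"
  proof
    fix p :: "'k alg_closure laurent" assume p: "p \<in> laurent_ring 2"
    have "(\<Sum>m\<in>keys p. single m (lookup p m)) \<in> ?S"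
    proof (rule S.sum_in)
      fix m assume "m \<in> keys p"
      then have "mon m \<in> ?S" using p mon by (auto simp: laurent_ring_def)
      then have "single 0 (lookup p m) * mon m \<in> ?S" by (intro S.mult_in S.const_in)
      then show "single m (lookup p m) \<in> ?S" by (simp add: mult_single)
    qed
    then show "p \<in> ?S" by (simp flip: poly_mapping_sum_singles)
  qed
qed

lemma torus_torus_ideal: "torus torus_ideal"
  unfolding torus_ideal_def by (rule torus_kernel[OF comult_point_M range_M M_descends])

lemma identity_component_subset_torus: "identity_component (aut_ideal e) \<subseteq> torus_ideal"
proof (rule identity_component_subset[OF prime_torus_ideal aut_ideal_subset])
  show "torus_ideal \<subseteq> {g. gl_counit g = 0}"
    using torus_torus_ideal by (auto simp: torus_def closed_subgroup_def)
qed

end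

lemma prod_const_mult: "(\<Prod>i\<in>S. z ^ f i) = z ^ (\<Sum>i\<in>S. f i)" for z :: "'b::comm_ring_1"
  by (induction S rule: infinite_finite_induct) (simp_all add: power_add)

lemma lin_subst_scalar: "lin_subst (mat z) (single m c) = mp_const (z ^ mdeg m) * single m c"
proof -
  interpret c: rhom mp_const by (rule rhom_mp_const)
  have "linear_form (\<lambda>j. mat z $ j $ i) = mp_const z * mp_var i" for i :: 'a
  proof -
    have "mp_const (mat z $ j $ i) * mp_var j = (if j = i then mp_const z * mp_var i else 0)" for j
      by (simp add: mat_def c.zero)
    then show ?thesis by (simp add: linear_form_def)
  qed
  then have "lin_subst (mat z) (single m c) = mp_const c * (\<Prod>i\<in>keys m. mp_const z ^ lookup m i * mp_var i ^ lookup m i)"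
    by (simp add: lin_subst_def c.eval_single power_mult_distrib)
  also have "\<dots> = mp_const (z ^ mdeg m) * (mp_const c * (\<Prod>i\<in>keys m. mp_var i ^ lookup m i))"
    by (simp add: prod.distrib prod_const_mult mdeg_def c.power ac_simps)
  also have "mp_const c * (\<Prod>i\<in>keys m. mp_var i ^ lookup m i) = single m c"
    using mp_eval_self[of "single m c"] by (simp add: c.eval_single)
  finally show ?thesis .
qed

text \<open>The torus acts on a monomial of degree n by the character n \<psi>; the multiple is a
  sum, since \<open>'g\<close> is just an abelian group.\<close>

definition (in presentation) scaling_matrix :: "'g::ab_group_add \<Rightarrow> ('g \<Rightarrow>\<^sub>0 'k)^'m^'m \<Rightarrow> bool"
  where "scaling_matrix \<psi> N \<longleftrightarrow> (\<forall>m. N *v hcoord e (single 0) (\<phi> (single m 1)) =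
    single (\<Sum>i<mdeg m. \<psi>) 1 *s hcoord e (single 0) (\<phi> (single m 1)))"

section \<open>Comparison with the scaling action\<close>

context torus_data
begin

lemma rotation_scalar':
  assumes h: "rhom h" and z: "z = u \<or> E0 = 0"
  shows "rotation h u u z = mat u"
proof -
  have "rotation h u u z = rotation h u u u"
    using z by (auto simp: rotation_def map_zero[OF h] matrix_mult_zero)
  then show ?thesis by (simp add: rotation_scalar[OF h])
qed

lemma scaling_matrix_map:
  fixes N :: "('g::ab_group_add \<Rightarrow>\<^sub>0 'k)^'m^'m"
  assumes N: "scaling_matrix \<psi> N"
  shows "map_matrix (map_coeffs to_ac) N = lift hl (mat (mon \<psi>))"
proof (rule matrix_eq_axisI)
  fix j
  let ?N = "map_matrix (map_coeffs to_ac) N"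
  let ?hl = "hl :: 'k \<Rightarrow> 'g \<Rightarrow>\<^sub>0 'k alg_closure"
  interpret m: rhom "map_coeffs to_ac :: ('g \<Rightarrow>\<^sub>0 'k) \<Rightarrow> _"
    by (rule rhom.rhom_map[OF rhom_to_ac])
  have hc: "hcoord e ?hl x = (\<chi> k. map_coeffs to_ac (hcoord e (single 0) x $ k))" for x
    by (simp add: hcoord_def)
  have Nv: "?N *v (\<chi> k. map_coeffs to_ac (v $ k)) = (\<chi> k. map_coeffs to_ac ((N *v v) $ k))" for v
    by (simp add: matrix_vector_mult_def map_matrix_def vec_eq_iff m.sum m.mult)
  have mono: "?N *v hcoord e ?hl (\<phi> (single m 1)) = mon \<psi> ^ mdeg m *s hcoord e ?hl (\<phi> (single m 1))" for m
    unfolding hc Nv using N[unfolded scaling_matrix_def]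
    by (simp add: vec_eq_iff m.mult single_power)
  have "?N *v hcoord e ?hl (\<phi> f) = base_change_coord ?hl (lin_subst (mat (mon \<psi>)) (map_coeffs ?hl f))" for f
  proof (induction f rule: poly_mapping_induct)
    case zero
    show ?case
      by (simp add: phi.zero hcoord_zero[OF basis rhom_hl] rhom.zero[OF rhom.rhom_map[OF rhom_hl]]
          rhom.zero[OF rhom_lin_subst] kap_zero[OF rhom_hl])
  next
    case (single m c)
    have "?N *v hcoord e ?hl (\<phi> (single m c)) = ?hl c *s (mon \<psi> ^ mdeg m *s hcoord e ?hl (\<phi> (single m 1)))"
      by (simp only: phi_single[of m c] hcoord_smul[OF basis rhom_hl] mult_vec_scale mono)
    also have "\<dots> = base_change_coord ?hl (mp_const (mon \<psi> ^ mdeg m) * single m (?hl c))"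
      unfolding kap_scale[OF rhom_hl] kap_single[OF rhom_hl] vector_smult_assoc by (simp only: mult.commute)
    finally show ?case
      by (simp add: lin_subst_scalar rhom.zero[OF rhom_hl])
  next
    case (add f g)
    then show ?case
      by (simp add: phi.add hcoord_add[OF basis rhom_hl] rhom.add[OF rhom.rhom_map[OF rhom_hl]]
          rhom.add[OF rhom_lin_subst] kap_add[OF rhom_hl] matrix_vector_right_distrib)
  qed
  from this[of "basis_lift j"] show "?N *v axis j 1 = lift ?hl (mat (mon \<psi>)) *v axis j 1"
    unfolding lift_basis[OF rhom_hl] phi_basis_lift hcoord_basis[OF basis rhom_hl] .
qed

text \<open>Composing characters with \<theta> makes the three weights equal to \<psi>, so the
  rotation becomes a scalar and the specialised M becomes N. Thus the scaling action factors through
  the larger torus. N has coefficients in k, and passing to the closure is injective.\<close>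

lemma torus_ideal_vanishes_on_scaling:
  fixes N :: "('g::ab_group_add \<Rightarrow>\<^sub>0 'k)^'m^'m"
  assumes N: "scaling_matrix \<psi> N" "c * det N = 1"
    and \<theta>: "\<theta> 0 = 0" "\<And>a b. \<theta> (a + b) = \<theta> a + \<theta> b" "\<theta> \<alpha> = \<psi>" "\<theta> \<beta> = \<psi>" "\<theta> \<gamma> = \<psi> \<or> E0 = 0"
    and f: "f \<in> torus_ideal"
  shows "mp_eval (single 0) (gl_point N c) f = 0"
proof -
  interpret u: rhom "push_forward \<theta> :: _ \<Rightarrow> ('g \<Rightarrow>\<^sub>0 'k alg_closure)"
    by (rule rhom_push_forward[OF \<theta>(1,2)])
  interpret m: rhom "map_coeffs to_ac :: ('g \<Rightarrow>\<^sub>0 'k) \<Rightarrow> _"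
    by (rule rhom.rhom_map[OF rhom_to_ac])
  have "map_matrix (push_forward \<theta>) M = action \<theta>"
    unfolding M_def by (rule action_natural[OF \<theta>(1,2)])
  also have "\<dots> = lift hl (mat (mon \<psi>))"
    unfolding action_def \<theta>(3,4) using \<theta>(5) by (subst rotation_scalar'[OF rhom_single]) auto
  finally have M: "map_matrix (push_forward \<theta>) M = map_matrix (map_coeffs to_ac) N"
    unfolding scaling_matrix_map[OF N(1)] .
  have "push_forward \<theta> d * det (map_matrix (push_forward \<theta>) M) = 1"
    "map_coeffs to_ac c * det (map_matrix (map_coeffs to_ac) N) = 1"
    using arg_cong[OF inv_det, of "push_forward \<theta>"] arg_cong[OF N(2), of "map_coeffs to_ac"]
    by (simp_all add: u.mult u.det u.one m.mult m.det m.one)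
  then have d: "push_forward \<theta> d = map_coeffs to_ac c"
    unfolding M by (rule unit_inverse_unique)
  have "push_forward \<theta> (mp_eval hl (gl_point M d) f) = 0"
    using f by (simp add: torus_ideal_def u.zero)
  then have "map_coeffs to_ac (mp_eval (single 0) (gl_point N c) f) = 0"
    by (simp add: mp_eval_gl_point_comp[OF u.rhom_axioms] mp_eval_gl_point_comp[OF m.rhom_axioms] M d
        push_forward_single \<theta>(1))
  then show ?thesis by (rule map_to_ac_eq_0)
qed

text \<open>The torus does not act by scalars on the plane, so a linear relation of the scaling action fails.\<close>

lemma scaling_relation:
  obtains f where "f \<notin> torus_ideal"
    "\<And>(N :: ('g::ab_group_add \<Rightarrow>\<^sub>0 'k)^'m^'m) \<psi> c. scaling_matrix \<psi> N \<Longrightarrow> mp_eval (single 0) (gl_point N c) f = 0"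
proof -
  define u w where "u = coord e (\<phi> (linear_form (\<lambda>i. p1 $ i)))" "w = coord e (\<phi> (linear_form (\<lambda>i. p2 $ i)))"
  have "p1 \<noteq> 0" using dots(1) by (auto simp: dotp_def)
  then have "u \<noteq> 0"
    using phi_linear_form_nonzero coord_eq_0[OF basis] unfolding u_w_def by blast
  then obtain k where k: "u $ k \<noteq> 0" by (auto simp: vec_eq_iff)
  \<comment> \<open>u and w are the coordinates of two independent linear forms. At N, f is (N u) k
    * w k - u k * (N w) k, which is 0 if N multiplies both by the same scalar.\<close>
  define f where "f = (\<Sum>j\<in>UNIV. mp_var (Entry k j) * mp_const (u $ j * w $ k - u $ k * w $ j)) "
  have eval: "mp_eval h (gl_point N c) f = (N *v (\<chi> j. h (u $ j))) $ k * h (w $ k) - h (u $ k) * (N *v (\<chi> j. h (w $ j))) $ k"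
    if h: "rhom h" for h :: "'k \<Rightarrow> 'b::comm_ring_1" and N c
  proof -
    interpret h: rhom h by (rule h)
    interpret e: rhom "mp_eval h (gl_point N c)" by (rule rhom_mp_eval[OF h])
    show ?thesis
      by (simp add: f_def e.sum e.mult h.eval_var h.eval_const gl_point_def h.diff h.mult matrix_vector_mult_def
          right_diff_distrib sum_subtractf sum_distrib_left sum_distrib_right ac_simps)
  qed
  have hu: "(\<chi> j. h (u $ j)) = linear_vec h (\<chi> i. h (p1 $ i))" "(\<chi> j. h (w $ j)) = linear_vec h (\<chi> i. h (p2 $ i))"
    if h: "rhom h" for h :: "'k \<Rightarrow> 'b::comm_ring_1"
    using kap_map[OF h, of "linear_form (\<lambda>i. p1 $ i)"] kap_map[OF h, of "linear_form (\<lambda>i. p2 $ i)"]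
    by (simp_all add: linear_vec_def u_w_def hcoord_def rhom.map_linear_form[OF h] vec_nth_lambda)
  have "mp_eval (single 0) (gl_point N c) f = 0" if N: "scaling_matrix \<psi> N"
    for N :: "('g \<Rightarrow>\<^sub>0 'k)^'m^'m" and \<psi> c
  proof -
    have var: "N *v hcoord e (single 0) (\<phi> (mp_var i)) = single \<psi> 1 *s hcoord e (single 0) (\<phi> (mp_var i))" for i
      using N[unfolded scaling_matrix_def, rule_format, of "single i 1"] by (simp add: mp_var_def)
    have lin: "N *v linear_vec (single 0) a = single \<psi> 1 *s linear_vec (single 0) a" for a
      unfolding linear_vec_eq[OF rhom_single] mult_vec_sum mult_vec_scale var
      by (simp add: vec_eq_iff sum_distrib_left ac_simps)
    show ?thesis
      unfolding eval[OF rhom_single] hu[OF rhom_single] lin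
      unfolding hu[OF rhom_single, symmetric] by (simp add: ac_simps)
  qed
  moreover have "f \<notin> torus_ideal"
  proof
    assume "f \<in> torus_ideal"
    then have f0: "mp_eval hl (gl_point M d) f = 0" by (simp add: torus_ideal_def)
    let ?s = "single (0 :: weight) s"
    let ?c = "\<lambda>a :: 'k alg_closure^'n. \<chi> i. single (0 :: weight) (a $ i)"
    let ?p1 = "\<chi> i. (hl (p1 $ i) :: 'k alg_closure laurent)" and ?p2 = "\<chi> i. (hl (p2 $ i) :: 'k alg_closure laurent)"
    have a: "?c a1 = ?p1 + ?s *s ?p2" "?c a2 = ?p1 - ?s *s ?p2"
      by (simp_all add: vec_eq_iff a1_def a2_def tov_def single_add single_diff mult_single)
    have eig: "M *v linear_vec hl (?c a1) = mon \<alpha> *s linear_vec hl (?c a1)"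
      "M *v linear_vec hl (?c a2) = mon \<beta> *s linear_vec hl (?c a2)"
      unfolding M_def by (rule action_linear_vec; simp add: rotation_eigen[OF rhom_single])+
    define U W :: "'k alg_closure laurent" where "U = hl (u $ k)" "W = hl (w $ k)"
    define MU MW where "MU = (M *v linear_vec hl ?p1) $ k" "MW = (M *v linear_vec hl ?p2) $ k"
    have UW: "linear_vec hl ?p1 $ k = U" "linear_vec hl ?p2 $ k = W"
      by (simp_all add: U_W_def flip: hu[OF rhom_hl])
    have rel: "MU * W = U * MW"
      using f0 unfolding eval[OF rhom_hl] hu[OF rhom_hl] MU_MW_def U_W_def by simp
    have e1: "MU + ?s * MW = mon \<alpha> * (U + ?s * W)"
      using arg_cong[OF eig(1), of "\<lambda>v. v $ k"]
      by (simp add: a linear_vec_add[OF rhom_hl] linear_vec_scale[OF rhom_hl] matrix_vector_right_distrib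
          mult_vec_scale UW distrib_left mult.assoc flip: MU_MW_def)
    have e2: "MU - ?s * MW = mon \<beta> * (U - ?s * W)"
      using arg_cong[OF eig(2), of "\<lambda>v. v $ k"]
      by (simp add: a linear_vec_diff[OF rhom_hl] linear_vec_scale[OF rhom_hl] matrix_vector_mult_diff_distrib
          mult_vec_scale UW right_diff_distrib mult.assoc flip: MU_MW_def)
    have "(MU + ?s * MW) * (U - ?s * W) = MU * U - ?s * (MU * W) + ?s * (U * MW) - ?s * ?s * (MW * W)"
      "(MU - ?s * MW) * (U + ?s * W) = MU * U + ?s * (MU * W) - ?s * (U * MW) - ?s * ?s * (MW * W)"
      by (simp_all add: algebra_simps)
    then have "(MU + ?s * MW) * (U - ?s * W) = (MU - ?s * MW) * (U + ?s * W)"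
      unfolding rel by simp
    \<comment> \<open>Laurent polynomials form a domain and \<alpha> \<noteq> \<beta>, so the norm
      form U^2 - t W^2 vanishes at two constants with U nonzero. Then t is the square of u k / w
      k.\<close>
    then have "(mon \<alpha> - mon \<beta>) * ((U + ?s * W) * (U - ?s * W)) = 0"
      unfolding e1 e2 by (simp add: algebra_simps)
    moreover have "mon \<alpha> \<noteq> (mon \<beta> :: 'k alg_closure laurent)"
    proof
      assume "mon \<alpha> = (mon \<beta> :: 'k alg_closure laurent)"
      then have "lookup (mon \<alpha> :: 'k alg_closure laurent) \<alpha> = lookup (mon \<beta>) \<alpha>" by simp
      then show False using alpha_neq_beta by (simp add: lookup_single)
    qed
    ultimately have "(U + ?s * W) * (U - ?s * W) = 0" by simp
    then have "U * U = ?s * ?s * (W * W)" by (simp add: algebra_simps)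
    then have "single (0 :: weight) (to_ac (u $ k * u $ k)) = single 0 (to_ac (t * (w $ k * w $ k)))"
      by (simp add: U_W_def mult_single s)
    then have eq: "u $ k * u $ k = t * (w $ k * w $ k)"
      by (metis lookup_single_eq to_ac_eq_iff)
    then have "w $ k \<noteq> 0" using k by auto
    then have "(u $ k / w $ k) * (u $ k / w $ k) = t" using eq by (simp add: field_simps)
    with nonsquare show False by blast
  qed
  ultimately show ?thesis using that by blast
qed

end

section \<open>The grading defined by a split torus\<close>

text \<open>F is only additive: it will be a functional on A whose values on products are known,
  although it is not multiplicative.\<close>

lemma map_mult_expand:
  fixes P :: "'g::comm_monoid_add \<Rightarrow>\<^sub>0 'a::comm_ring_1" and F :: "'a \<Rightarrow> 'b::comm_ring_1"
  assumes F: "\<And>a b. F (a + b) = F a + F b"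
  shows "map_coeffs F (P * Q) =
    (\<Sum>m\<in>keys P. \<Sum>n\<in>keys Q. single (m + n) (F (lookup P m * lookup Q n)))"
proof -
  have F0: "F 0 = 0" using F[of 0 0] by simp
  have sum: "map_coeffs F (sum f S) = (\<Sum>i\<in>S. map_coeffs F (f i))" for f :: "'c \<Rightarrow> 'g \<Rightarrow>\<^sub>0 'a" and S
    by (induction S rule: infinite_finite_induct) (simp_all add: map_add F F0, simp_all add: F0 poly_mapping_eqI lookup_map)
  have sum': "map_coeffs F (sum f S) = (\<Sum>i\<in>S. map_coeffs F (f i))" for f :: "'g \<Rightarrow> 'g \<Rightarrow>\<^sub>0 'a" and S
    by (induction S rule: infinite_finite_induct) (simp_all add: map_add F F0, simp_all add: F0 poly_mapping_eqI lookup_map)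
  have "P * Q = (\<Sum>m\<in>keys P. \<Sum>n\<in>keys Q. single (m + n) (lookup P m * lookup Q n))"
    by (subst (1) poly_mapping_sum_singles[of P], subst (1) poly_mapping_sum_singles[of Q])
      (simp add: sum_product mult_single)
  then show ?thesis by (simp add: sum' F0)
qed

lemma map_sum_singles: "F 0 = 0 \<Longrightarrow> map_coeffs F P = (\<Sum>m\<in>keys P. single m (F (lookup P m)))"
  by (rule poly_mapping_eqI)
    (auto simp: lookup_map lookup_sum lookup_single when_def sum.delta in_keys_iff)

lemma push_forward_map: "F 0 = 0 \<Longrightarrow> (\<And>a b. F (a + b) = F a + F b) \<Longrightarrow>
    push_forward g (map_coeffs F p) = map_coeffs F (push_forward g p)"
  for F :: "'a::comm_ring_1 \<Rightarrow> 'b::comm_ring_1"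
proof (induction p rule: poly_mapping_induct)
  case zero
  then show ?case by (simp add: push_forward_def poly_mapping_eqI lookup_map)
qed (simp_all add: push_forward_single push_forward_add map_add)

section \<open>Taylor coefficients of polynomials along a line through the origin\<close>

definition line_eval :: "('n \<Rightarrow> 'k::comm_ring_1) \<Rightarrow> ('n, 'k) mpoly \<Rightarrow> 'k poly"
  where "line_eval c = mp_eval (\<lambda>a. [:a:]) (\<lambda>i. [:0, c i:])"

lemma rhom_pconst: "rhom (\<lambda>a :: 'k::comm_ring_1. [:a:])"
  by standard (simp_all add: one_pCons)

lemma rhom_line_eval: "rhom (line_eval c)"
  unfolding line_eval_def by (rule rhom_mp_eval[OF rhom_pconst])

lemma line_eval_single:
  fixes c :: "'n \<Rightarrow> 'k::comm_ring_1"
  shows "line_eval c (single m a) = Polynomial.monom (a * (\<Prod>i\<in>keys m. c i ^ lookup m i)) (mdeg m)"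
proof -
  have "[:0, x:] ^ n = Polynomial.monom (x ^ n) n" for x :: 'k and n
    by (induction n) (simp_all add: monom_Suc one_pCons[symmetric] mult_monom[symmetric] monom_0 monom_altdef mult.commute)
  moreover have "(\<Prod>i\<in>S. Polynomial.monom (f i) (k i)) = Polynomial.monom (\<Prod>i\<in>S. f i) (\<Sum>i\<in>S. k i)"
    for f :: "'n \<Rightarrow> 'k" and k S
    by (induction S rule: infinite_finite_induct) (simp_all add: mult_monom)
  ultimately show ?thesis
    by (simp add: line_eval_def rhom.eval_single[OF rhom_pconst] mdeg_def smult_monom)
qed

lemma coeff_line_eval_order: "f \<in> order_ge d \<Longrightarrow> j < d \<Longrightarrow> Polynomial.coeff (line_eval c f) j = 0"
proof (induction rule: order_ge_induct)
  case zero
  show ?case by (simp add: rhom.zero[OF rhom_line_eval])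
next
  case (single m a)
  then show ?case by (simp add: line_eval_single)
next
  case (add f g)
  then show ?case by (simp add: rhom.add[OF rhom_line_eval])
qed

lemma coeff_line_eval_0: "Polynomial.coeff (line_eval c f) 0 = lookup f 0"
proof (induction f rule: poly_mapping_induct)
  case (single m a)
  show ?case by (auto simp: mdeg_eq_0 line_eval_single lookup_single when_def)
qed (simp_all add: rhom.zero[OF rhom_line_eval] rhom.add[OF rhom_line_eval] lookup_add)

lemma mdeg_1:
  assumes "mdeg m = 1"
  obtains i where "m = single i 1"
proof -
  have "Suc 0 \<le> mdeg m" using assms by simp
  then obtain i m' where m: "m = single i 1 + m'" using single_factor_var[of 0 m 0] by metis
  then have "mdeg m' = 0" using assms by (simp add: mdeg_add)
  then have "m' = 0" by (simp add: mdeg_eq_0)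
  then show ?thesis using m that by simp
qed

lemma coeff_line_eval_1: "Polynomial.coeff (line_eval (\<lambda>i. if i = j then 1 else 0) f) 1 = lookup f (single j 1)"
proof (induction f rule: poly_mapping_induct)
  case (single m a)
  show ?case
  proof (cases "mdeg m = 1")
    case True
    then obtain i where "m = single i 1" by (rule mdeg_1)
    then show ?thesis by (simp add: line_eval_single lookup_single when_def single_exponent_eq_iff)
  next
    case False
    then have "m \<noteq> single j 1" by auto
    with False show ?thesis by (simp add: line_eval_single lookup_single when_def)
  qed
qed (simp_all add: rhom.zero[OF rhom_line_eval] rhom.add[OF rhom_line_eval] lookup_add)

lemma line_eval_linear: "Polynomial.coeff (line_eval c (mp_var i)) 1 = c i"
  by (simp add: mp_var_def line_eval_single)

lemma line_eval_quadratic: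
  assumes "quadratic_form q"
  shows "line_eval c q = Polynomial.monom (mp_eval id c q) 2"
proof -
  have deg: "mdeg m = 2" if "m \<in> keys q" for m
    using assms that by (simp add: quadratic_form_def mdeg_def)
  have "line_eval c q = (\<Sum>m\<in>keys q. line_eval c (single m (lookup q m)))"
    by (subst poly_mapping_sum_singles[of q]) (simp add: rhom.sum[OF rhom_line_eval])
  also have "\<dots> = (\<Sum>m\<in>keys q. Polynomial.monom (lookup q m * (\<Prod>i\<in>keys m. c i ^ lookup m i)) 2)"
    by (rule sum.cong) (simp_all add: line_eval_single deg)
  finally show ?thesis
    by (simp add: mp_eval_def monom_sum)
qed

lemma coeff_mult_low:
  assumes "Polynomial.coeff p 0 = 0" "Polynomial.coeff r 0 = 0"
  shows "Polynomial.coeff (p * r) 1 = 0" "Polynomial.coeff (p * r) 2 = Polynomial.coeff p 1 * Polynomial.coeff r 1"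
  using assms by (simp_all add: coeff_mult numeral_2_eq_2)

section \<open>The coaction of a split torus on the algebra\<close>

locale torus_action =
  presentation smul e \<phi> q l + comult_point N c
  for smul :: "'k::field \<Rightarrow> 'a::comm_ring_1 \<Rightarrow> 'a" and e :: "'m::finite \<Rightarrow> 'a"
    and \<phi> :: "('n::finite, 'k) mpoly \<Rightarrow> 'a" and q l
    and N :: "'k laurent^'m^'m" and c +
  assumes aut: "tensor_aut e (single 0) N"
    and quad: "quadratic_form q"
    and aniso: "mp_eval id v q = 0 \<Longrightarrow> v = (\<lambda>_. 0)"
    and two: "(2 :: 'k) \<noteq> 0"
    and l_gt: "2 < l"
begin

lemmas q_order = quadratic_form_order_ge[OF quad]

lemmas kernel_order = kernel_order_ge[OF q_order less_imp_le[OF l_gt]]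

definition embed :: "'k laurent \<Rightarrow> weight \<Rightarrow>\<^sub>0 'a"
  where "embed = map_coeffs (\<lambda>a. smul a 1)"

lemma rhom_embed: "rhom embed"
  unfolding embed_def by (rule rhom.rhom_map[OF rhom_smul])

text \<open>Passes from coordinates of A \<otimes> k[T] to Laurent polynomials with coefficients in
  A, where the weight components of an element become its coefficients.\<close>

definition assemble :: "'k laurent^'m \<Rightarrow> weight \<Rightarrow>\<^sub>0 'a"
  where "assemble u = (\<Sum>k\<in>UNIV. embed (u $ k) * single 0 (e k))"

lemma assemble_add: "assemble (u + v) = assemble u + assemble v"
  by (simp add: assemble_def rhom.add[OF rhom_embed] distrib_right sum.distrib)

lemma assemble_hcoord: "assemble (hcoord e (single 0) a) = single 0 a"
proof -
  interpret s: rhom "single (0 :: weight) :: 'a \<Rightarrow> _" by (rule rhom_single)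
  have "assemble (hcoord e (single 0) a) = (\<Sum>k\<in>UNIV. single 0 (smul (coord e a $ k) (e k)))"
    by (simp add: assemble_def hcoord_def embed_def mult_single smul_eq[of _ "e _", symmetric])
  also have "\<dots> = single 0 a"
    unfolding s.sum[symmetric] coord_expand[OF basis] ..
  finally show ?thesis .
qed

lemma assemble_mult: "assemble (tensor_mult e (single 0) u v) = assemble u * assemble v"
proof -
  interpret E: rhom embed by (rule rhom_embed)
  let ?c = "\<lambda>i j k. single (0 :: weight) (coord e (e i * e j) $ k)"
  have ee: "single 0 (e i * e j) = (\<Sum>k\<in>UNIV. embed (?c i j k) * single 0 (e k))" for i j
    using assemble_hcoord[of "e i * e j"] by (simp add: assemble_def hcoord_def)
  have "assemble u * assemble v = (\<Sum>i\<in>UNIV. \<Sum>j\<in>UNIV. embed (u $ i) * embed (v $ j) * single 0 (e i * e j))"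
    unfolding assemble_def sum_product by (intro sum.cong refl) (simp add: mult_single[of 0 _ 0, simplified, symmetric] ac_simps)
  also have "\<dots> = (\<Sum>i\<in>UNIV. \<Sum>j\<in>UNIV. \<Sum>k\<in>UNIV. embed (u $ i * v $ j * ?c i j k) * single 0 (e k))"
    by (simp add: ee sum_distrib_left E.mult ac_simps)
  also have "\<dots> = (\<Sum>i\<in>UNIV. \<Sum>k\<in>UNIV. \<Sum>j\<in>UNIV. embed (u $ i * v $ j * ?c i j k) * single 0 (e k))"
    by (intro sum.cong refl sum.swap)
  also have "\<dots> = (\<Sum>k\<in>UNIV. \<Sum>i\<in>UNIV. \<Sum>j\<in>UNIV. embed (u $ i * v $ j * ?c i j k) * single 0 (e k))"
    by (rule sum.swap)
  also have "\<dots> = assemble (tensor_mult e (single 0) u v)"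
    by (simp add: assemble_def tensor_mult_def E.sum sum_distrib_right)
  finally show ?thesis ..
qed

definition coaction :: "'a \<Rightarrow> weight \<Rightarrow>\<^sub>0 'a"
  where "coaction a = assemble (N *v hcoord e (single 0) a)"

lemma rhom_coaction: "rhom coaction"
proof
  show "coaction (a + b) = coaction a + coaction b" for a b
    by (simp add: coaction_def hcoord_add[OF basis rhom_single] matrix_vector_right_distrib assemble_add)
  show "coaction (a * b) = coaction a * coaction b" for a b
    using aut unfolding tensor_aut_def coaction_def
    by (simp add: assemble_mult flip: hcoord_mult[OF basis rhom_single])
  show "coaction 1 = 1"
    using aut unfolding tensor_aut_def coaction_def tensor_one_eq
    by (simp add: assemble_hcoord)
qed

sublocale coact: rhom coaction
  by (rule rhom_coaction)

lemma lookup_assemble: "coord e (lookup (assemble u) g) $ k = lookup (u $ k) g"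
proof -
  have "lookup (assemble u) g = (\<Sum>k\<in>UNIV. smul (lookup (u $ k) g) (e k))"
  proof -
    have "lookup (embed p * single 0 a) g = smul (lookup p g) a" for p a
      using lookup_single_zero_mult[of a "embed p" g] rhom.zero[OF rhom_smul]
      by (simp add: embed_def lookup_map mult.commute[of "single 0 a"] smul_eq[of _ a] mult.commute[of a])
    then show ?thesis by (simp add: assemble_def lookup_sum)
  qed
  then show ?thesis
    by (simp add: coord_sum[OF basis] coord_smul[OF basis] coord_basis[OF basis] axis_def if_distrib cong: if_cong)
qed

abbreviation weight_comp :: "weight \<Rightarrow> 'a \<Rightarrow> 'a"
  where "weight_comp g a \<equiv> lookup (coaction a) g"

lemma coord_comp: "coord e (weight_comp g a) $ k = (\<Sum>j\<in>UNIV. lookup (N $ k $ j) g * coord e a $ j)"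
proof -
  have "lookup (p * single 0 x) g = lookup p g * x" for p :: "'k laurent" and x
    using lookup_single_zero_mult[of x p g] by (simp add: mult.commute)
  then show ?thesis
    by (simp add: coaction_def lookup_assemble matrix_vector_mult_def lookup_sum hcoord_def)
qed

text \<open>Comparing coefficients at a pair of exponents in the comultiplication axiom shows that
  the coefficient matrices of N are orthogonal idempotents.\<close>

lemma coaction_comp: "coaction (weight_comp g a) = single g (weight_comp g a)"
proof (rule poly_mapping_eqI)
  fix g'
  have NN: "(\<Sum>k\<in>UNIV. lookup (N $ i $ k) g' * lookup (N $ k $ j) g) = (if g' = g then lookup (N $ i $ j) g else 0)" for i j
  proof -
    have "lookup (push_forward (\<lambda>m. (m, m)) p) (g', g) = (if g' = g then lookup p g else 0)" for p :: "'k laurent"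
    proof (induction p rule: poly_mapping_induct)
      case zero
      show ?case by (simp add: push_forward_def)
    qed (auto simp: push_forward_single push_forward_add lookup_single lookup_add when_def)
    from this[of "N $ i $ j"] show ?thesis
      using arg_cong[OF comult, of "\<lambda>A. lookup (A $ i $ j) (g', g)"]
      by (simp add: map_matrix_def matrix_matrix_mult_def lookup_sum lookup_pair)
  qed
  have "coord e (weight_comp g' (weight_comp g a)) $ i = coord e (lookup (single g (weight_comp g a)) g') $ i" for i
  proof -
    have "coord e (weight_comp g' (weight_comp g a)) $ i =
        (\<Sum>k\<in>UNIV. \<Sum>j\<in>UNIV. lookup (N $ i $ k) g' * lookup (N $ k $ j) g * coord e a $ j)"
      by (simp add: coord_comp[of "weight_comp g a" g'] coord_comp[of a g] sum_distrib_left mult.assoc)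
    also have "\<dots> = (\<Sum>j\<in>UNIV. \<Sum>k\<in>UNIV. lookup (N $ i $ k) g' * lookup (N $ k $ j) g * coord e a $ j)"
      by (rule sum.swap)
    also have "\<dots> = (\<Sum>j\<in>UNIV. (if g' = g then lookup (N $ i $ j) g else 0) * coord e a $ j)"
      by (simp add: NN flip: sum_distrib_right)
    finally show ?thesis
      by (auto simp: lookup_single when_def coord_comp coord_zero[OF basis])
  qed
  then have "coord e (weight_comp g' (weight_comp g a)) = coord e (lookup (single g (weight_comp g a)) g')"
    by (simp add: vec_eq_iff)
  then show "weight_comp g' (weight_comp g a) = lookup (single g (weight_comp g a)) g'"
    by (metis coord_expand[OF basis])
qed

text \<open>The counit, which sends all characters to 1, says that the coefficient matrices of N add
  up to the identity.\<close>

lemma comp_sum: "(\<Sum>g\<in>keys (coaction a). weight_comp g a) = a"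
proof -
  interpret u: rhom "push_forward (\<lambda>m. 0 :: weight) :: 'k laurent \<Rightarrow> 'k laurent"
    by (rule rhom_push_forward) auto
  interpret u': rhom "push_forward (\<lambda>m. 0 :: weight) :: (weight \<Rightarrow>\<^sub>0 'a) \<Rightarrow> (weight \<Rightarrow>\<^sub>0 'a)"
    by (rule rhom_push_forward) auto
  interpret s: rhom "single (0 :: weight) :: 'a \<Rightarrow> _" by (rule rhom_single)
  have emb: "push_forward (\<lambda>m. 0 :: weight) (embed p) = embed (push_forward (\<lambda>m. 0 :: weight) p)" for p
    unfolding embed_def by (rule push_forward_map) (simp_all add: rhom.zero[OF rhom_smul] rhom.add[OF rhom_smul])
  have "push_forward (\<lambda>m. 0 :: weight) (coaction a) =
      assemble (\<chi> k. push_forward (\<lambda>m. 0 :: weight) ((N *v hcoord e (single 0) a) $ k))"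
    by (simp add: coaction_def assemble_def u'.sum u'.mult emb push_forward_single)
  also have "(\<chi> k. push_forward (\<lambda>m. 0 :: weight) ((N *v hcoord e (single 0) a) $ k)) =
      map_matrix (push_forward (\<lambda>m. 0 :: weight)) N *v hcoord e (single 0) a"
    by (simp add: matrix_vector_mult_def map_matrix_def u.sum u.mult hcoord_def push_forward_single)
  also have "\<dots> = hcoord e (single 0) a"
    by (simp add: counit matrix_vector_mul_lid)
  finally have "push_forward (\<lambda>m. 0 :: weight) (coaction a) = single 0 a"
    by (simp add: assemble_hcoord)
  then have "single (0 :: weight) (\<Sum>g\<in>keys (coaction a). weight_comp g a) = single 0 a"
    by (simp add: push_forward_def s.sum)
  then show ?thesis by (metis lookup_single_eq)
qed

end

lemma order_ge_Suc:
  assumes "f \<in> order_ge d" "\<And>m. mdeg m = d \<Longrightarrow> lookup f m = 0"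
  shows "f \<in> order_ge (Suc d)"
  by (rule order_geI) (metis assms order_geD linorder_neqE_nat not_less_eq_eq not_le)

section \<open>Functionals of low degree on the algebra, and the weights on the cotangent
  space\<close>

context torus_action
begin

definition descend :: "(('n, 'k) mpoly \<Rightarrow> 'c) \<Rightarrow> 'a \<Rightarrow> 'c::ab_group_add"
  where "descend F a = F (SOME f. \<phi> f = a)"

lemma descend_phi:
  assumes "\<And>f g. F (f + g) = F f + F g" "\<And>f. \<phi> f = 0 \<Longrightarrow> F f = 0"
  shows "descend F (\<phi> f) = F f"
proof -
  have "\<phi> (SOME g. \<phi> g = \<phi> f) = \<phi> f" by (rule someI) simp
  then have "\<phi> ((SOME g. \<phi> g = \<phi> f) - f) = 0" by (simp add: phi.diff)
  then have "F ((SOME g. \<phi> g = \<phi> f) - f) = 0" by (rule assms(2))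
  then show ?thesis
    using assms(1)[of "(SOME g. \<phi> g = \<phi> f) - f" f] by (simp add: descend_def)
qed

text \<open>The constant term and the derivative at the origin in direction v; both pass to A
  because the kernel has order at least 2.\<close>

definition aug :: "'a \<Rightarrow> 'k" where "aug = descend (\<lambda>f. Polynomial.coeff (line_eval (\<lambda>_. 0) f) 0)"
definition ell :: "('n \<Rightarrow> 'k) \<Rightarrow> 'a \<Rightarrow> 'k" where "ell v = descend (\<lambda>f. Polynomial.coeff (line_eval v f) 1)"
definition tau :: "('n \<Rightarrow> 'k) \<Rightarrow> ('n \<Rightarrow> 'k) \<Rightarrow> 'a \<Rightarrow> 'k"
  where "tau v w = descend (\<lambda>f. Polynomial.coeff (line_eval v f) 2 * mp_eval id w q -
    Polynomial.coeff (line_eval w f) 2 * mp_eval id v q)"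

lemmas le_add = rhom.add[OF rhom_line_eval] and le_mult = rhom.mult[OF rhom_line_eval]

lemma aug_phi: "aug (\<phi> f) = Polynomial.coeff (line_eval v f) 0"
proof -
  have "aug (\<phi> f) = Polynomial.coeff (line_eval (\<lambda>_. 0) f) 0"
    unfolding aug_def by (rule descend_phi) (simp_all add: le_add coeff_line_eval_order[OF kernel_order])
  then show ?thesis by (simp add: coeff_line_eval_0)
qed

lemma ell_phi: "ell v (\<phi> f) = Polynomial.coeff (line_eval v f) 1"
  unfolding ell_def by (rule descend_phi) (simp_all add: le_add coeff_line_eval_order[OF kernel_order])

text \<open>The degree two part of the kernel is spanned by \<open>q\<close>, so this combination kills it.\<close>

lemma tau_phi: "tau v w (\<phi> f) = Polynomial.coeff (line_eval v f) 2 * mp_eval id w q -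
    Polynomial.coeff (line_eval w f) 2 * mp_eval id v q"
  unfolding tau_def
proof (rule descend_phi)
  fix f assume "\<phi> f = 0"
  then obtain a r where a: "a \<in> order_ge l" "f = a + r * q" by (rule phi_eq_0E)
  have "Polynomial.coeff (line_eval v f) 2 = lookup r 0 * mp_eval id v q" for v
    using coeff_line_eval_order[OF a(1) l_gt, of v]
    by (simp add: a(2) le_add le_mult line_eval_quadratic[OF quad] coeff_line_eval_0[symmetric, of _ v]
        coeff_mult numeral_2_eq_2)
  then show "Polynomial.coeff (line_eval v f) 2 * mp_eval id w q -
      Polynomial.coeff (line_eval w f) 2 * mp_eval id v q = 0" by simp
qed (simp add: le_add algebra_simps)

lemma rhom_aug: "rhom aug"
proof
  fix a b
  obtain f g where fg: "a = \<phi> f" "b = \<phi> g" using phi_ex by metis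
  show "aug (a + b) = aug a + aug b"
    by (simp only: fg phi.add[symmetric] aug_phi[of _ "\<lambda>_. 0"] le_add coeff_add)
  show "aug (a * b) = aug a * aug b"
    by (simp only: fg phi.mult[symmetric] aug_phi[of _ "\<lambda>_. 0"] le_mult coeff_mult_0)
next
  show "aug 1 = 1"
    using aug_phi[of 1 "\<lambda>_. 0"] by (simp add: phi.one rhom.one[OF rhom_line_eval])
qed

lemma ell_add: "ell v (a + b) = ell v a + ell v b"
proof -
  obtain f g where fg: "a = \<phi> f" "b = \<phi> g" using phi_ex by metis
  show ?thesis by (simp only: fg phi.add[symmetric] ell_phi le_add coeff_add)
qed

lemma tau_add: "tau v w (a + b) = tau v w a + tau v w b"
proof -
  obtain f g where fg: "a = \<phi> f" "b = \<phi> g" using phi_ex by metis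
  show ?thesis unfolding fg phi.add[symmetric] tau_phi le_add coeff_add by (simp add: algebra_simps)
qed

lemma line_eval_smul: "line_eval v (mp_const k * f) = Polynomial.smult k (line_eval v f)"
proof -
  have "line_eval v (mp_const k) = [:k:]" by (simp add: line_eval_def rhom.eval_const[OF rhom_pconst])
  then show ?thesis by (simp add: le_mult)
qed

lemma ell_smul: "ell v (smul k a) = k * ell v a"
proof -
  obtain f where f: "a = \<phi> f" using phi_ex by metis
  show ?thesis unfolding f phi_scale[symmetric] ell_phi line_eval_smul by simp
qed

lemma tau_smul: "tau v w (smul k a) = k * tau v w a"
proof -
  obtain f where f: "a = \<phi> f" using phi_ex by metis
  show ?thesis unfolding f phi_scale[symmetric] tau_phi line_eval_smul by (simp add: algebra_simps)
qed

lemma ell_zero: "ell v 0 = 0"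
  using ell_smul[of v 0 0] by simp

lemma tau_zero: "tau v w 0 = 0"
  using tau_smul[of v w 0 0] by simp

lemma ell_tau_mult:
  assumes "aug a = 0" "aug b = 0"
  shows "ell v (a * b) = 0"
    "tau v w (a * b) = ell v a * ell v b * mp_eval id w q - ell w a * ell w b * mp_eval id v q"
proof -
  obtain f g where fg: "a = \<phi> f" "b = \<phi> g" using phi_ex by metis
  have 0: "Polynomial.coeff (line_eval v f) 0 = 0" "Polynomial.coeff (line_eval v g) 0 = 0" for v
    using assms unfolding fg by (simp_all flip: aug_phi)
  show "ell v (a * b) = 0"
    unfolding fg phi.mult[symmetric] ell_phi le_mult by (rule coeff_mult_low[OF 0])
  show "tau v w (a * b) = ell v a * ell v b * mp_eval id w q - ell w a * ell w b * mp_eval id v q"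
    unfolding fg phi.mult[symmetric] tau_phi ell_phi le_mult coeff_mult_low(2)[OF 0] ..
qed

abbreviation "x i \<equiv> \<phi> (mp_var i)"

lemma aug_x: "aug (x i) = 0"
  using coeff_line_eval_order[OF var_in_order_ge, of 0] by (simp add: aug_phi[of _ "\<lambda>_. 0"])

lemma ell_x: "ell v (x i) = v i"
  by (simp only: ell_phi line_eval_linear)

lemma augE:
  assumes "aug a = 0"
  obtains f where "a = \<phi> f" "f \<in> order_ge 1"
proof -
  obtain f where f: "a = \<phi> f" using phi_ex by metis
  have f0: "lookup f 0 = 0"
    using assms by (simp add: f aug_phi[of f "\<lambda>_. 0"] coeff_line_eval_0)
  then have "f \<in> order_ge (Suc 0)"
    by (intro order_ge_Suc) (auto simp: mdeg_eq_0)
  with f that show ?thesis by simp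
qed

text \<open>An element of the maximal ideal is nilpotent, so its coaction becomes nilpotent in k[T]
  after \<open>aug\<close>; k[T] is a domain.\<close>

lemma aug_weight_comp:
  assumes "aug a = 0"
  shows "aug (weight_comp g a) = 0"
proof -
  interpret m: rhom "map_coeffs aug :: (weight \<Rightarrow>\<^sub>0 'a) \<Rightarrow> 'k laurent"
    by (rule rhom.rhom_map[OF rhom_aug])
  obtain f where f: "a = \<phi> f" "f \<in> order_ge 1" using assms by (rule augE)
  have "f ^ l \<in> order_ge l" using power_in_order_ge[OF f(2), of l] by simp
  then have "a ^ l = 0" by (simp add: f(1) phi_order_ge flip: phi.power)
  then have "map_coeffs aug (coaction a) ^ l = 0"
    by (simp add: coact.zero m.zero flip: coact.power m.power)
  then have "map_coeffs aug (coaction a) = 0" by simp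
  then have "lookup (map_coeffs aug (coaction a)) g = 0" by simp
  then show ?thesis by (simp add: lookup_map rhom.zero[OF rhom_aug])
qed

lemma coaction_smul: "coaction (smul k a) = single 0 (smul k 1) * coaction a"
proof -
  have "embed (single 0 k) = single 0 (smul k 1)"
    by (simp add: embed_def rhom.zero[OF rhom_smul])
  then show ?thesis
    by (simp add: coaction_def hcoord_smul[OF basis rhom_single] mult_vec_scale assemble_def
        rhom.mult[OF rhom_embed] sum_distrib_left mult.assoc)
qed

lemma ell_coaction_mult:
  assumes "aug a = 0" "aug b = 0"
  shows "ell v (weight_comp g (a * b)) = 0"
proof -
  have "map_coeffs (ell v) (coaction (a * b)) = 0"
    unfolding coact.mult map_mult_expand[of "ell v", OF ell_add]
    by (simp add: ell_tau_mult(1) aug_weight_comp[OF assms(1)] aug_weight_comp[OF assms(2)])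
  then have "lookup (map_coeffs (ell v) (coaction (a * b))) g = 0" by simp
  then show ?thesis by (simp add: lookup_map ell_zero)
qed

text \<open>The composite of a weight projection with a derivation at the origin kills products of
  elements of the maximal ideal, so it is again a derivation, whose direction is given by its values
  on the variables.\<close>

lemma ell_weight_comp:
  assumes "aug a = 0"
  shows "ell v (weight_comp g a) = ell (\<lambda>i. ell v (weight_comp g (x i))) a"
proof -
  let ?w = "\<lambda>i. ell v (weight_comp g (x i))"
  obtain f where f: "a = \<phi> f" "f \<in> order_ge 1" using assms by (rule augE)
  have "ell v (weight_comp g (\<phi> f)) = ell ?w (\<phi> f)" using f(2)
  proof (induction rule: order_ge_induct)
    case zero
    show ?case by (simp add: phi.zero coact.zero ell_zero)
  next
    case (add f g)
    then show ?case by (simp add: phi.add coact.add lookup_add ell_add)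
  next
    case (single m k)
    then have "Suc 0 \<le> mdeg m" by simp
    then obtain i m' where m: "single m k = mp_var i * single m' k" "m = single i 1 + m'"
      by (rule single_factor_var)
    show ?case
    proof (cases "m' = 0")
      case True
      have "\<phi> (single m k) = smul k (x i)"
        unfolding m(1) True using phi_scale[of k "mp_var i"] by (simp add: mp_const_def mult.commute)
      then show ?thesis
        by (simp add: coaction_smul lookup_single_zero_mult ell_smul ell_x flip: smul_eq)
    next
      case False
      then have "mdeg m' \<noteq> 0" by (simp add: mdeg_eq_0)
      then have "aug (\<phi> (single m' k)) = 0"
        by (simp add: aug_phi[of _ "\<lambda>_. 0"] coeff_line_eval_order[OF single_in_order_ge[of 1]])
      then show ?thesis
        unfolding m(1) phi.mult using ell_coaction_mult[OF aug_x] ell_tau_mult(1)[OF aug_x] by simp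
    qed
  qed
  then show ?thesis by (simp add: f(1))
qed

text \<open>An eigenvector in the tangent space dual to the span of the variables, where q is a
  function: the coaction followed by the derivation \<open>ell v\<close> is \<open>ell v\<close>
  times the character g.\<close>

definition weight_vector :: "weight \<Rightarrow> ('n \<Rightarrow> 'k) \<Rightarrow> bool"
  where "weight_vector g v \<longleftrightarrow> v \<noteq> (\<lambda>_. 0) \<and>
    (\<forall>i. map_coeffs (ell v) (coaction (x i)) = single g (v i))"

lemma weight_vectorI:
  assumes "v' = (\<lambda>i. ell v (weight_comp g (x i)))" "v' \<noteq> (\<lambda>_. 0)"
  shows "weight_vector g v'"
  unfolding weight_vector_def
proof (intro conjI allI poly_mapping_eqI)
  fix i g'
  have "ell v' (weight_comp g' (x i)) = ell v (weight_comp g (weight_comp g' (x i)))"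
    unfolding assms(1) by (rule ell_weight_comp[symmetric, OF aug_weight_comp[OF aug_x]])
  then show "lookup (map_coeffs (ell v') (coaction (x i))) g' = lookup (single g (v' i)) g'"
    by (auto simp: lookup_map ell_zero coaction_comp lookup_single when_def assms(1))
qed (rule assms(2))

lemma quad_relation:
  assumes Q: "q = quad_poly Q"
  shows "(\<Sum>a\<in>UNIV. \<Sum>b\<in>UNIV. smul (Q $ a $ b) (x a * x b)) = 0"
  using phi_q unfolding Q quad_poly_def phi.sum phi_scale unfolding phi.mult .

lemma mp_eval_quad: "mp_eval id v (quad_poly Q) = (\<Sum>a\<in>UNIV. \<Sum>b\<in>UNIV. Q $ a $ b * (v a * v b))"
  by (simp add: eval_quad_poly dotp_def matrix_vector_mult_def sum_distrib_left ac_simps)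

text \<open>The action preserves \<open>q\<close> up to a character, and \<open>q\<close> does not vanish on the weight vectors.\<close>

lemma weight_unique:
  assumes v: "weight_vector g v" and w: "weight_vector h w"
  shows "g = h"
proof -
  obtain Q where Q: "q = quad_poly Q" using quadratic_form_matrix[OF quad two] by metis
  let ?qv = "mp_eval id v q" and ?qw = "mp_eval id w q"
  have nz: "?qv \<noteq> 0" "?qw \<noteq> 0" using v w aniso by (auto simp: weight_vector_def)
  have map: "map_coeffs (tau v w) (sum f S) = (\<Sum>i\<in>S. map_coeffs (tau v w) (f i))"
    for f :: "'n \<Rightarrow> weight \<Rightarrow>\<^sub>0 'a" and S
    by (induction S rule: infinite_finite_induct)
      (simp_all add: map_add tau_add tau_zero, simp_all add: tau_zero poly_mapping_eqI lookup_map)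
  have prod: "map_coeffs (tau v w) (coaction (x a) * coaction (x b)) =
      single 0 ?qw * (single g (v a) * single g (v b)) - single 0 ?qv * (single h (w a) * single h (w b))" for a b
  proof -
    let ?P = "coaction (x a)" and ?R = "coaction (x b)"
    have e: "single g (v a) = (\<Sum>m\<in>keys ?P. single m (ell v (lookup ?P m)))"
      "single g (v b) = (\<Sum>m\<in>keys ?R. single m (ell v (lookup ?R m)))"
      "single h (w a) = (\<Sum>m\<in>keys ?P. single m (ell w (lookup ?P m)))"
      "single h (w b) = (\<Sum>m\<in>keys ?R. single m (ell w (lookup ?R m)))"
      using v w by (simp_all add: weight_vector_def flip: map_sum_singles[of "ell _", OF ell_zero])
    have "map_coeffs (tau v w) (?P * ?R) = (\<Sum>m\<in>keys ?P. \<Sum>n\<in>keys ?R.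
        single 0 ?qw * (single m (ell v (lookup ?P m)) * single n (ell v (lookup ?R n))) -
        single 0 ?qv * (single m (ell w (lookup ?P m)) * single n (ell w (lookup ?R n))))"
      unfolding map_mult_expand[of "tau v w", OF tau_add]
      by (intro sum.cong refl)
        (simp add: ell_tau_mult(2)[OF aug_weight_comp[OF aug_x] aug_weight_comp[OF aug_x]] mult_single
          single_diff mult.commute)
    also have "\<dots> = single 0 ?qw * (single g (v a) * single g (v b)) - single 0 ?qv * (single h (w a) * single h (w b))"
      unfolding e sum_product by (simp add: sum_subtractf sum_distrib_left)
    finally show ?thesis .
  qed
  have scal: "map_coeffs (tau v w) (single 0 (smul k 1) * P) = single 0 k * map_coeffs (tau v w) P" for k P
    by (rule poly_mapping_eqI)
      (simp add: lookup_map tau_zero lookup_single_zero_mult tau_smul flip: smul_eq)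
  \<comment> \<open>Apply the coaction and then \<open>tau\<close> to the relation q = 0 in A. What
    remains is q(v) q(w) times the difference of the characters g + g and h + h; weights can be
    halved since they have integer exponents.\<close>
  have "0 = map_coeffs (tau v w) (coaction (\<Sum>a\<in>UNIV. \<Sum>b\<in>UNIV. smul (Q $ a $ b) (x a * x b)))"
    unfolding quad_relation[OF Q] coact.zero by (simp add: poly_mapping_eqI lookup_map tau_zero)
  also have "\<dots> = (\<Sum>a\<in>UNIV. \<Sum>b\<in>UNIV. single 0 (Q $ a $ b) *
      (single 0 ?qw * (single g (v a) * single g (v b)) - single 0 ?qv * (single h (w a) * single h (w b))))"
    by (simp add: coact.sum coaction_smul coact.mult map scal prod)
  also have "\<dots> = single (g + g) (?qw * ?qv) - single (h + h) (?qv * ?qw)"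
  proof -
    interpret s: rhom "single (0 :: weight) :: 'k \<Rightarrow> _" by (rule rhom_single)
    have sum_single: "(\<Sum>i\<in>S. single m (f i)) = single m (\<Sum>i\<in>S. f i)"
      for m :: "weight" and f :: "'n \<Rightarrow> 'k" and S
      by (induction S rule: infinite_finite_induct) (simp_all add: single_add)
    have "single 0 (Q $ a $ b) * (single 0 ?qw * (single g (v a) * single g (v b)) - single 0 ?qv * (single h (w a) * single h (w b)))
        = single (g + g) (?qw * (Q $ a $ b * (v a * v b))) - single (h + h) (?qv * (Q $ a $ b * (w a * w b)))" for a b
      by (simp add: right_diff_distrib mult_single ac_simps)
    then show ?thesis
      by (simp add: sum_subtractf sum_single flip: sum_distrib_left mp_eval_quad Q)
  qed
  finally have eq: "single (g + g) (?qw * ?qv) = single (h + h) (?qv * ?qw)" by simp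
  have gh: "g + g = h + h"
  proof (rule ccontr)
    assume "g + g \<noteq> h + h"
    then have "lookup (single (g + g) (?qw * ?qv)) (g + g) = 0"
      unfolding eq by (simp add: lookup_single)
    then show False using nz by simp
  qed
  show ?thesis
  proof (rule poly_mapping_eqI)
    fix k
    have "lookup g k + lookup g k = lookup h k + lookup h k"
      unfolding lookup_add[symmetric] gh ..
    then show "lookup g k = lookup h k" by simp
  qed
qed

text \<open>The weights of one variable yield some weight vector, and \<psi> is its weight. By
  \<open>weight_unique\<close> the other components of every variable have no linear part, so the
  \<psi>-component carries all of it.\<close>

lemma character_exists: "\<exists>\<psi>. \<forall>i. \<exists>r\<in>order_ge 2. weight_comp \<psi> (x i) = x i + \<phi> r"
proof -
  have ex: "\<exists>g. ell v (weight_comp g a) \<noteq> 0" if "ell v a \<noteq> 0" for v a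
  proof (rule ccontr)
    assume "\<not> ?thesis"
    moreover have "ell v (\<Sum>g\<in>S. weight_comp g a) = (\<Sum>g\<in>S. ell v (weight_comp g a))" for S
      by (induction S rule: infinite_finite_induct) (simp_all add: ell_zero ell_add)
    ultimately have "ell v (\<Sum>g\<in>keys (coaction a). weight_comp g a) = 0" by simp
    with that show False by (simp add: comp_sum)
  qed
  obtain i0 :: 'n where True by simp
  have "ell (\<lambda>i. if i = i0 then 1 else 0) (x i0) \<noteq> 0" by (simp add: ell_x)
  from ex[OF this] obtain \<psi> where \<psi>: "ell (\<lambda>i. if i = i0 then 1 else 0) (weight_comp \<psi> (x i0)) \<noteq> 0" by blast
  then have wv: "weight_vector \<psi> (\<lambda>i. ell (\<lambda>i. if i = i0 then 1 else 0) (weight_comp \<psi> (x i)))"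
    by (intro weight_vectorI[OF refl]) metis
  have other: "ell v (weight_comp g (x i)) = 0" if "g \<noteq> \<psi>" for v g i
  proof (rule ccontr)
    assume "ell v (weight_comp g (x i)) \<noteq> 0"
    then have "weight_vector g (\<lambda>i. ell v (weight_comp g (x i)))"
      by (intro weight_vectorI[OF refl]) metis
    from weight_unique[OF this wv] that show False by simp
  qed
  have "\<exists>r\<in>order_ge 2. weight_comp \<psi> (x i) = x i + \<phi> r" for i
  proof -
    let ?y = "weight_comp \<psi> (x i)"
    \<comment> \<open>A nonzero linear part would be visible in some weight component; that of
      weight \<psi> is 0, and the others are components of - x i.\<close>
    have z: "ell v (?y - x i) = 0" for v
    proof (rule ccontr)
      assume "ell v (?y - x i) \<noteq> 0"
      from ex[OF this] obtain g where g: "ell v (weight_comp g (?y - x i)) \<noteq> 0" by blast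
      have "weight_comp g (?y - x i) = (if g = \<psi> then 0 else - weight_comp g (x i))"
        by (simp add: coact.diff lookup_minus coaction_comp lookup_single when_def)
      moreover have "ell v (- a) = - ell v a" for a
        using ell_add[of v "- a" a] by (simp add: ell_zero add_eq_0_iff)
      ultimately show False using g other[of g v i] by (auto simp: ell_zero split: if_splits)
    qed
    have "aug (?y - x i) = 0"
      by (simp add: rhom.diff[OF rhom_aug] aug_x aug_weight_comp[OF aug_x])
    then obtain r where r: "?y - x i = \<phi> r" "r \<in> order_ge 1" by (rule augE)
    have "lookup r (single j 1) = 0" for j
      using z[of "\<lambda>i. if i = j then 1 else 0"] unfolding r(1) ell_phi coeff_line_eval_1 .
    then have "lookup r m = 0" if "mdeg m = 1" for m
      using that by (metis mdeg_1)
    then have "r \<in> order_ge (Suc 1)"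
      by (intro order_ge_Suc r(2)) simp
    then show ?thesis
      using r(1) by (intro bexI[of _ r]) (simp_all add: algebra_simps numeral_2_eq_2)
  qed
  then show ?thesis by blast
qed

end

text \<open>By induction on the degree of a monomial: split off one variable and telescope the
  difference of the two products.\<close>

lemma perturb_variables:
  fixes S :: "('n, 'k::comm_ring_1) mpoly \<Rightarrow> ('n, 'k) mpoly"
  assumes S: "rhom S" and const: "\<And>c. S (mp_const c) = mp_const c"
    and var: "\<And>i. S (mp_var i) - mp_var i \<in> order_ge 2"
  shows "f \<in> order_ge d \<Longrightarrow> S f - f \<in> order_ge (Suc d)" "f \<in> order_ge d \<Longrightarrow> S f \<in> order_ge d"
proof -
  interpret S: rhom S by (rule S)
  have mono: "S (single m c) - single m c \<in> order_ge (Suc (mdeg m))" for m and c :: 'k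
  proof (induction "mdeg m" arbitrary: m)
    case 0
    then have "m = 0" by (simp add: mdeg_eq_0)
    then show ?case using const[of c] by (simp add: mp_const_def)
  next
    case (Suc k)
    then have "Suc k \<le> mdeg m" by simp
    then obtain i m' where m: "single m c = mp_var i * single m' c" "m = single i 1 + m'"
      by (rule single_factor_var)
    then have m': "mdeg m' = k" using Suc(2) by (simp add: mdeg_add)
    let ?D = "S (single m' c) - single m' c"
    have D: "?D \<in> order_ge (Suc k)" using Suc(1)[of m'] m' by simp
    have "S (single m' c) \<in> order_ge k"
      using add_in_order_ge[OF subsetD[OF order_ge_mono D], of k "single m' c"] m'
      by (simp add: single_in_order_ge)
    then have "(S (mp_var i) - mp_var i) * S (single m' c) \<in> order_ge (2 + k)"
      by (rule mult_in_order_ge[OF var])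
    moreover have "mp_var i * ?D \<in> order_ge (1 + Suc k)"
      by (rule mult_in_order_ge[OF var_in_order_ge D])
    moreover have "S (single m c) - single m c = (S (mp_var i) - mp_var i) * S (single m' c) + mp_var i * ?D"
      by (simp add: m(1) S.mult algebra_simps)
    ultimately show ?case
      using Suc(2) by (simp add: add_in_order_ge)
  qed
  show 1: "S f - f \<in> order_ge (Suc d)" if "f \<in> order_ge d" for f d
    using that
  proof (induction rule: order_ge_induct)
    case (single m c)
    then show ?case using mono[of m c] order_ge_mono[of "Suc d" "Suc (mdeg m)"] by auto
  next
    case (add f g)
    have eq: "S (f + g) - (f + g) = (S f - f) + (S g - g)" by (simp add: S.add)
    show ?case unfolding eq by (intro add_in_order_ge add)
  qed (simp add: S.zero)
  show "S f \<in> order_ge d" if "f \<in> order_ge d" for f d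
  proof -
    have "(S f - f) + f \<in> order_ge d"
      using 1[OF that] order_ge_mono[of d "Suc d"] that by (intro add_in_order_ge) auto
    then show ?thesis by simp
  qed
qed

context torus_action
begin

text \<open>The new variables are the \<psi>-components y i of the old ones, so monomials of degree
  n have weight n \<psi>. The substitution S expresses the y i as polynomials; the work is to show
  that the kernel stays the same.\<close>

lemma scaling_presentation:
  obtains \<phi>' \<psi> where "presentation smul e \<phi>' q l" "presentation.scaling_matrix smul e \<phi>' \<psi> N"
proof -
  obtain \<psi> where "\<forall>i. \<exists>r\<in>order_ge 2. weight_comp \<psi> (x i) = x i + \<phi> r"
    using character_exists by blast
  then obtain R where R: "\<And>i. R i \<in> order_ge 2" "\<And>i. weight_comp \<psi> (x i) = x i + \<phi> (R i)"
    by metis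
  define y where "y i = weight_comp \<psi> (x i)" for i
  define S where "S = mp_eval mp_const (\<lambda>i. mp_var i + R i)"
  define \<phi>' where "\<phi>' f = \<phi> (S f)" for f
  interpret c: rhom "mp_const :: 'k \<Rightarrow> ('n, 'k) mpoly" by (rule rhom_mp_const)
  have rhom_S: "rhom S" unfolding S_def by (rule rhom_mp_eval[OF rhom_mp_const])
  interpret S: rhom S by (rule rhom_S)
  have Sconst: "S (mp_const k) = mp_const k" for k by (simp add: S_def c.eval_const)
  have Svar: "S (mp_var i) - mp_var i \<in> order_ge 2" for i by (simp add: S_def c.eval_var R(1))
  note pert = perturb_variables[OF rhom_S Sconst Svar]
  have rhom': "rhom \<phi>'" unfolding \<phi>'_def by (rule rhom_comp[OF rhom_S phi_rhom])
  interpret p': rhom \<phi>' by (rule rhom')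
  have scale': "\<phi>' (mp_const k * f) = smul k (\<phi>' f)" for k f
    by (simp add: \<phi>'_def S.mult Sconst phi_scale)
  have single': "\<phi>' (single m k) = smul k (\<phi>' (single m 1))" for m k
    using scale'[of k "single m 1"] by (simp add: mult_const_single)
  have var': "\<phi>' (mp_var i) = y i" for i
    by (simp add: \<phi>'_def S_def c.eval_var phi.add y_def R(2))
  have co_const: "coaction (smul k 1) = single 0 (smul k 1)" for k
    using coaction_smul[of k 1] by (simp add: coact.one)
  have co_mono: "coaction (\<phi>' (single m k)) = single (\<Sum>j<mdeg m. \<psi>) (\<phi>' (single m k))" for m k
  proof (induction "mdeg m" arbitrary: m)
    case 0
    then have "m = 0" by (simp add: mdeg_eq_0)
    moreover have "\<phi>' (single 0 k) = smul k 1"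
      using scale'[of k 1] by (simp add: mp_const_def p'.one)
    ultimately show ?case by (simp add: co_const)
  next
    case (Suc j)
    then have "Suc j \<le> mdeg m" by simp
    then obtain i m' where m: "single m k = mp_var i * single m' k" "m = single i 1 + m'"
      by (rule single_factor_var)
    then have m': "j = mdeg m'" using Suc(2) by (simp add: mdeg_add)
    have "coaction (y i) = single \<psi> (y i)" unfolding y_def by (rule coaction_comp)
    then show ?case
      using Suc(1)[OF m'] m' Suc(2)[symmetric]
      by (simp add: m(1) p'.mult coact.mult var' mult_single distrib_right)
  qed
  \<comment> \<open>Descending induction on the order, starting at l where \<phi> is 0: f and S f
    differ in higher order only. The bound on the order of g is used for q below.\<close>
  have reach: "\<exists>g\<in>order_ge (l - j). \<phi> f = \<phi>' g" if "f \<in> order_ge (l - j)" "j \<le> l" for f j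
    using that
  proof (induction j arbitrary: f)
    case 0
    then show ?case by (intro bexI[of _ 0]) (simp_all add: phi_order_ge p'.zero)
  next
    case (Suc j)
    have l: "Suc (l - Suc j) = l - j" using Suc(3) by simp
    have "S f - f \<in> order_ge (l - j)" using pert(1)[OF Suc(2)] l by simp
    then obtain g where g: "g \<in> order_ge (l - j)" "\<phi> (S f - f) = \<phi>' g"
      using Suc(1) Suc(3) by (meson Suc_leD)
    have "\<phi> f = \<phi>' (f - g)"
      using g(2) by (simp add: S.diff phi.diff \<phi>'_def algebra_simps)
    moreover have "f - g \<in> order_ge (l - Suc j)"
      using Suc(2) subsetD[OF order_ge_mono g(1), of "l - Suc j"] by (intro diff_in_order_ge) auto
    ultimately show ?case by blast
  qed
  have surj': "surj \<phi>'"
  proof (rule surjI)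
    show "\<phi>' (SOME g. a = \<phi>' g) = a" for a
    proof -
      obtain f where "a = \<phi> f" using phi_ex by metis
      with reach[of f l] have "\<exists>g. a = \<phi>' g" by auto
      then show ?thesis by (metis (mono_tags, lifting) someI_ex)
    qed
  qed
  have order': "\<phi>' f = 0" if "f \<in> order_ge l" for f
    unfolding \<phi>'_def by (rule phi_order_ge[OF pert(2)[OF that]])
  \<comment> \<open>For \<psi> = 0 the torus acts trivially and the variables are unchanged.
    Otherwise l - (l - 3) = 3, so \<phi>' q is the image of some g of order at least 3, which has no
    component of weight 2 \<psi>; but \<phi>' q is homogeneous of that weight.\<close>
  have q': "\<phi>' q = 0"
  proof (cases "\<psi> = 0")
    case True
    have "coaction (\<phi>' f) = single 0 (\<phi>' f)" for f
      by (induction f rule: poly_mapping_induct)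
        (simp_all add: co_mono True p'.zero coact.zero p'.add coact.add single_add)
    then have yx: "y i = x i" for i
      unfolding y_def using surj' by (metis True lookup_single_eq surjD)
    have "\<phi>' f = \<phi> f" for f
      by (rule rhom_mpoly_eqI[OF rhom' phi_rhom])
        (simp_all add: var' yx scale'[of _ 1, simplified] p'.one phi_const)
    then show ?thesis by (simp add: phi_q)
  next
    case False
    have "S q - q \<in> order_ge (l - (l - 3))"
      using pert(1)[OF q_order] l_gt by (simp add: numeral_3_eq_3 numeral_2_eq_2)
    then obtain g where g: "g \<in> order_ge (l - (l - 3))" "\<phi> (S q - q) = \<phi>' g"
      using reach[of "S q - q" "l - 3"] by auto
    have g3: "g \<in> order_ge 3" using g(1) l_gt by simp
    have eq: "\<phi>' q = \<phi>' g" using g(2) by (simp add: phi.diff phi_q \<phi>'_def)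
    have ne: "(\<Sum>j<n. \<psi>) \<noteq> \<psi> + \<psi>" if "3 \<le> n" for n :: nat
    proof
      assume h: "(\<Sum>j<n. \<psi>) = \<psi> + \<psi>"
      obtain k where k: "lookup \<psi> k \<noteq> 0" using False by (metis lookup_zero poly_mapping_eqI)
      have "int n * lookup \<psi> k = lookup \<psi> k + lookup \<psi> k"
        using arg_cong[OF h, of "\<lambda>p. lookup p k"]
        unfolding lookup_sum lookup_add by simp
      with k that show False by simp
    qed
    have "weight_comp (\<psi> + \<psi>) (\<phi>' g) = 0" using g3
    proof (induction rule: order_ge_induct)
      case zero
      show ?case by (simp add: p'.zero coact.zero)
    next
      case (single m k)
      show ?case
        unfolding co_mono lookup_single using ne[OF single] by (simp add: when_def del: sum_constant)
    next
      case (add f g)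
      then show ?case by (simp add: p'.add coact.add lookup_add)
    qed
    moreover have "coaction (\<phi>' q) = single (\<psi> + \<psi>) (\<phi>' q)"
    proof -
      have "coaction (\<phi>' (\<Sum>m\<in>keys q. single m (lookup q m))) =
          single (\<psi> + \<psi>) (\<phi>' (\<Sum>m\<in>keys q. single m (lookup q m)))"
      proof -
        have "mdeg m = 2" if "m \<in> keys q" for m
          using quad that by (simp add: quadratic_form_def mdeg_def)
        then have co: "coaction (\<phi>' (single m (lookup q m))) = single (\<psi> + \<psi>) (\<phi>' (single m (lookup q m)))" if "m \<in> keys q" for m
          using that by (simp add: co_mono numeral_2_eq_2)
        have "coaction (\<phi>' (\<Sum>m\<in>A. single m (lookup q m))) = single (\<psi> + \<psi>) (\<phi>' (\<Sum>m\<in>A. single m (lookup q m)))"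
          if "A \<subseteq> keys q" for A
          using that by (induction A rule: infinite_finite_induct)
            (simp_all add: p'.zero coact.zero p'.add coact.add co single_add)
        then show ?thesis by simp
      qed
      then show ?thesis by (simp flip: poly_mapping_sum_singles)
    qed
    ultimately show ?thesis by (simp add: eq)
  qed
  have sub: "\<phi>' f = 0" if f: "\<phi> f = 0" for f
  proof -
    obtain a r where "a \<in> order_ge l" "f = a + r * q" using f by (rule phi_eq_0E)
    then show ?thesis by (simp add: p'.add p'.mult order' q')
  qed
  have ker': "\<phi>' f = 0 \<longleftrightarrow> \<phi> f = 0" for f
  proof
    assume f: "\<phi>' f = 0"
    \<comment> \<open>\<phi>' kills the kernel of \<phi> and so induces an endomorphism of A. It is
      surjective, hence injective by finite dimension, and the kernels agree.\<close>
    define \<Theta> where "\<Theta> = descend \<phi>'"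
    have \<Theta>: "\<Theta> (\<phi> f) = \<phi>' f" for f
      unfolding \<Theta>_def by (rule descend_phi) (simp_all add: p'.add sub)
    interpret fd: finite_dimensional_vector_space smul "range e"
      by standard (use basis in \<open>auto simp: is_basis_def\<close>)
    have lin: "Vector_Spaces.linear smul smul \<Theta>"
    proof (unfold Vector_Spaces.linear_iff, intro conjI allI)
      show "vector_space smul" by (rule vector_space_axioms)
      then show "vector_space smul" .
      fix a b k
      obtain f g where fg: "a = \<phi> f" "b = \<phi> g" using phi_ex by metis
      show "\<Theta> (a + b) = \<Theta> a + \<Theta> b" by (simp add: fg \<Theta> p'.add flip: phi.add)
      show "\<Theta> (smul k a) = smul k (\<Theta> a)" by (simp add: fg \<Theta> scale' flip: phi_scale)
    qed
    have "surj \<Theta>"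
      using surj' unfolding surj_def by (metis \<Theta>)
    then have "inj \<Theta>"
      by (rule fd.linear_surj_imp_inj[OF lin])
    moreover have "\<Theta> (\<phi> f) = \<Theta> 0"
      using f \<Theta>[of 0] by (simp add: \<Theta> phi.zero p'.zero)
    ultimately show "\<phi> f = 0" by (meson injD)
  qed (rule sub)
  have pres: "presentation smul e \<phi>' q l"
  proof
    show "algebra_hom mp_scale smul \<phi>'"
      using hom unfolding algebra_hom_def Vector_Spaces.linear_iff
      by (simp add: p'.add p'.mult p'.one scale'[folded mp_scale_def])
    show "{f. \<phi>' f = 0} = {f + g | f g. f \<in> order_ge l \<and> g \<in> ideal_gen {q}}"
      unfolding ker' by (rule ker)
  qed (rule basis, rule surj')
  moreover have "presentation.scaling_matrix smul e \<phi>' \<psi> N"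
    unfolding presentation.scaling_matrix_def[OF pres]
  proof (intro allI)
    fix m
    let ?a = "\<phi>' (single m 1)" and ?g = "\<Sum>j<mdeg m. \<psi>"
    have "lookup ((N *v hcoord e (single 0) ?a) $ k) g = lookup (single ?g (coord e ?a $ k)) g" for k g
      using lookup_assemble[of "N *v hcoord e (single 0) ?a" g k]
      unfolding coaction_def[symmetric] co_mono
      by (auto simp: lookup_single when_def coord_zero[OF basis])
    then have "(N *v hcoord e (single 0) ?a) $ k = single ?g (coord e ?a $ k)" for k
      by (intro poly_mapping_eqI)
    then show "N *v hcoord e (single 0) ?a = single ?g 1 *s hcoord e (single 0) ?a"
      by (simp add: vec_eq_iff hcoord_def mult_single)
  qed
  ultimately show ?thesis by (rule that)
qed

end

section \<open>The main theorem\<close>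

lemma subgroup_multiple:
  fixes S :: "weight set"
  assumes S: "0 \<in> S" "\<And>a b. a \<in> S \<Longrightarrow> b \<in> S \<Longrightarrow> a + b \<in> S" "\<And>a. a \<in> S \<Longrightarrow> - a \<in> S"
    and i: "single i 1 \<in> S"
  shows "single i n \<in> S"
proof -
  have nat: "single i (int k) \<in> S" for k
  proof (induction k)
    case (Suc k)
    have "single i (int (Suc k)) = single i (int k) + single i 1"
      by (simp add: add.commute flip: single_add)
    then show ?case using S(2)[OF Suc i] by simp
  qed (simp add: S(1))
  have "single i (- int k) \<in> S" for k
    using S(3)[OF nat[of k]] by (simp add: single_uminus)
  then show ?thesis
    using nat by (cases n rule: int_cases2) auto
qed

lemma two_variable_exponent:
  assumes "keys (m :: weight) \<subseteq> {..<2}"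
  shows "m = single 0 (lookup m 0) + single 1 (lookup m 1)"
proof (rule poly_mapping_eqI)
  fix k
  have "lookup m k = 0" if "2 \<le> k"
    using assms that by (auto simp: in_keys_iff subset_iff not_less)
  then show "lookup m k = lookup (single 0 (lookup m 0) + single 1 (lookup m 1)) k"
    by (cases "k < 2") (auto simp: lookup_add lookup_single when_def less_2_cases_iff)
qed

text \<open>If the plane is everything (\<open>b\<close>), its two weights form a basis of the character lattice.
  Otherwise \<open>\<gamma>\<close> is a third weight, half the sum of the other two, and the basis is \<open>\<alpha>\<close> and \<open>\<gamma> - \<alpha>\<close>.
  The map \<open>\<theta>\<close> restricts characters to the scaling action.\<close>

lemma plane_exponents:
  fixes b :: bool and \<psi> :: "weight"
  obtains \<alpha> \<beta> \<gamma> :: "weight" and \<iota> \<theta>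
  where "\<gamma> + \<gamma> = \<alpha> + \<beta> \<or> b" "\<iota> 0 = 0" "\<forall>m n. \<iota> (m + n) = \<iota> m + \<iota> n"
    "\<iota> \<alpha> = \<beta>" "\<iota> \<beta> = \<alpha>" "\<iota> \<gamma> = \<gamma>" "keys \<alpha> \<subseteq> {..<2}" "keys \<beta> \<subseteq> {..<2}" "keys \<gamma> \<subseteq> {..<2}"
    "\<forall>S m. keys m \<subseteq> {..<2} \<longrightarrow> 0 \<in> S \<longrightarrow> (\<forall>a\<in>S. \<forall>b\<in>S. a + b \<in> S) \<longrightarrow>
      (\<forall>a\<in>S. - a \<in> S) \<longrightarrow> \<alpha> \<in> S \<longrightarrow> \<beta> \<in> S \<longrightarrow> (b \<or> \<gamma> \<in> S) \<longrightarrow> m \<in> S"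
    "\<alpha> \<noteq> \<beta>" "\<theta> 0 = (0 :: weight)" "\<forall>m n. \<theta> (m + n) = \<theta> m + \<theta> n" "\<theta> \<alpha> = \<psi>" "\<theta> \<beta> = \<psi>" "\<theta> \<gamma> = \<psi> \<or> b"
proof -
  define pr :: "int \<Rightarrow> int \<Rightarrow> weight" where "pr x y = single 0 x + single 1 y" for x y
  have l0: "lookup (pr x y) 0 = x" and l1: "lookup (pr x y) (Suc 0) = y" for x y
    by (simp_all add: pr_def lookup_add lookup_single)
  have keys: "keys (pr x y) \<subseteq> {..<2}" for x y
    using Poly_Mapping.keys_add[of "single 0 x" "single 1 y"] unfolding pr_def
    by (rule subset_trans) simp
  have add: "pr x y + pr x' y' = pr (x + x') (y + y')" for x y x' y'
    by (simp add: pr_def single_add)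
  have zero: "pr 0 0 = 0" by (simp add: pr_def)
  have basis: "m \<in> S" if m: "keys m \<subseteq> {..<2}" and S: "0 \<in> S" "\<And>a b. a \<in> S \<Longrightarrow> b \<in> S \<Longrightarrow> a + b \<in> S" "\<And>a. a \<in> S \<Longrightarrow> - a \<in> S"
    and "pr 1 0 \<in> S" "pr 0 1 \<in> S" for m and S :: "weight set"
  proof -
    have 01: "single 0 1 \<in> S" "single 1 1 \<in> S" using that(5,6) by (simp_all add: pr_def)
    show ?thesis
      by (subst two_variable_exponent[OF m])
        (rule S(2)[OF subgroup_multiple[OF S 01(1)] subgroup_multiple[OF S 01(2)]])
  qed
  show ?thesis
  proof (cases b)
    case True
    show ?thesis
    \<comment> \<open>\<iota> exchanges the two coordinates. Exponents themselves form a ring, in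
      which multiplication by \<open>of_int\<close> is taking an integer multiple.\<close>
    proof (rule that[where \<gamma> = 0 and \<alpha> = "pr 1 0" and \<beta> = "pr 0 1"
          and \<iota> = "\<lambda>m. pr (lookup m 1) (lookup m 0)" and \<theta> = "\<lambda>m. of_int (lookup m 0 + lookup m 1) * \<psi>"])
      show "pr 1 0 \<noteq> pr 0 1" using l0[of 1 0] l0[of 0 1] by auto
      show "\<forall>S m. keys m \<subseteq> {..<2} \<longrightarrow> 0 \<in> S \<longrightarrow> (\<forall>a\<in>S. \<forall>b\<in>S. a + b \<in> S) \<longrightarrow>
        (\<forall>a\<in>S. - a \<in> S) \<longrightarrow> pr 1 0 \<in> S \<longrightarrow> pr 0 1 \<in> S \<longrightarrow> (b \<or> 0 \<in> S) \<longrightarrow> m \<in> S"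
        using basis by blast
    qed (use True in \<open>simp_all add: l0 l1 add zero lookup_add algebra_simps keys\<close>)
  next
    case False
    show ?thesis
    \<comment> \<open>\<iota> is the reflection that fixes \<gamma> = (1, 1) and exchanges (1, 0)
      with (1, 2); all three weights have first coordinate 1, which \<theta> reads off.\<close>
    proof (rule that[where \<gamma> = "pr 1 1" and \<alpha> = "pr 1 0" and \<beta> = "pr 1 2"
          and \<iota> = "\<lambda>m. pr (lookup m 0) (2 * lookup m 0 - lookup m 1)" and \<theta> = "\<lambda>m. of_int (lookup m 0) * \<psi>"])
      show "pr 1 0 \<noteq> pr 1 2" using l1[of 1 0] l1[of 1 2] by auto
      show "\<forall>S m. keys m \<subseteq> {..<2} \<longrightarrow> 0 \<in> S \<longrightarrow> (\<forall>a\<in>S. \<forall>b\<in>S. a + b \<in> S) \<longrightarrow>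
        (\<forall>a\<in>S. - a \<in> S) \<longrightarrow> pr 1 0 \<in> S \<longrightarrow> pr 1 2 \<in> S \<longrightarrow> (b \<or> pr 1 1 \<in> S) \<longrightarrow> m \<in> S"
      proof (intro allI impI)
        fix S and m :: "weight"
        assume S: "0 \<in> S" "\<forall>a\<in>S. \<forall>b\<in>S. a + b \<in> S" "\<forall>a\<in>S. - a \<in> S"
          and m: "keys m \<subseteq> {..<2}" and \<alpha>: "pr 1 0 \<in> S" and \<gamma>: "b \<or> pr 1 1 \<in> S"
        have "pr 1 1 + - pr 1 0 \<in> S"
          using S(2,3) \<alpha> \<gamma> False by blast
        moreover have "pr 1 1 = pr 1 0 + pr 0 1" by (simp add: add)
        ultimately have "pr 0 1 \<in> S" by simp
        then show "m \<in> S" using basis[OF m S(1) _ _ \<alpha>] S(2,3) by blast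
      qed
    qed (simp_all add: l0 l1 add zero lookup_add algebra_simps keys)
  qed
qed

section \<open>Consequences of the presentation for the radical, the form and the number of
  variables\<close>

context presentation
begin

lemma ring_ideal_image: "ring_ideal (\<phi> ` order_ge d)"
  unfolding ring_ideal_iff
proof (intro conjI ballI allI)
  show "0 \<in> \<phi> ` order_ge d"
    using phi.zero by (intro image_eqI[of _ _ 0]) auto
  show "a + b \<in> \<phi> ` order_ge d" if "a \<in> \<phi> ` order_ge d" "b \<in> \<phi> ` order_ge d" for a b
    using that by (auto simp: add_in_order_ge simp flip: phi.add)
  show "a * b \<in> \<phi> ` order_ge d" if "b \<in> \<phi> ` order_ge d" for a b
  proof -
    obtain f where "\<phi> f = a" using phi_ex by metis
    with that show ?thesis
      by (auto simp: mult_in_order_ge2 simp flip: phi.mult)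
  qed
qed

text \<open>An element with constant term k \<noteq> 0 differs from k by an element of the ideal, so
  any ideal containing both contains a unit.\<close>

lemma maximal_ideal_image:
  assumes "q \<in> order_ge 1" "1 \<le> l"
  shows "maximal_ideal (\<phi> ` order_ge 1)"
  unfolding maximal_ideal_def
proof (intro conjI allI impI)
  show "ring_ideal (\<phi> ` order_ge 1)" by (rule ring_ideal_image)
  show "\<phi> ` order_ge 1 \<noteq> UNIV"
  proof
    assume "\<phi> ` order_ge 1 = UNIV"
    then obtain f where f: "f \<in> order_ge 1" "\<phi> f = 1" by (metis UNIV_I imageE)
    then have "\<phi> (1 - f) = 0" by (simp add: phi.diff phi.one)
    then have "1 - f \<in> order_ge 1" by (rule kernel_order_ge[OF assms])
    then have "(1 - f) + f \<in> order_ge 1" using f(1) by (rule add_in_order_ge)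
    then have "lookup (1 :: ('n, 'k) mpoly) 0 = 0" by (intro order_geD[of _ 1]) simp_all
    then show False by (simp add: lookup_one)
  qed
  fix K assume K: "ring_ideal K \<and> \<phi> ` order_ge 1 \<subseteq> K"
  show "K = \<phi> ` order_ge 1 \<or> K = UNIV"
  proof (rule disjCI)
    assume "K \<noteq> UNIV"
    show "K = \<phi> ` order_ge 1"
    proof (rule ccontr)
      assume "K \<noteq> \<phi> ` order_ge 1"
      then obtain a where a: "a \<in> K" "a \<notin> \<phi> ` order_ge 1" using K by blast
      obtain f where f: "\<phi> f = a" using surj by (metis surjD)
      define k where "k = lookup f 0"
      have diff: "f - mp_const k \<in> order_ge 1"
        unfolding One_nat_def
      proof (rule order_ge_Suc)
        show "lookup (f - mp_const k) m = 0" if "mdeg m = 0" for m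
          using that by (simp add: mdeg_eq_0 lookup_minus mp_const_def k_def)
      qed simp
      have "k \<noteq> 0"
        using diff a(2) f by (auto simp: mp_const_def)
      have "\<phi> (f - mp_const k) \<in> K" using diff K by blast
      then have "a + (- 1) * \<phi> (f - mp_const k) \<in> K"
        using K a(1) unfolding ring_ideal_iff by blast
      then have "smul k 1 \<in> K" by (simp add: phi.diff f phi_const)
      then have "smul (1 / k) 1 * smul k 1 \<in> K"
        using K unfolding ring_ideal_iff by blast
      then have "1 \<in> K"
        using \<open>k \<noteq> 0\<close> by (simp flip: smul_eq)
      then have "b * 1 \<in> K" for b
        using K unfolding ring_ideal_iff by blast
      then show False using \<open>K \<noteq> UNIV\<close> by auto
    qed
  qed
qed

text \<open>The radical lies in the maximal ideal just found, and a product of two elements of order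
  1 has order 2. The square unfolds to J (J A), which explains the intermediate product with
  \<open>UNIV\<close>.\<close>

lemma jacobson_power_subset:
  assumes "q \<in> order_ge 1" "1 \<le> l"
  shows "ideal_pow jacobson_radical 2 \<subseteq> \<phi> ` order_ge 2"
proof -
  have jac: "jacobson_radical \<subseteq> \<phi> ` order_ge 1"
    unfolding jacobson_radical_def using maximal_ideal_image[OF assms] by blast
  have "ideal_prod jacobson_radical UNIV \<subseteq> \<phi> ` order_ge 1"
    unfolding ideal_prod_def
  proof (rule ideal_gen_minimal[OF _ ring_ideal_image])
    show "{a * b |a b. a \<in> jacobson_radical \<and> b \<in> UNIV} \<subseteq> \<phi> ` order_ge 1"
      using jac ring_ideal_image[of 1] unfolding ring_ideal_iff by (auto simp: mult.commute)
  qed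
  then have "{a * b |a b. a \<in> jacobson_radical \<and> b \<in> ideal_prod jacobson_radical UNIV} \<subseteq>
      {\<phi> f * \<phi> g | f g. f \<in> order_ge 1 \<and> g \<in> order_ge 1}"
    using jac by blast
  also have "\<dots> \<subseteq> \<phi> ` order_ge 2"
    using mult_in_order_ge[of _ 1 _ 1] by (auto simp: numeral_2_eq_2 simp flip: phi.mult)
  finally show ?thesis
    unfolding numeral_2_eq_2 ideal_pow.simps ideal_prod_def[of _ "ideal_prod _ _"]
    by (intro ideal_gen_minimal ring_ideal_image)
qed

text \<open>The hypothesis yields a vanishing class in the cotangent space. The kernel has order at
  least 2, so a linear form whose class vanishes has zero coefficients.\<close>

lemma anisotropic_form:
  assumes an: "anisotropic_on_cotangent smul (\<lambda>i. \<phi> (mp_var i)) q"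
    and q: "quadratic_form q" and l: "2 \<le> l" and v: "mp_eval id v q = 0"
  shows "v = (\<lambda>_. 0)"
proof -
  have q2: "q \<in> order_ge 2" by (rule quadratic_form_order_ge[OF q])
  then have q1: "q \<in> order_ge 1" using order_ge_mono[of 1 2] by auto
  have "(\<Sum>i\<in>UNIV. smul (v i) (\<phi> (mp_var i))) \<in> ideal_pow jacobson_radical 2"
    using an v by (simp add: anisotropic_on_cotangent_def)
  then obtain f where f: "f \<in> order_ge 2" "\<phi> (linear_form v) = \<phi> f"
    using jacobson_power_subset[OF q1] l by (auto simp: linear_form_def phi.sum phi_scale)
  then have "\<phi> (linear_form v - f) = 0" by (simp add: phi.diff)
  then have "linear_form v - f \<in> order_ge 2" by (rule kernel_order_ge[OF q2 l])
  then have "(linear_form v - f) + f \<in> order_ge 2" using f(1) by (rule add_in_order_ge)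
  then have "lookup (linear_form v) (single i (Suc 0)) = 0" for i
    by (intro order_geD[of _ 2]) simp_all
  then show ?thesis by (simp add: lookup_linear_form fun_eq_iff)
qed

text \<open>In one variable \<open>q\<close> would generate the square of the maximal ideal, against \<open>l > 2\<close>.\<close>

lemma two_variables:
  assumes q: "quadratic_form q" and aniso: "\<And>v. mp_eval id v q = 0 \<Longrightarrow> v = (\<lambda>_. 0)" and two: "(2 :: 'k) \<noteq> 0"
    and loewy: "loewy_length {f. \<phi> f = 0} l" and l: "2 < l"
  shows "\<exists>i j :: 'n. i \<noteq> j"
proof (rule ccontr)
  assume "\<not> ?thesis"
  then have eq: "i = j" for i j :: 'n by blast
  obtain Q where Q: "q = quad_poly Q" using quadratic_form_matrix[OF q two] by metis
  obtain i :: 'n where True by simp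
  have U: "UNIV = {i}" using eq by blast
  \<comment> \<open>Otherwise q = 0 and the vector 1 is isotropic. So the square of the only
    variable is 0 in A, and l would be 2.\<close>
  have "Q $ i $ i \<noteq> 0"
  proof
    assume "Q $ i $ i = 0"
    then have "mp_eval id (\<lambda>_. 1) q = 0"
      unfolding Q eval_quad_poly by (simp add: dotp_def matrix_vector_mult_def U)
    from aniso[OF this] show False by (simp add: fun_eq_iff)
  qed
  moreover have "smul (Q $ i $ i) (\<phi> (mp_var i * mp_var i)) = 0"
    using phi_q unfolding Q quad_poly_def by (simp add: U phi_scale)
  ultimately have sq: "\<phi> (mp_var i * mp_var i) = 0" by simp
  have "\<phi> f = 0" if "f \<in> order_ge 2" for f
    using that
  proof (induction rule: order_ge_induct)
    case (single m c)
    then have "Suc 1 \<le> mdeg m" by simp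
    then obtain a m' where m: "single m c = mp_var a * single m' c" "1 \<le> mdeg m'"
      by (rule single_factor_var)
    then have "Suc 0 \<le> mdeg m'" by simp
    then obtain b m'' where m': "single m' c = mp_var b * single m'' c"
      by (rule single_factor_var)
    have "single m c = (mp_var i * mp_var i) * single m'' c"
      by (simp add: m(1) m' eq[of a i] eq[of b i] mult.assoc)
    then show ?case by (simp only: phi.mult[of "mp_var i * mp_var i"] sq mult_zero_left)
  qed (simp_all add: phi.zero phi.add)
  then have "2 \<le> (2::nat) \<and> ideal_pow var_ideal 2 \<subseteq> {f. \<phi> f = 0} \<and> {f. \<phi> f = 0} \<subseteq> ideal_pow var_ideal 2"
    using loewy by (auto simp: loewy_length_def is_arg_min_def ideal_pow_var_ideal)
  with loewy l show False
    by (auto simp: loewy_length_def is_arg_min_def)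
qed

end

lemma eval_gl_relation:
  assumes "rhom h"
  shows "mp_eval h (gl_point M d) gl_relation = d * det M - 1"
proof -
  interpret h: rhom h by fact
  interpret ev: rhom "mp_eval h (gl_point M d)" by (rule rhom_mp_eval[OF assms])
  have "map_matrix (mp_eval h (gl_point M d)) (var_matrix (\<lambda>v. v)) = M"
    by (simp add: vec_eq_iff map_matrix_def var_matrix_def h.eval_var gl_point_def)
  then show ?thesis
    by (simp add: gl_relation_def ev.diff ev.mult ev.det ev.one h.eval_var) (simp add: gl_point_def)
qed

theorem theorem7:
  fixes smul :: "'k::field \<Rightarrow> 'a::comm_ring_1 \<Rightarrow> 'a"
    and e :: "'m::finite \<Rightarrow> 'a"
    and \<phi> :: "('n::finite, 'k) mpoly \<Rightarrow> 'a"
    and q :: "('n, 'k) mpoly"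
    and l :: nat
  assumes "perfect_field TYPE('k)"
    and "CHAR('k) \<noteq> 2"
    and "comm_algebra smul"
    and "comm_algebra.is_basis smul e"
    and "split_local smul"
    and "quotient_dim smul (jacobson_radical :: 'a set) (ideal_pow jacobson_radical 2) CARD('n)"
    and "quadratic_form q"
    and "algebra_hom mp_scale smul \<phi>"
    and "surj \<phi>"
    and "{f. \<phi> f = 0} = {f + g | f g. f \<in> ideal_pow var_ideal l \<and> g \<in> ideal_gen {q}}"
    and "loewy_length {f. \<phi> f = 0} l"
    and "l > 2"
    and "anisotropic_on_cotangent smul (\<lambda>i. \<phi> (mp_var i)) q"
  shows "\<not> k_split_group (identity_component (comm_algebra.aut_ideal smul e))"
proof
  assume "k_split_group (identity_component (comm_algebra.aut_ideal smul e))"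
  then obtain T where T: "maximal_torus_of (identity_component (comm_algebra.aut_ideal smul e)) T" "split_torus T"
    unfolding k_split_group_def by blast
  interpret A: comm_algebra smul by (rule assms(3))
  interpret P: presentation smul e \<phi> q l
  proof
    show "{f. \<phi> f = 0} = {f + g | f g. f \<in> order_ge l \<and> g \<in> ideal_gen {q}}"
      using assms(10) by (simp only: ideal_pow_var_ideal)
  qed (rule assms)+
  obtain N :: "'k laurent^'m^'m" and c where N: "{f. mp_eval (single 0) (gl_point N c) f = 0} = T"
    and comult: "\<forall>i j. push_forward (\<lambda>m. (m, m)) (N $ i $ j) =
        (\<Sum>k\<in>UNIV. push_forward (\<lambda>m. (m, 0)) (N $ i $ k) * push_forward (\<lambda>m. (0, m)) (N $ k $ j))"
    using T(2) unfolding split_torus_def by blast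
  have "gl_relation \<in> T"
    using T(2) by (simp add: split_torus_def closed_subgroup_def)
  then have "mp_eval (single 0) (gl_point N c) gl_relation = 0"
    unfolding N[symmetric] by simp
  then have inv: "c * det N = 1"
    by (simp add: eval_gl_relation[OF rhom_single])
  have G: "identity_component (A.aut_ideal e) \<subseteq> T"
    using T(1) by (simp add: maximal_torus_of_def)
  have aut: "A.tensor_aut e (single 0) N"
  proof -
    interpret s: rhom "single 0 :: 'k \<Rightarrow> 'k laurent" by (rule rhom_single)
    have "\<forall>f\<in>A.aut_ideal e. mp_eval (single 0) (gl_point N c) f = 0"
      using subset_identity_component G N by blast
    then show ?thesis
      using A.aut_ideal_points[OF s.add s.mult s.one] by blast
  qed
  \<comment> \<open>If 2 = 0, the characteristic divides 2 and hence is 1 or 2; neither is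
    possible.\<close>
  have two: "(2 :: 'k) \<noteq> 0"
  proof
    assume "(2 :: 'k) = 0"
    then have "of_nat 2 = (0 :: 'k)" by simp
    then have dvd: "CHAR('k) dvd 2" by (simp only: of_nat_eq_0_iff_char_dvd)
    then have "CHAR('k) \<le> 2" by (rule dvd_imp_le) simp
    moreover have "CHAR('k) \<noteq> 0" using dvd by (metis dvd_0_left_iff zero_neq_numeral)
    ultimately show False using assms(2) CHAR_not_1[where ?'a = 'k] by linarith
  qed
  have aniso: "v = (\<lambda>_. 0)" if "mp_eval id v q = 0" for v :: "'n \<Rightarrow> 'k"
    using P.anisotropic_form[OF assms(13,7) _ that] assms(12) by simp
  obtain i j :: 'n where ij: "i \<noteq> j"
    using P.two_variables[OF assms(7) aniso two assms(11,12)] by blast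
  interpret action: torus_action smul e \<phi> q l N c
    by standard (use inv comult aut assms(7,12) aniso two in
      \<open>auto simp: vec_eq_iff map_matrix_def matrix_matrix_mult_def\<close>)
  obtain \<phi>' \<psi> where pres: "presentation smul e \<phi>' q l"
    and scaling: "presentation.scaling_matrix smul e \<phi>' \<psi> N"
    by (rule action.scaling_presentation)
  obtain Q where Q: "transpose Q = Q" "q = quad_poly Q"
    by (rule quadratic_form_matrix[OF assms(7) two])
  have anisoQ: "v = 0" if "dotp v (Q *v v) = 0" for v
    using aniso[of "\<lambda>i. v $ i"] that unfolding Q(2) eval_quad_poly
    by (simp add: vec_lambda_eta fun_eq_iff vec_eq_iff)
  obtain v1 v2 p1 p2 Q1 t where plane: "dotp p1 v1 = 1" "dotp p1 v2 = 0" "dotp p2 v1 = 0" "dotp p2 v2 = 1"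
    "Q *v v1 = Q1 *s p1" "Q *v v2 = (- t * Q1) *s p2" "t \<noteq> 0" "\<And>x. x * x \<noteq> t"
    using orthogonal_plane[OF Q(1) anisoQ ij] by metis
  obtain s :: "'k alg_closure" where s: "s ^ 2 = to_ac t"
    using nth_root_exists[of 2 "to_ac t"] by auto
  have two': "(2 :: 'k alg_closure) \<noteq> 0"
    using two by (metis to_ac_eq_0_iff to_ac_numeral)
  interpret to: rhom "to_ac :: 'k \<Rightarrow> _" by (rule rhom_to_ac)
  interpret rot: rotation_plane to_ac Q v1 v2 p1 p2 Q1 t s
    by standard (use plane Q(1) s two' in \<open>simp_all add: power2_eq_square\<close>)
  obtain \<alpha> \<beta> \<gamma> :: "weight" and \<iota> \<theta>
    where ex: "\<gamma> + \<gamma> = \<alpha> + \<beta> \<or> rot.E0 = 0" "\<iota> 0 = 0" "\<forall>m n. \<iota> (m + n) = \<iota> m + \<iota> n"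
      "\<iota> \<alpha> = \<beta>" "\<iota> \<beta> = \<alpha>" "\<iota> \<gamma> = \<gamma>" "keys \<alpha> \<subseteq> {..<2}" "keys \<beta> \<subseteq> {..<2}" "keys \<gamma> \<subseteq> {..<2}"
      "\<forall>S m. keys m \<subseteq> {..<2} \<longrightarrow> 0 \<in> S \<longrightarrow> (\<forall>a\<in>S. \<forall>b\<in>S. a + b \<in> S) \<longrightarrow>
        (\<forall>a\<in>S. - a \<in> S) \<longrightarrow> \<alpha> \<in> S \<longrightarrow> \<beta> \<in> S \<longrightarrow> (rot.E0 = 0 \<or> \<gamma> \<in> S) \<longrightarrow> m \<in> S"
      "\<alpha> \<noteq> \<beta>"
    and th: "\<theta> 0 = (0 :: weight)" "\<forall>m n. \<theta> (m + n) = \<theta> m + \<theta> n" "\<theta> \<alpha> = \<psi>" "\<theta> \<beta> = \<psi>"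
      "\<theta> \<gamma> = \<psi> \<or> rot.E0 = 0"
    by (rule plane_exponents[where b = "rot.E0 = 0" and \<psi> = \<psi>])
  interpret P': presentation smul e \<phi>' q l by (rule pres)
  \<comment> \<open>The larger torus is built on \<phi>' because T acts by scalars on its variables;
    in the original variables T need not act linearly.\<close>
  interpret D: torus_data smul e \<phi>' q l Q v1 v2 p1 p2 Q1 t s \<alpha> \<beta> \<gamma> \<iota>
  proof
    show "m \<in> S" if "keys m \<subseteq> {..<2}" "0 \<in> S" "\<And>a b. a \<in> S \<Longrightarrow> b \<in> S \<Longrightarrow> a + b \<in> S" "\<And>a. a \<in> S \<Longrightarrow> - a \<in> S"
      "\<alpha> \<in> S" "\<beta> \<in> S" "rot.E0 \<noteq> 0 \<Longrightarrow> \<gamma> \<in> S" for S m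
    proof -
      have "\<forall>a\<in>S. \<forall>b\<in>S. a + b \<in> S" "\<forall>a\<in>S. - a \<in> S" "rot.E0 = 0 \<or> \<gamma> \<in> S"
        using that(3,4,7) by blast+
      with ex(10)[THEN spec[of _ S], THEN spec[of _ m]] that(1,2,5,6) show ?thesis
        by (simp only: simp_thms)
    qed
  qed (use ex(1-9,11) Q(2) plane(8) assms(12) in simp_all)
  \<comment> \<open>As groups, T is contained in the larger torus; maximality turns the inclusion
    into an equality, which the relation f refutes.\<close>
  have "D.torus_ideal \<subseteq> T"
    using D.torus_ideal_vanishes_on_scaling[OF scaling inv th(1) th(2)[rule_format] th(3-5)] N by blast
  then have "D.torus_ideal = T"
    using T(1) D.torus_torus_ideal D.identity_component_subset_torus unfolding maximal_torus_of_def by blast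
  moreover obtain f where "f \<notin> D.torus_ideal" "mp_eval (single 0) (gl_point N c) f = 0"
    using D.scaling_relation scaling by metis
  ultimately show False
    using N by blast
qed

end
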